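(* Let $\mathcal B$ be a matrix Muckenhoupt basis in $\mathbb R^n$ (with associated functions $K_t$, $1<t<\infty$) and let $\mathcal F$ be a family of extrapolation pairs. Fix $s$ with $1\le s<\infty$. Suppose that for some $p_0,q_0$ with $1\le p_0\le q_0\le\infty$, where $\frac1{p_0}-\frac1{q_0}=\frac1{s'}$ and $r_0=\frac{q_0}s$, there exists a positive increasing function $N_{p_0,q_0}$ such that for every matrix weight $W_0$ with $W_0^s\in\mathcal A_{r_0,\mathcal B}$, $$\left(\int_{\mathbb R^n}|W_0(x)f(x)|^{q_0}\,dx\right)^{\frac1{q_0}}\le N_{p_0,q_0}\big([W_0^s]_{\mathcal A_{r_0,\mathcal B}}\big)\left(\int_{\mathbb R^n}|W_0(x)g(x)|^{p_0}\,dx\right)^{\frac1{p_0}},\qquad (f,g)\in\mathcal F.$$ Then for all $p,q$ such that $1<p\le q<\infty$, $\frac1p-\frac1q=\frac1{p_0}-\frac1{q_0}$, with $r=\frac qs$, and for all matrix weights $W$ with $W^s\in\mathcal A_{r,\mathcal B}$, $$\left(\int_{\mathbb R^n}|W(x)f(x)|^{q}\,dx\right)^{\frac1q}\le N_{p,q}(\mathcal B,p_0,q_0,p,q,[W^s]_{\mathcal A_{r,\mathcal B}})\left(\int_{\mathbb R^n}|W(x)g(x)|^{p}\,dx\right)^{\frac1p},\qquad (f,g)\in\mathcal F,$$ where $$N_{p,q}(\mathcal B,p_0,q_0,p,q,[W^s]_{\mathcal A_{r,\mathcal B}})=C(d,p_0,q_0,p,q)\,N_{p_0,q_0}\Big(C(d,p_0,q_0)\,K_{r'}\big([W^{-s}]_{\mathcal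 A_{r',\mathcal B}}\big)^{\frac1{r_0}}K_r\big([W^s]_{\mathcal A_{r,\mathcal B}}\big)^{\frac1{r_0'}}\Big),$$ with constants $C(\cdot)$ depending only on the listed parameters.
   Context: Family of extrapolation pairs: a family $\mathcal F$ of pairs $(f,g)$ of measurable functions $f,g:\mathbb R^n\to\mathbb R^d$ such that neither $f$ nor $g$ equals $0$ almost everywhere. An inequality written with "$(f,g)\in\mathcal F$" means that it holds for all pairs $(f,g)\in\mathcal F$ for which its left-hand side is finite, with constant independent of the pair. For $1\le t\le\infty$, $t'$ is the conjugate exponent, $\frac1t+\frac1{t'}=1$, with $\frac1\infty=0$; integral expressions with exponent $\infty$ are read as essential suprema, and $r_0=\infty$ if $q_0=\infty$. $|v|$ is the Euclidean norm of $v\in\mathbb R^d$, and $|A|_{\mathrm{op}}=\sup_{|v|=1}|Av|$. Matrix weight: a measurable function $W$ on $\mathbb R^n$ with values in the $d\times d$ real symmetric positive semidefinite matrices, with entries finite a.e. and $W(x)$ invertible for a.e. $x$. Powers $W^t$ are defined by diagonalization: if $W=U^{*}\mathrm{diag}(\lambda_i)U$ with $U$ orthogonal, then $W^t=U^{*}\mathrm{diag}(\lambda_i^t)U$. Basis: a collection $\mathcal B$ of nonempty open subsets of $\mathbb R^n$ of finite measure. Classes $\mathcal A_{r,\mathcal B}$: for $1<r<\infty$, $W\in\mathcal A_{r,\mathcal B}$ if $$[W]_{\mathcal A_{r,\mathcal B}}=\sup_{B\in\mathcal B}\left(\frac1{|B|}\int_B\left(\frac1{|B|}\int_B|W(x)W^{-1}(y)|_{\mathrm{op}}^{r'}\,dy\right)^{\frac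 r{r'}}dx\right)^{\frac1r}<\infty;$$ $W\in\mathcal A_{1,\mathcal B}$ if $[W]_{\mathcal A_{1,\mathcal B}}=\sup_{B\in\mathcal B}\operatorname{ess\,sup}_{x\in B}\frac1{|B|}\int_B|W^{-1}(x)W(y)|_{\mathrm{op}}\,dy<\infty$; $W\in\mathcal A_{\infty,\mathcal B}$ if $[W]_{\mathcal A_{\infty,\mathcal B}}=\sup_{B\in\mathcal B}\operatorname{ess\,sup}_{x\in B}\frac1{|B|}\int_B|W(x)W^{-1}(y)|_{\mathrm{op}}\,dy<\infty$. Christ–Goldberg maximal operator: $M_{W,\mathcal B}f(x)=\sup_{B\in\mathcal B}\frac1{|B|}\int_B|W(x)W^{-1}(y)f(y)|\,dy\cdot\chi_B(x)$ for $f:\mathbb R^n\to\mathbb R^d$. Matrix Muckenhoupt basis: a basis $\mathcal B$ such that (in every dimension $d\ge1$) for every $1<p<\infty$ there is an increasing function $K_p$ (which may also depend on $d,n,p$) such that for every matrix weight $W\in\mathcal A_{p,\mathcal B}$, $M_{W,\mathcal B}:L^p(\mathbb R^n,\mathbb R^d)\to L^p(\mathbb R^n)$ with $$\|M_{W,\mathcal B}f\|_{L^p(\mathbb R^n)}\le K_p([W]_{\mathcal A_{p,\mathcal B}})\|f\|_{L^p(\mathbb R^n,\mathbb R^d)}.$$ *)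

theory Defs
  imports
    "HOL-Probability.Essential_Supremum"
    "Jordan_Normal_Form.Gauss_Jordan_Elimination"
begin

text \<open>
  Both dimensions, \<open>n\<close> of the underlying space and \<open>d\<close> of the values, are natural numbers, so that
  one can quantify over them inside a formula: a Muckenhoupt basis is defined by a condition in
  every \<open>d\<close>, and the constants of the theorem must not depend on \<open>n\<close>.  A point of \<open>R^n\<close> is an
  extensional function on \<open>{..<n}\<close>; a vector of \<open>R^d\<close> is a \<open>real vec\<close> in \<open>carrier_vec d\<close>.
\<close>

definition leb :: "nat \<Rightarrow> (nat \<Rightarrow> real) measure" where
  "leb n = completion (Pi\<^sub>M {..<n} (\<lambda>_. lborel))"

definition euclid_top :: "nat \<Rightarrow> (nat \<Rightarrow> real) topology" where
  "euclid_top n = product_topology (\<lambda>_. euclidean) {..<n}"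

text \<open>In \<open>ereal\<close> we have \<open>1 / \<infinity> = 0\<close> and \<open>1 / 0 = \<infinity>\<close>, so this also covers \<open>t = 1\<close> and \<open>t = \<infinity>\<close>.\<close>

definition conj_exp :: "ereal \<Rightarrow> ereal" where
  "conj_exp t = 1 / (1 - 1 / t)"

lemma conj_exp_1 [simp]: "conj_exp 1 = \<infinity>"
  by (simp add: conj_exp_def one_ereal_def divide_ereal_def)

lemma conj_exp_infinity [simp]: "conj_exp \<infinity> = 1"
  by (simp add: conj_exp_def)

lemma conj_exp_ereal: "1 < t \<Longrightarrow> conj_exp (ereal t) = ereal (t / (t - 1))"
  by (simp add: conj_exp_def one_ereal_def divide_ereal_def field_simps)

text \<open>Only used with exponents \<open>a > 0\<close>.\<close>

definition epowr :: "ennreal \<Rightarrow> real \<Rightarrow> ennreal" where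
  "epowr x a = (if x = \<infinity> then \<infinity> else ennreal (enn2real x powr a))"

definition Lp_norm :: "'a measure \<Rightarrow> ereal \<Rightarrow> ('a \<Rightarrow> ennreal) \<Rightarrow> ennreal" where
  "Lp_norm M p h =
     (if p = \<infinity> then esssup M h
      else epowr (\<integral>\<^sup>+ x. epowr (h x) (real_of_ereal p) \<partial>M) (1 / real_of_ereal p))"

definition avg :: "'a measure \<Rightarrow> 'a set \<Rightarrow> ('a \<Rightarrow> ennreal) \<Rightarrow> ennreal" where
  "avg M B h = (\<integral>\<^sup>+ x\<in>B. h x \<partial>M) / emeasure M B"

definition esssup_on :: "'a measure \<Rightarrow> 'a set \<Rightarrow> ('a \<Rightarrow> ennreal) \<Rightarrow> ennreal" where
  "esssup_on M B h = esssup (restrict_space M B) h"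

definition vnorm :: "real vec \<Rightarrow> real" where
  "vnorm v = sqrt (scalar_prod v v)"

definition op_norm :: "real mat \<Rightarrow> real" where
  "op_norm A = (SUP v \<in> {v \<in> carrier_vec (dim_col A). vnorm v = 1}. vnorm (A *\<^sub>v v))"

definition psd_mat :: "nat \<Rightarrow> real mat set" where
  "psd_mat d = {A \<in> carrier_mat d d. transpose_mat A = A \<and>
     (\<forall>v \<in> carrier_vec d. 0 \<le> scalar_prod v (A *\<^sub>v v))}"

text \<open>The value at singular matrices is a dummy; for a matrix weight it is attained on a null set only.\<close>

definition minv :: "real mat \<Rightarrow> real mat" where
  "minv A = (case mat_inverse A of Some B \<Rightarrow> B | None \<Rightarrow> 0\<^sub>m (dim_row A) (dim_col A))"

text \<open>
  The choice of the diagonalization does not affect the result.  As \<open>0 powr t = 0\<close>, for \<open>t < 0\<close> the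
  value at a singular matrix is again a dummy.
\<close>

definition mat_powr :: "real mat \<Rightarrow> real \<Rightarrow> real mat" where
  "mat_powr A t = (SOME P. \<exists>U l. U \<in> carrier_mat (dim_row A) (dim_row A) \<and>
     transpose_mat U * U = 1\<^sub>m (dim_row A) \<and>
     A = transpose_mat U * mat_diag (dim_row A) l * U \<and>
     P = transpose_mat U * mat_diag (dim_row A) (\<lambda>i. l i powr t) * U)"

definition vec_measurable :: "nat \<Rightarrow> nat \<Rightarrow> ((nat \<Rightarrow> real) \<Rightarrow> real vec) \<Rightarrow> bool" where
  "vec_measurable n d f \<longleftrightarrow> (\<forall>x \<in> space (leb n). f x \<in> carrier_vec d) \<and>
     (\<forall>i<d. (\<lambda>x. vec_index (f x) i) \<in> borel_measurable (leb n))"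

definition matrix_weight :: "nat \<Rightarrow> nat \<Rightarrow> ((nat \<Rightarrow> real) \<Rightarrow> real mat) \<Rightarrow> bool" where
  "matrix_weight n d W \<longleftrightarrow> (\<forall>x \<in> space (leb n). W x \<in> psd_mat d) \<and>
     (\<forall>i<d. \<forall>j<d. (\<lambda>x. W x $$ (i, j)) \<in> borel_measurable (leb n)) \<and>
     (AE x in leb n. invertible_mat (W x))"

definition basis :: "nat \<Rightarrow> (nat \<Rightarrow> real) set set \<Rightarrow> bool" where
  "basis n \<B> \<longleftrightarrow> (\<forall>B \<in> \<B>. openin (euclid_top n) B \<and> B \<noteq> {} \<and> emeasure (leb n) B < \<infinity>)"

definition A_const ::
  "nat \<Rightarrow> (nat \<Rightarrow> real) set set \<Rightarrow> ereal \<Rightarrow> ((nat \<Rightarrow> real) \<Rightarrow> real mat) \<Rightarrow> ennreal" where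
  "A_const n \<B> r W =
     (if r = 1 then
        SUP B \<in> \<B>. esssup_on (leb n) B (\<lambda>x. avg (leb n) B (\<lambda>y. ennreal (op_norm (minv (W x) * W y))))
      else if r = \<infinity> then
        SUP B \<in> \<B>. esssup_on (leb n) B (\<lambda>x. avg (leb n) B (\<lambda>y. ennreal (op_norm (W x * minv (W y)))))
      else
        let t = real_of_ereal r; t' = real_of_ereal (conj_exp r) in
        SUP B \<in> \<B>. epowr
          (avg (leb n) B (\<lambda>x. epowr
             (avg (leb n) B (\<lambda>y. epowr (ennreal (op_norm (W x * minv (W y)))) t')) (t / t')))
          (1 / t))"

definition A_class ::
  "nat \<Rightarrow> nat \<Rightarrow> (nat \<Rightarrow> real) set set \<Rightarrow> ereal \<Rightarrow> ((nat \<Rightarrow> real) \<Rightarrow> real mat) set" where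
  "A_class n d \<B> r = {W. matrix_weight n d W \<and> A_const n \<B> r W < \<infinity>}"

definition maximal_op ::
  "nat \<Rightarrow> (nat \<Rightarrow> real) set set \<Rightarrow> ((nat \<Rightarrow> real) \<Rightarrow> real mat) \<Rightarrow>
   ((nat \<Rightarrow> real) \<Rightarrow> real vec) \<Rightarrow> (nat \<Rightarrow> real) \<Rightarrow> ennreal" where
  "maximal_op n \<B> W f x =
     (SUP B \<in> \<B>. avg (leb n) B (\<lambda>y. ennreal (vnorm ((W x * minv (W y)) *\<^sub>v f y))) * indicator B x)"

text \<open>
  \<open>K d p\<close> is the increasing function associated with the exponent \<open>p\<close> in dimension \<open>d\<close>; it is
  relevant on \<open>[0, \<infinity>)\<close> only.
\<close>

definition matrix_muckenhoupt_basis ::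
  "nat \<Rightarrow> (nat \<Rightarrow> real) set set \<Rightarrow> (nat \<Rightarrow> real \<Rightarrow> real \<Rightarrow> real) \<Rightarrow> bool" where
  "matrix_muckenhoupt_basis n \<B> K \<longleftrightarrow> basis n \<B> \<and>
     (\<forall>d\<ge>1. \<forall>p>1. mono_on {0..} (K d p) \<and> (\<forall>t\<ge>0. 0 \<le> K d p t) \<and>
       (\<forall>W \<in> A_class n d \<B> (ereal p). \<forall>f. vec_measurable n d f \<and>
          Lp_norm (leb n) (ereal p) (\<lambda>x. ennreal (vnorm (f x))) < \<infinity> \<longrightarrow>
          maximal_op n \<B> W f \<in> borel_measurable (leb n) \<and>
          Lp_norm (leb n) (ereal p) (maximal_op n \<B> W f)
            \<le> ennreal (K d p (enn2real (A_const n \<B> (ereal p) W))) *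
              Lp_norm (leb n) (ereal p) (\<lambda>x. ennreal (vnorm (f x)))))"

definition extrapolation_pairs ::
  "nat \<Rightarrow> nat \<Rightarrow> (((nat \<Rightarrow> real) \<Rightarrow> real vec) \<times> ((nat \<Rightarrow> real) \<Rightarrow> real vec)) set \<Rightarrow> bool" where
  "extrapolation_pairs n d \<F> \<longleftrightarrow> (\<forall>(f, g) \<in> \<F>.
     vec_measurable n d f \<and> vec_measurable n d g \<and>
     \<not> (AE x in leb n. f x = 0\<^sub>v d) \<and> \<not> (AE x in leb n. g x = 0\<^sub>v d))"

definition weighted_norm ::
  "nat \<Rightarrow> ereal \<Rightarrow> ((nat \<Rightarrow> real) \<Rightarrow> real mat) \<Rightarrow> ((nat \<Rightarrow> real) \<Rightarrow> real vec) \<Rightarrow> ennreal" where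
  "weighted_norm n p W f = Lp_norm (leb n) p (\<lambda>x. ennreal (vnorm (W x *\<^sub>v f x)))"

text \<open>The weighted inequality, required only of those pairs for which its left-hand side is finite.\<close>

definition pairs_ineq ::
  "nat \<Rightarrow> (((nat \<Rightarrow> real) \<Rightarrow> real vec) \<times> ((nat \<Rightarrow> real) \<Rightarrow> real vec)) set \<Rightarrow>
   ((nat \<Rightarrow> real) \<Rightarrow> real mat) \<Rightarrow> ereal \<Rightarrow> ereal \<Rightarrow> real \<Rightarrow> bool" where
  "pairs_ineq n \<F> W p q c \<longleftrightarrow> (\<forall>(f, g) \<in> \<F>. weighted_norm n q W f < \<infinity> \<longrightarrow>
     weighted_norm n q W f \<le> ennreal c * weighted_norm n p W g)"

end

theory Submission
  imports Defs "Jordan_Normal_Form.Spectral_Radius"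
begin

text \<open>
  Write \<open>V = W^s\<close>.  The relation between the exponents gives \<open>q = r s\<close> and \<open>p' = r' s\<close> for the
  conjugate exponent \<open>p'\<close> of \<open>p\<close>.  For each pair \<open>(f, g)\<close>, the hypothesis is tested on a single weight
  \<open>W0 = \<omega> W\<close>, where \<open>\<omega>\<close> is a \<^emph>\<open>scalar\<close> function that depends on the pair:
  \<open>\<omega>^s = a^(1/r0) b^(-1/r0')\<close>, with \<open>a\<close> in \<open>L^r'\<close> and \<open>b\<close> in \<open>L^r\<close>.

  \<^item> \<^emph>\<open>Choice of \<open>a\<close> and \<open>b\<close>.\<close>  Let \<open>F = |W f|\<close> and \<open>G = |W g|\<close>, normalized in \<open>L^q\<close> and
    \<open>L^p\<close>.  The functions \<open>F^(q-s)\<close> and \<open>F^s + G^(p/r)\<close> have norms of order one in \<open>L^r'\<close> and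
    \<open>L^r\<close>.  Applying the maximal operator to \<open>h e_i\<close> for the \<open>d\<close> unit vectors \<open>e_i\<close> bounds the
    sublinear operator \<open>h \<mapsto> sup_B avg_B |V(x) V(y)^-1| h(y)\<close> on \<open>L^r\<close>, and the Rubio de Francia
    series turns this bound into majorants \<open>b\<close> with \<open>avg_B |V(x) V(y)^-1| b(y) \<le> c2 b(x)\<close> for
    every \<open>B\<close> that contains \<open>x\<close>, where \<open>c2\<close> is a multiple of \<open>K_r\<close>
    (lemmas \<open>rubio_de_francia\<close> and \<open>majorant\<close>).  The same
    argument for \<open>V^-1\<close> in \<open>L^r'\<close> gives \<open>a\<close>, with a multiple \<open>c1\<close> of \<open>K_r'\<close>; that \<open>V^-1\<close> is in the
    class \<open>A_r'\<close> is lemma \<open>A_const_dual_finite\<close>.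

  \<^item> \<^emph>\<open>The weight is admissible.\<close>  These inequalities say that \<open>a V\<close> is in \<open>A_1\<close> and \<open>b^-1 V\<close> in
    \<open>A_\<infinity>\<close>, and \<open>W0^s\<close> is a geometric mean of the two.  In the scalar case the bound
    \<open>c1^(1/r0) c2^(1/r0')\<close> for its constant uses \<open>a(y)^-1 \<le> c1 v(y) / avg_B (a v)\<close>.  For
    matrices, \<open>avg_B a |V v|\<close> is a norm of the vector \<open>v\<close>; expanding in a basis \<open>u_i\<close> that is almost an
    Auerbach basis of it (lemmas \<open>near_auerbach_basis\<close> and \<open>reducing_basis\<close>) gives
    \<open>|V(x) V(y)^-1| \<le> 2 c1 a(y) \<alpha>(x)\<close> with \<open>\<alpha> = \<Sum>_i |V u_i|\<close> and \<open>avg_B a \<alpha> \<le> d\<close>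
    (lemma \<open>kernel_factorization\<close>), which serves the same purpose
    (lemma \<open>A_const_interior\<close>).

  \<^item> \<^emph>\<open>The scalar estimates.\<close>  After normalization \<open>1 = \<integral> F^q \<le> \<integral> F^s a\<close>, and Hoelder's inequality bounds
    this by a power of \<open>\<parallel>\<omega> F\<parallel>\<close> in \<open>L^q0\<close> times a power of \<open>\<integral> a b\<close>, while \<open>\<omega> G\<close> is dominated by a
    geometric mean of \<open>a^r'\<close> and \<open>b^r\<close> when raised to the power \<open>p0\<close>
    (locale \<open>extrapolation_majorants\<close>).  Since \<open>|W0 f| = \<omega> F\<close> and \<open>|W0 g| = \<omega> G\<close>, the
    hypothesis for \<open>W0\<close> links the two.

  Real powers of matrices are defined by an arbitrary choice of a diagonalization.  That
  \<open>(\<omega> W)^s = \<omega>^s W^s\<close> and \<open>W^(-s) = (W^s)^-1\<close> therefore requires the existence of a diagonalization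
  (\<open>spectral_theorem_real_symmetric\<close>) and the independence of the choice
  (\<open>diagonalization_function_unique\<close>).
\<close>

(* From here on, these symbols denote the scalar product and the entries of vectors whose dimension
   is a natural number, and top is the largest element of an order. *)
no_notation Inner_Product.real_inner_class.inner (infix "\<bullet>" 70)
no_notation Finite_Cartesian_Product.vec.vec_nth (infixl "$" 90)
hide_const (open) Order.top

section \<open>Euclidean norm, operator norm and inverse of a real matrix\<close>

lemma vnorm_L2: "vnorm v = L2_set (vec_index v) {0..<dim_vec v}"
  by (simp add: vnorm_def L2_set_def scalar_prod_def power2_eq_square)

lemma vnorm_nonneg [simp]: "0 \<le> vnorm v"
  by (simp add: vnorm_L2)

lemma vnorm_smult: "vnorm (c \<cdot>\<^sub>v v) = \<bar>c\<bar> * vnorm v"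
proof -
  have "L2_set (\<lambda>i. c * v $ i) {0..<dim_vec v} = \<bar>c\<bar> * L2_set (vec_index v) {0..<dim_vec v}"
    by (simp add: L2_set_def power_mult_distrib sum_distrib_left [symmetric] real_sqrt_mult)
  moreover have "L2_set (vec_index (c \<cdot>\<^sub>v v)) {0..<dim_vec v} = L2_set (\<lambda>i. c * v $ i) {0..<dim_vec v}"
    by (rule L2_set_cong) auto
  ultimately show ?thesis by (simp add: vnorm_L2)
qed

lemma vnorm_add:
  assumes "v \<in> carrier_vec n" "w \<in> carrier_vec n"
  shows "vnorm (v + w) \<le> vnorm v + vnorm w"
proof -
  have "L2_set (vec_index (v + w)) {0..<n} = L2_set (\<lambda>i. v $ i + w $ i) {0..<n}"
    using assms by (intro L2_set_cong) auto
  with L2_set_triangle_ineq [of "vec_index v" "vec_index w" "{0..<n}"] assms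
  show ?thesis by (simp add: vnorm_L2)
qed

lemma vnorm_zero [simp]: "vnorm (0\<^sub>v n) = 0"
  by (simp add: vnorm_def)

lemma vnorm_eq_0: "v \<in> carrier_vec n \<Longrightarrow> vnorm v = 0 \<longleftrightarrow> v = 0\<^sub>v n"
  by (auto simp: vnorm_L2 L2_set_eq_0_iff intro!: eq_vecI)

lemma vnorm_unit [simp]: "i < n \<Longrightarrow> vnorm (unit_vec n i) = 1"
  by (simp add: vnorm_def)

lemma vnorm_square: "vnorm v ^ 2 = v \<bullet> v"
  by (simp add: vnorm_def scalar_prod_def sum_nonneg)

lemma abs_index_le_vnorm:
  assumes "i < dim_vec v" shows "\<bar>v $ i\<bar> \<le> vnorm v"
proof -
  have "\<bar>v $ i\<bar> = sqrt ((v $ i)\<^sup>2)" by simp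
  also have "\<dots> \<le> vnorm v"
    unfolding vnorm_L2 L2_set_def real_sqrt_le_iff using assms
    by (intro member_le_sum) auto
  finally show ?thesis .
qed

lemma scalar_prod_le_vnorm:
  assumes "v \<in> carrier_vec n" "w \<in> carrier_vec n"
  shows "v \<bullet> w \<le> vnorm v * vnorm w"
proof -
  have "v \<bullet> w \<le> (\<Sum>i\<in>{0..<n}. \<bar>v $ i\<bar> * \<bar>w $ i\<bar>)"
    using assms unfolding scalar_prod_def by (auto simp: abs_mult [symmetric] intro!: sum_mono)
  also have "\<dots> \<le> vnorm v * vnorm w"
    using L2_set_mult_ineq [of "vec_index v" "vec_index w" "{0..<n}"] assms by (simp add: vnorm_L2)
  finally show ?thesis .
qed

lemma vnorm_finsum_le:
  fixes m :: nat
  assumes "\<And>i. i < m \<Longrightarrow> u i \<in> carrier_vec n"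
  shows "vnorm (vec n (\<lambda>k. \<Sum>i<m. t i * u i $ k)) \<le> (\<Sum>i<m. \<bar>t i\<bar> * vnorm (u i))"
  using assms
proof (induction m)
  case 0
  have "vec n (\<lambda>k. \<Sum>i<(0::nat). t i * u i $ k) = 0\<^sub>v n" by auto
  then show ?case by simp
next
  case (Suc m)
  have "vec n (\<lambda>k. \<Sum>i<Suc m. t i * u i $ k) = vec n (\<lambda>k. \<Sum>i<m. t i * u i $ k) + t m \<cdot>\<^sub>v u m"
    using Suc.prems[of m] by (intro eq_vecI) auto
  also have "vnorm \<dots> \<le> vnorm (vec n (\<lambda>k. \<Sum>i<m. t i * u i $ k)) + vnorm (t m \<cdot>\<^sub>v u m)"
    using Suc.prems[of m] by (intro vnorm_add[of _ n]) auto
  also have "\<dots> \<le> (\<Sum>i<Suc m. \<bar>t i\<bar> * vnorm (u i))"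
    using Suc.IH Suc.prems by (simp add: vnorm_smult)
  finally show ?case .
qed

lemma mult_unit_vec_index:
  fixes A :: "real mat"
  assumes "A \<in> carrier_mat m n" "i < m" "j < n"
  shows "(A *\<^sub>v unit_vec n j) $ i = A $$ (i, j)"
  using assms by simp

lemma mult_unit_vec_eq_col:
  fixes A :: "real mat"
  assumes "A \<in> carrier_mat m n" "i < n"
  shows "A *\<^sub>v unit_vec n i = col A i"
  using assms by (intro eq_vecI) auto

lemma mult_mat_vec_expand:
  fixes A :: "real mat"
  assumes "A \<in> carrier_mat m n" "v \<in> carrier_vec n"
  shows "A *\<^sub>v v = vec m (\<lambda>k. \<Sum>i<n. v $ i * (A *\<^sub>v unit_vec n i) $ k)"
proof (rule eq_vecI)
  fix k assume "k < dim_vec (vec m (\<lambda>k. \<Sum>i<n. v $ i * (A *\<^sub>v unit_vec n i) $ k))"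
  then have k: "k < m" by simp
  then have "(A *\<^sub>v v) $ k = (\<Sum>i<n. A $$ (k, i) * v $ i)"
    using assms by (simp add: scalar_prod_def lessThan_atLeast0)
  also have "\<dots> = (\<Sum>i<n. v $ i * (A *\<^sub>v unit_vec n i) $ k)"
    using assms k by (intro sum.cong) (auto simp: mult_unit_vec_index[of A m n] simp del: index_mult_mat_vec)
  finally show "(A *\<^sub>v v) $ k = vec m (\<lambda>k. \<Sum>i<n. v $ i * (A *\<^sub>v unit_vec n i) $ k) $ k"
    using k by simp
qed (use assms in auto)

lemma vnorm_mult_mat_vec_le_columns:
  assumes "A \<in> carrier_mat m n" "v \<in> carrier_vec n"
  shows "vnorm (A *\<^sub>v v) \<le> (\<Sum>i<n. \<bar>v $ i\<bar> * vnorm (A *\<^sub>v unit_vec n i))"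
  unfolding mult_mat_vec_expand[OF assms] using assms
  by (intro vnorm_finsum_le) auto

lemma vnorm_mult_mat_vec_le_sum_columns:
  assumes "A \<in> carrier_mat m n" "v \<in> carrier_vec n"
  shows "vnorm (A *\<^sub>v v) \<le> (\<Sum>i<n. vnorm (A *\<^sub>v unit_vec n i)) * vnorm v"
proof -
  have "(\<Sum>i<n. \<bar>v $ i\<bar> * vnorm (A *\<^sub>v unit_vec n i)) \<le> (\<Sum>i<n. vnorm v * vnorm (A *\<^sub>v unit_vec n i))"
    using assms abs_index_le_vnorm[of _ v] by (intro sum_mono mult_right_mono) auto
  with vnorm_mult_mat_vec_le_columns[OF assms] show ?thesis
    by (simp add: sum_distrib_left mult.commute)
qed

lemma bdd_above_op_norm:
  "A \<in> carrier_mat m n \<Longrightarrow> bdd_above ((\<lambda>v. vnorm (A *\<^sub>v v)) ` {v \<in> carrier_vec n. vnorm v = 1})"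
  by (rule bdd_aboveI2[of _ _ "\<Sum>i<n. vnorm (A *\<^sub>v unit_vec n i)"])
     (use vnorm_mult_mat_vec_le_sum_columns[of A m n] in fastforce)

lemma vnorm_mult_mat_vec_le:
  assumes A: "A \<in> carrier_mat m n" and v: "v \<in> carrier_vec n"
  shows "vnorm (A *\<^sub>v v) \<le> op_norm A * vnorm v"
proof (cases "vnorm v = 0")
  case True
  then have "v = 0\<^sub>v n" using v vnorm_eq_0 by blast
  moreover have "A *\<^sub>v 0\<^sub>v n = 0\<^sub>v m" using A by auto
  ultimately show ?thesis by simp
next
  case False
  define w where "w = (1 / vnorm v) \<cdot>\<^sub>v v"
  have w: "w \<in> carrier_vec n" "vnorm w = 1" using v False by (auto simp: w_def vnorm_smult)
  have "vnorm (A *\<^sub>v w) \<le> op_norm A"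
    unfolding op_norm_def using w A by (intro cSUP_upper bdd_above_op_norm) (auto intro: bdd_above_op_norm)
  moreover have "A *\<^sub>v w = (1 / vnorm v) \<cdot>\<^sub>v (A *\<^sub>v v)"
    unfolding w_def using A v by (rule mult_mat_vec)
  ultimately show ?thesis using False vnorm_nonneg[of v]
    by (simp add: vnorm_smult field_simps)
qed

lemma op_norm_le:
  assumes A: "A \<in> carrier_mat m n" and n: "0 < n"
    and le: "\<And>v. v \<in> carrier_vec n \<Longrightarrow> vnorm (A *\<^sub>v v) \<le> c * vnorm v"
  shows "op_norm A \<le> c"
proof -
  have "unit_vec n 0 \<in> {v \<in> carrier_vec n. vnorm v = 1}" using n by auto
  then have ne: "{v \<in> carrier_vec n. vnorm v = 1} \<noteq> {}" by blast
  show ?thesis unfolding op_norm_def using A ne le by (intro cSUP_least) force+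
qed

lemma op_norm_nonneg:
  assumes A: "A \<in> carrier_mat m n" and n: "0 < n"
  shows "0 \<le> op_norm A"
  using vnorm_mult_mat_vec_le[OF A, of "unit_vec n 0"] n vnorm_nonneg[of "A *\<^sub>v unit_vec n 0"]
  by (simp add: order_trans[OF vnorm_nonneg])

text \<open>
  The maximal operator acts on vector functions.  The images of the unit vectors let it control
  operator norms.
\<close>

lemma op_norm_le_sum_columns:
  assumes "A \<in> carrier_mat m n" "0 < n"
  shows "op_norm A \<le> (\<Sum>i<n. vnorm (A *\<^sub>v unit_vec n i))"
  using assms by (intro op_norm_le vnorm_mult_mat_vec_le_sum_columns)

text \<open>
  Pair \<open>A v\<close> with itself, move one factor \<open>A\<close> to the other side, and cancel \<open>|A v|\<close>.
\<close>

lemma op_norm_transpose_le: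
  assumes A: "A \<in> carrier_mat m n" and n: "0 < n" and m: "0 < m"
  shows "op_norm A \<le> op_norm (transpose_mat A)"
proof (rule op_norm_le[OF A n])
  fix v :: "real vec" assume v: "v \<in> carrier_vec n"
  have Av: "A *\<^sub>v v \<in> carrier_vec m" using A v by auto
  have At: "transpose_mat A \<in> carrier_mat n m" using A by auto
  have "vnorm (A *\<^sub>v v) ^ 2 = (A *\<^sub>v v) \<bullet> (A *\<^sub>v v)" by (simp add: vnorm_square)
  also have "\<dots> = (transpose_mat A *\<^sub>v (A *\<^sub>v v)) \<bullet> v"
    using transpose_vec_mult_scalar[OF A v Av] A v Av by auto
  also have "\<dots> \<le> vnorm (transpose_mat A *\<^sub>v (A *\<^sub>v v)) * vnorm v"
    using v At Av by (intro scalar_prod_le_vnorm[of _ n]) auto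
  also have "\<dots> \<le> (op_norm (transpose_mat A) * vnorm (A *\<^sub>v v)) * vnorm v"
    using At Av by (intro mult_right_mono vnorm_mult_mat_vec_le) auto
  finally have *: "vnorm (A *\<^sub>v v) * vnorm (A *\<^sub>v v) \<le> (op_norm (transpose_mat A) * vnorm v) * vnorm (A *\<^sub>v v)"
    by (simp add: power2_eq_square mult_ac)
  show "vnorm (A *\<^sub>v v) \<le> op_norm (transpose_mat A) * vnorm v"
  proof (cases "vnorm (A *\<^sub>v v) = 0")
    case True then show ?thesis using op_norm_nonneg[OF At m] by simp
  next
    case False
    then have "0 < vnorm (A *\<^sub>v v)" using vnorm_nonneg[of "A *\<^sub>v v"] by linarith
    with * show ?thesis by (rule mult_right_le_imp_le)
  qed
qed

lemma op_norm_transpose: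
  assumes A: "A \<in> carrier_mat m n" and n: "0 < n" and m: "0 < m"
  shows "op_norm (transpose_mat A) = op_norm A"
  using op_norm_transpose_le[OF A n m] op_norm_transpose_le[of "transpose_mat A" n m] assms by auto

lemma smult_mat_mult_mat_vec:
  assumes "A \<in> carrier_mat m n" "v \<in> carrier_vec n"
  shows "(c \<cdot>\<^sub>m A) *\<^sub>v v = c \<cdot>\<^sub>v (A *\<^sub>v v)"
  using assms by (intro eq_vecI) (auto simp: scalar_prod_def sum_distrib_left mult.assoc)

lemma op_norm_smult:
  assumes A: "A \<in> carrier_mat m n" and n: "0 < n"
  shows "op_norm (c \<cdot>\<^sub>m A) = \<bar>c\<bar> * op_norm A"
proof -
  have le: "op_norm (c \<cdot>\<^sub>m A) \<le> \<bar>c\<bar> * op_norm A" if A: "A \<in> carrier_mat m n" for c :: real and A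
  proof (rule op_norm_le[OF _ n])
    fix v :: "real vec" assume v: "v \<in> carrier_vec n"
    have "vnorm (c \<cdot>\<^sub>m A *\<^sub>v v) = \<bar>c\<bar> * vnorm (A *\<^sub>v v)"
      using A v by (simp add: smult_mat_mult_mat_vec vnorm_smult)
    also have "\<dots> \<le> \<bar>c\<bar> * (op_norm A * vnorm v)"
      using A v by (intro mult_left_mono vnorm_mult_mat_vec_le) auto
    finally show "vnorm (c \<cdot>\<^sub>m A *\<^sub>v v) \<le> \<bar>c\<bar> * op_norm A * vnorm v" by (simp add: mult_ac)
  qed (use A in auto)
  show ?thesis
  proof (cases "c = 0")
    case True
    then show ?thesis using le[OF A, of c] op_norm_nonneg[of "c \<cdot>\<^sub>m A" m n] A n by simp
  next
    case False
    have "(1 / c) \<cdot>\<^sub>m (c \<cdot>\<^sub>m A) = A" using False by (intro eq_matI) auto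
    then have "op_norm A \<le> \<bar>1 / c\<bar> * op_norm (c \<cdot>\<^sub>m A)"
      using le[of "c \<cdot>\<^sub>m A" "1 / c"] A by auto
    then have "\<bar>c\<bar> * op_norm A \<le> op_norm (c \<cdot>\<^sub>m A)"
      using False by (simp add: field_simps abs_divide)
    with le[OF A, of c] show ?thesis by linarith
  qed
qed

lemma smult_mult_smult_mat:
  fixes A E :: "real mat"
  assumes "A \<in> carrier_mat d d" "E \<in> carrier_mat d d"
  shows "(s \<cdot>\<^sub>m A) * (t \<cdot>\<^sub>m E) = (s * t) \<cdot>\<^sub>m (A * E)"
proof -
  have "(s \<cdot>\<^sub>m A) * (t \<cdot>\<^sub>m E) = s \<cdot>\<^sub>m (A * (t \<cdot>\<^sub>m E))"
    using assms by (intro mult_smult_assoc_mat[of _ d d _ d]) auto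
  also have "A * (t \<cdot>\<^sub>m E) = t \<cdot>\<^sub>m (A * E)"
    using assms by (intro mult_smult_distrib[of _ d d _ d]) auto
  also have "s \<cdot>\<^sub>m (t \<cdot>\<^sub>m (A * E)) = (s * t) \<cdot>\<^sub>m (A * E)"
    by (intro eq_matI) auto
  finally show ?thesis .
qed

lemma invertible_mat_iff_det:
  fixes A :: "real mat"
  assumes A: "A \<in> carrier_mat d d"
  shows "invertible_mat A \<longleftrightarrow> det A \<noteq> 0"
proof
  assume "invertible_mat A"
  then obtain B where B: "A * B = 1\<^sub>m d" "B * A = 1\<^sub>m (dim_row B)"
    using A unfolding invertible_mat_def inverts_mat_def by auto
  have "dim_row B = d"
    using arg_cong[OF B(2), of dim_col] A by simp
  moreover have "dim_col B = d"
    using arg_cong[OF B(1), of dim_col] by simp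
  ultimately have "B \<in> carrier_mat d d" by auto
  with A have "det A * det B = 1"
    using B(1) by (metis det_mult det_one)
  then show "det A \<noteq> 0" by auto
next
  assume "det A \<noteq> 0"
  from det_non_zero_imp_unit[OF A this, of "()"]
  obtain B where "B \<in> carrier_mat d d" "A * B = 1\<^sub>m d" "B * A = 1\<^sub>m d"
    by (auto simp: Units_def ring_mat_def)
  then show "invertible_mat A"
    using A unfolding invertible_mat_def inverts_mat_def square_mat.simps by auto
qed

lemma minv_eqI:
  assumes A: "A \<in> carrier_mat d d" and B: "B \<in> carrier_mat d d" and AB: "A * B = 1\<^sub>m d"
  shows "minv A = B"
proof -
  have BA: "B * A = 1\<^sub>m d" by (rule mat_mult_left_right_inverse[OF A B AB])
  have "A \<in> Units (ring_mat TYPE(real) d ())"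
    using A B AB BA by (auto simp: Units_def ring_mat_def)
  with mat_inverse(1)[OF A, of "()"] obtain C where C: "mat_inverse A = Some C" by (cases "mat_inverse A") auto
  from mat_inverse(2)[OF A this] have C': "A * C = 1\<^sub>m d" "C * A = 1\<^sub>m d" "C \<in> carrier_mat d d" by auto
  have "C = C * (A * B)" using C' AB by auto
  also have "\<dots> = (C * A) * B" using A B C' by (intro assoc_mult_mat[symmetric]) auto
  also have "\<dots> = B" using C' B by auto
  finally show ?thesis by (simp add: minv_def C)
qed

lemma minv_singular:
  assumes A: "A \<in> carrier_mat d d" and "det A = 0"
  shows "minv A = 0\<^sub>m d d"
proof -
  have "mat_inverse A = None"
  proof (cases "mat_inverse A")
    case (Some C)
    from mat_inverse(2)[OF A this] have "A * C = 1\<^sub>m d" "C \<in> carrier_mat d d" by auto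
    with A have "det A * det C = 1" by (metis det_mult det_one)
    with assms show ?thesis by simp
  qed
  then show ?thesis using A by (simp add: minv_def)
qed

text \<open>
  The adjugate makes the entries of the inverse rational functions of the entries of \<open>A\<close>, also
  at singular matrices, where both sides are zero; this is what measurability rests on.
\<close>

lemma minv_eq_adj_mat:
  assumes A: "A \<in> carrier_mat d d"
  shows "minv A = inverse (det A) \<cdot>\<^sub>m adj_mat A"
proof (cases "det A = 0")
  case True
  then show ?thesis using minv_singular[OF A] adj_mat(1)[OF A] by (auto intro!: eq_matI)
next
  case False
  have "A * (inverse (det A) \<cdot>\<^sub>m adj_mat A) = inverse (det A) \<cdot>\<^sub>m (A * adj_mat A)"
    using A adj_mat(1)[OF A] by (intro mult_smult_distrib) auto
  also have "\<dots> = 1\<^sub>m d"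
    using False by (auto simp: adj_mat(2)[OF A] intro!: eq_matI)
  finally show ?thesis using A adj_mat(1)[OF A] by (intro minv_eqI) auto
qed

lemma minv_carrier [simp, intro]: "A \<in> carrier_mat d d \<Longrightarrow> minv A \<in> carrier_mat d d"
  using minv_eq_adj_mat adj_mat(1) by force

lemma minv_right:
  assumes A: "A \<in> carrier_mat d d" and inv: "invertible_mat A"
  shows "A * minv A = 1\<^sub>m d"
proof -
  have "det A \<noteq> 0" using assms invertible_mat_iff_det by blast
  from det_non_zero_imp_unit[OF A this, of "()"]
  obtain B where "B \<in> carrier_mat d d" "A * B = 1\<^sub>m d"
    by (auto simp: Units_def ring_mat_def)
  with minv_eqI[OF A] show ?thesis by simp
qed

lemma minv_left:
  assumes A: "A \<in> carrier_mat d d" and inv: "invertible_mat A"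
  shows "minv A * A = 1\<^sub>m d"
  using mat_mult_left_right_inverse[OF A minv_carrier[OF A] minv_right[OF assms]] .

lemma invertible_minv:
  assumes A: "A \<in> carrier_mat d d" and inv: "invertible_mat A"
  shows "invertible_mat (minv A)"
proof -
  have "det A * det (minv A) = 1" using A minv_right[OF assms] minv_carrier[OF A] by (metis det_mult det_one)
  then show ?thesis using invertible_mat_iff_det[OF minv_carrier[OF A]] by auto
qed

lemma minv_minv:
  assumes A: "A \<in> carrier_mat d d" and inv: "invertible_mat A"
  shows "minv (minv A) = A"
  using minv_eqI[OF minv_carrier[OF A] A minv_left[OF assms]] .

lemma minv_smult:
  assumes A: "A \<in> carrier_mat d d" and c: "c \<noteq> 0" and inv: "invertible_mat A"
  shows "minv (c \<cdot>\<^sub>m A) = inverse c \<cdot>\<^sub>m minv A"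
proof (rule minv_eqI)
  show "(c \<cdot>\<^sub>m A) * (inverse c \<cdot>\<^sub>m minv A) = 1\<^sub>m d"
  proof -
    have "(c \<cdot>\<^sub>m A) * (inverse c \<cdot>\<^sub>m minv A) = c \<cdot>\<^sub>m (A * (inverse c \<cdot>\<^sub>m minv A))"
      using A minv_carrier[OF A] by (intro mult_smult_assoc_mat[of _ d d _ d]) auto
    also have "A * (inverse c \<cdot>\<^sub>m minv A) = inverse c \<cdot>\<^sub>m (A * minv A)"
      using A minv_carrier[OF A] by (intro mult_smult_distrib) auto
    also have "c \<cdot>\<^sub>m (inverse c \<cdot>\<^sub>m (A * minv A)) = 1\<^sub>m d"
      using c by (auto simp: minv_right[OF A inv] intro!: eq_matI)
    finally show ?thesis .
  qed
qed (use A minv_carrier[OF A] in auto)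

lemma minv_transpose:
  assumes A: "A \<in> carrier_mat d d" and inv: "invertible_mat A"
  shows "transpose_mat (minv A) = minv (transpose_mat A)"
proof (rule minv_eqI[symmetric])
  have "transpose_mat A * transpose_mat (minv A) = transpose_mat (minv A * A)"
    using transpose_mult[OF minv_carrier[OF A] A] by simp
  then show "transpose_mat A * transpose_mat (minv A) = 1\<^sub>m d"
    using minv_left[OF assms] by simp
qed (use A minv_carrier[OF A] in auto)

section \<open>Spectral theorem and powers of positive semidefinite matrices\<close>

lemma square_closed:
  fixes A B :: "'a :: semiring_0 mat"
  assumes "A \<in> carrier_mat d d"
  shows "B \<in> carrier_mat d d \<Longrightarrow> A * B \<in> carrier_mat d d"
    "v \<in> carrier_vec d \<Longrightarrow> A *\<^sub>v v \<in> carrier_vec d"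
  using assms by auto

lemma symmetric_mat_scalar_prod:
  fixes A :: "real mat"
  assumes A: "A \<in> carrier_mat d d" and sym: "transpose_mat A = A"
    and x: "x \<in> carrier_vec d" and y: "y \<in> carrier_vec d"
  shows "x \<bullet> (A *\<^sub>v y) = (A *\<^sub>v x) \<bullet> y"
  using transpose_vec_mult_scalar[OF A y x] sym by simp

text \<open>
  A complex eigenvector exists because the characteristic polynomial has a complex root.  Symmetry
  of \<open>A\<close>, applied to its real and imaginary part, forces the eigenvalue to be real, so that both parts
  are eigenvectors, and one of them is nonzero.
\<close>

lemma symmetric_mat_real_eigenvector:
  fixes A :: "real mat"
  assumes A: "A \<in> carrier_mat d d" and sym: "transpose_mat A = A" and d: "0 < d"
  obtains v e where "v \<in> carrier_vec d" "v \<bullet> v = 1" "A *\<^sub>v v = e \<cdot>\<^sub>v v"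
proof -
  define Ac where "Ac = map_mat complex_of_real A"
  have Ac: "Ac \<in> carrier_mat d d" using A by (simp add: Ac_def)
  obtain k where "eigenvalue Ac k"
    using spectrum_non_empty[OF Ac d] by (auto simp: spectrum_def)
  then obtain z where z: "z \<in> carrier_vec d" "z \<noteq> 0\<^sub>v d" "Ac *\<^sub>v z = k \<cdot>\<^sub>v z"
    using Ac by (auto simp: eigenvalue_def eigenvector_def)
  define x y where "x = map_vec Re z" and "y = map_vec Im z"
  have xy: "x \<in> carrier_vec d" "y \<in> carrier_vec d" using z by (auto simp: x_def y_def)
  have eq: "(\<Sum>j = 0..<d. complex_of_real (A $$ (i, j)) * z $ j) = k * z $ i" if "i < d" for i
    using arg_cong[OF z(3), of "\<lambda>v. v $ i"] that A z(1) by (simp add: Ac_def scalar_prod_def)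
  have Ax: "A *\<^sub>v x = Re k \<cdot>\<^sub>v x - Im k \<cdot>\<^sub>v y"
  proof (rule eq_vecI)
    fix i assume "i < dim_vec (Re k \<cdot>\<^sub>v x - Im k \<cdot>\<^sub>v y)"
    then have i: "i < d" using xy by simp
    show "(A *\<^sub>v x) $ i = (Re k \<cdot>\<^sub>v x - Im k \<cdot>\<^sub>v y) $ i"
      using arg_cong[OF eq[OF i], of Re] i A z(1) by (simp add: scalar_prod_def x_def y_def)
  qed (use A xy in auto)
  have Ay: "A *\<^sub>v y = Im k \<cdot>\<^sub>v x + Re k \<cdot>\<^sub>v y"
  proof (rule eq_vecI)
    fix i assume "i < dim_vec (Im k \<cdot>\<^sub>v x + Re k \<cdot>\<^sub>v y)"
    then have i: "i < d" using xy by simp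
    show "(A *\<^sub>v y) $ i = (Im k \<cdot>\<^sub>v x + Re k \<cdot>\<^sub>v y) $ i"
      using arg_cong[OF eq[OF i], of Im] i A z(1) by (simp add: scalar_prod_def x_def y_def)
  qed (use A xy in auto)
  have "x \<bullet> (A *\<^sub>v y) = (A *\<^sub>v x) \<bullet> y" by (rule symmetric_mat_scalar_prod[OF A sym xy])
  then have "Im k * (x \<bullet> x) + Re k * (x \<bullet> y) = Re k * (x \<bullet> y) - Im k * (y \<bullet> y)"
    using xy unfolding Ax Ay
    by (simp add: scalar_prod_add_distrib[of _ d] minus_scalar_prod_distrib[of _ d])
  then have "Im k * (vnorm x ^ 2 + vnorm y ^ 2) = 0" by (simp add: vnorm_square algebra_simps)
  moreover have "x \<noteq> 0\<^sub>v d \<or> y \<noteq> 0\<^sub>v d"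
  proof (rule ccontr)
    assume "\<not> (x \<noteq> 0\<^sub>v d \<or> y \<noteq> 0\<^sub>v d)"
    then have "\<forall>i<d. Re (z $ i) = 0 \<and> Im (z $ i) = 0"
      using z(1) unfolding x_def y_def
      by (metis carrier_vecD index_map_vec(1) index_zero_vec(1))
    then have "z = 0\<^sub>v d" using z(1) by (intro eq_vecI) (auto simp: complex_eq_iff)
    with z(2) show False by simp
  qed
  ultimately have "Im k = 0"
    using xy vnorm_eq_0[of x d] vnorm_eq_0[of y d] by (auto simp: add_nonneg_eq_0_iff)
  then have Ax': "A *\<^sub>v x = Re k \<cdot>\<^sub>v x" and Ay': "A *\<^sub>v y = Re k \<cdot>\<^sub>v y"
    using Ax Ay xy by (auto intro!: eq_vecI)
  obtain w where w: "w \<in> carrier_vec d" "w \<noteq> 0\<^sub>v d" "A *\<^sub>v w = Re k \<cdot>\<^sub>v w"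
    using \<open>x \<noteq> 0\<^sub>v d \<or> y \<noteq> 0\<^sub>v d\<close> Ax' Ay' xy by blast
  define v where "v = (1 / vnorm w) \<cdot>\<^sub>v w"
  have "vnorm w \<noteq> 0" using w vnorm_eq_0 by blast
  have v: "v \<in> carrier_vec d" using w by (simp add: v_def)
  moreover have "v \<bullet> v = 1"
    using \<open>vnorm w \<noteq> 0\<close> by (simp flip: vnorm_square add: v_def vnorm_smult)
  moreover have "A *\<^sub>v v = Re k \<cdot>\<^sub>v v"
    unfolding v_def using A w by (simp add: mult_mat_vec smult_smult_assoc mult.commute)
  ultimately show ?thesis using that by blast
qed

text \<open>
  The reflection in the hyperplane orthogonal to \<open>e - v\<close>, where \<open>e\<close> is the first unit vector,
  exchanges the unit vectors \<open>e\<close> and \<open>v\<close>.  It is used to deflate an eigenvector.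
\<close>

lemma householder_reflection:
  fixes v :: "real vec"
  assumes v: "v \<in> carrier_vec d" "v \<bullet> v = 1" and d: "0 < d"
  obtains H where "H \<in> carrier_mat d d" "transpose_mat H = H" "H * H = 1\<^sub>m d" "H *\<^sub>v unit_vec d 0 = v"
proof (cases "v = unit_vec d 0")
  case True
  show ?thesis by (rule that[of "1\<^sub>m d"]) (use True d in auto)
next
  case False
  define e where "e = (unit_vec d 0 :: real vec)"
  have e: "e \<in> carrier_vec d" "e \<bullet> e = 1" using d by (auto simp: e_def)
  (* The reflection is x - c (w . x) w with c = 2 / (w . w), and c (w . e) = 1. *)
  define w where "w = e - v"
  have w: "w \<in> carrier_vec d" using e v by (auto simp: w_def)
  have ww: "w \<bullet> w = 2 - 2 * (e \<bullet> v)"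
    using e v comm_scalar_prod[OF e(1) v(1)] unfolding w_def
    by (simp add: minus_scalar_prod_distrib[of _ d] scalar_prod_minus_distrib[of _ d])
  have we: "w $ 0 = 1 - e \<bullet> v" using d v by (simp add: w_def e_def)
  have "w \<noteq> 0\<^sub>v d"
  proof
    assume "w = 0\<^sub>v d"
    then have "\<forall>i<d. e $ i - v $ i = 0"
      using e v unfolding w_def by (metis carrier_vecD index_minus_vec(1) index_zero_vec(1))
    then have "v = e" using e v by (intro eq_vecI) auto
    with False show False by (simp add: e_def)
  qed
  then have ww0: "w \<bullet> w \<noteq> 0" using w vnorm_eq_0[OF w] by (simp flip: vnorm_square)
  define c where "c = 2 / (w \<bullet> w)"
  define H where "H = mat d d (\<lambda>(i,j). (if i = j then 1 else 0) - c * w $ i * w $ j)"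
  have H: "H \<in> carrier_mat d d" by (simp add: H_def)
  have W: "(\<Sum>k = 0..<d. w $ k * w $ k) = w \<bullet> w" using w by (simp add: scalar_prod_def)
  have "H * H = 1\<^sub>m d"
  proof (rule eq_matI)
    fix i j assume "i < dim_row (1\<^sub>m d :: real mat)" "j < dim_col (1\<^sub>m d :: real mat)"
    then have ij: "i < d" "j < d" by auto
    have "(H * H) $$ (i, j) = (\<Sum>k = 0..<d. ((if i = k then 1 else 0) - c * w $ i * w $ k) *
        ((if k = j then 1 else 0) - c * w $ k * w $ j))"
      using ij by (simp add: H_def scalar_prod_def)
    also have "\<dots> = (\<Sum>k = 0..<d. (if i = k then (if k = j then 1 else 0) else 0)
        - (if i = k then c * w $ k * w $ j else 0) - (if k = j then c * w $ i * w $ k else 0)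
        + c * c * w $ i * w $ j * (w $ k * w $ k))"
      by (intro sum.cong) (auto simp: algebra_simps)
    also have "\<dots> = (if i = j then 1 else 0) - c * w $ i * w $ j - c * w $ i * w $ j
        + c * c * w $ i * w $ j * (w \<bullet> w)"
      using ij by (simp add: sum.distrib sum_subtractf sum_distrib_left [symmetric] W)
    also have "c * c * w $ i * w $ j * (w \<bullet> w) = 2 * c * w $ i * w $ j"
      using ww0 by (simp add: c_def)
    finally show "(H * H) $$ (i, j) = 1\<^sub>m d $$ (i, j)" using ij by simp
  qed (use H in auto)
  moreover have "transpose_mat H = H" by (rule eq_matI) (auto simp: H_def)
  moreover have "H *\<^sub>v unit_vec d 0 = v"
  proof (rule eq_vecI)
    fix i assume "i < dim_vec v"
    then have i: "i < d" using v by simp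
    have "c * w $ 0 = 1" using ww0 we ww by (simp add: c_def field_simps)
    then have c1: "c * w $ i * w $ 0 = w $ i" by (metis mult.assoc mult.commute mult.right_neutral)
    have "(H *\<^sub>v unit_vec d 0) $ i = H $$ (i, 0)"
      using i d H by (simp add: mult_unit_vec_index[of H d d] del: index_mult_mat_vec)
    also have "\<dots> = e $ i - w $ i"
      using i d c1 by (simp add: H_def e_def unit_vec_def)
    also have "\<dots> = v $ i" using i v e by (simp add: w_def)
    finally show "(H *\<^sub>v unit_vec d 0) $ i = v $ i" .
  qed (use H v in auto)
  ultimately show ?thesis using H that by blast
qed

text \<open>
  Conjugating with a reflection that maps the first unit vector to an eigenvector turns the first
  row and column into those of a diagonal matrix; the induction hypothesis applies to the
  remaining block.
\<close>

lemma spectral_theorem_real_symmetric: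
  fixes A :: "real mat"
  assumes "A \<in> carrier_mat d d" "transpose_mat A = A"
  shows "\<exists>U l. U \<in> carrier_mat d d \<and> transpose_mat U * U = 1\<^sub>m d \<and> A = transpose_mat U * mat_diag d l * U"
  using assms
proof (induction d arbitrary: A)
  case 0
  then show ?case by (intro exI[of _ "1\<^sub>m 0"] exI[of _ "\<lambda>_. 0"]) (auto intro!: eq_matI)
next
  case (Suc d)
  note A = Suc.prems(1) and sym = Suc.prems(2)
  obtain v e where v: "v \<in> carrier_vec (Suc d)" "v \<bullet> v = 1" and Av: "A *\<^sub>v v = e \<cdot>\<^sub>v v"
    using symmetric_mat_real_eigenvector[OF A sym] by auto
  obtain H where H: "H \<in> carrier_mat (Suc d) (Suc d)" "transpose_mat H = H" "H * H = 1\<^sub>m (Suc d)"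
    and Hv: "H *\<^sub>v unit_vec (Suc d) 0 = v"
    using householder_reflection[OF v] by auto
  define B where "B = H * A * H"
  have B: "B \<in> carrier_mat (Suc d) (Suc d)" using A H by (simp add: B_def)
  have symB: "transpose_mat B = B"
    unfolding B_def using A H sym
    by (simp add: transpose_mult[of _ "Suc d" "Suc d" _ "Suc d"] assoc_mult_mat[of _ "Suc d" "Suc d" _ "Suc d" _ "Suc d"] square_closed)
  have "B *\<^sub>v unit_vec (Suc d) 0 = H *\<^sub>v (A *\<^sub>v v)"
    unfolding B_def using A H Hv v by (simp add: square_closed assoc_mult_mat_vec[of _ "Suc d" "Suc d" _ "Suc d"])
  also have "\<dots> = e \<cdot>\<^sub>v (H *\<^sub>v v)" unfolding Av using H v by (intro mult_mat_vec) auto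
  also have "H *\<^sub>v v = unit_vec (Suc d) 0"
    unfolding Hv[symmetric] using H by (simp add: square_closed assoc_mult_mat_vec[symmetric, of _ "Suc d" "Suc d" _ "Suc d"])
  finally have Be: "B *\<^sub>v unit_vec (Suc d) 0 = e \<cdot>\<^sub>v unit_vec (Suc d) 0" .
  have B0: "B $$ (i, 0) = (if i = 0 then e else 0)" if "i < Suc d" for i
    using arg_cong[OF Be, of "\<lambda>v. v $ i"] that mult_unit_vec_index[OF B that, of 0]
    by (simp del: index_mult_mat_vec)
  have B0': "B $$ (0, j) = (if j = 0 then e else 0)" if "j < Suc d" for j
    using B0[OF that] arg_cong[OF symB, of "\<lambda>M. M $$ (j, 0)"] B that by simp
  define A' where "A' = mat d d (\<lambda>(i,j). B $$ (Suc i, Suc j))"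
  have A': "A' \<in> carrier_mat d d" by (simp add: A'_def)
  have "transpose_mat A' = A'"
    unfolding A'_def using arg_cong[OF symB, of "\<lambda>M. M $$ (Suc _, Suc _)"] B
    by (intro eq_matI) (auto, metis B carrier_matD index_transpose_mat(1) Suc_less_eq symB)
  from Suc.IH[OF A' this] obtain U' l' where
    U': "U' \<in> carrier_mat d d" "transpose_mat U' * U' = 1\<^sub>m d" "A' = transpose_mat U' * mat_diag d l' * U'" by blast
  define E where "E = (four_block_mat (1\<^sub>m 1) (0\<^sub>m 1 d) (0\<^sub>m d 1) U')"
  define l where "l = (\<lambda>i. case i of 0 \<Rightarrow> e | Suc i \<Rightarrow> l' i)"
  have E: "E \<in> carrier_mat (Suc d) (Suc d)" using U' by (auto simp: E_def)
  have Et: "transpose_mat E = four_block_mat (1\<^sub>m 1) (0\<^sub>m 1 d) (0\<^sub>m d 1) (transpose_mat U')"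
    unfolding E_def using U' by (subst transpose_four_block_mat[of _ 1 1 _ d _ d]) auto
  have D: "mat_diag (Suc d) l = four_block_mat (e \<cdot>\<^sub>m 1\<^sub>m 1) (0\<^sub>m 1 d) (0\<^sub>m d 1) (mat_diag d l')"
    by (rule eq_matI) (auto simp: mat_diag_def l_def split: nat.splits)
  have EE: "transpose_mat E * E = 1\<^sub>m (Suc d)"
    unfolding Et unfolding E_def using U'
    by (subst mult_four_block_mat[of _ 1 1 _ d _ d _ _ 1 _ d]) (auto intro!: eq_matI)
  have "B = four_block_mat (e \<cdot>\<^sub>m 1\<^sub>m 1) (0\<^sub>m 1 d) (0\<^sub>m d 1) A'"
    using B by (intro eq_matI) (auto simp: A'_def B0 B0')
  also have "\<dots> = transpose_mat E * mat_diag (Suc d) l * E"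
    unfolding Et D unfolding E_def U'(3) using U'(1)
    by (subst mult_four_block_mat[of _ 1 1 _ d _ d _ _ 1 _ d], auto)
       (subst mult_four_block_mat[of _ 1 1 _ d _ d _ _ 1 _ d],
        auto simp: left_mult_zero_mat[OF mat_diag_dim] right_mult_zero_mat[of _ d d] square_closed)
  finally have BE: "B = transpose_mat E * mat_diag (Suc d) l * E" .
  define U where "U = E * H"
  have U: "U \<in> carrier_mat (Suc d) (Suc d)" using E H by (simp add: U_def)
  have Ut: "transpose_mat U = H * transpose_mat E"
    unfolding U_def using transpose_mult[OF E H(1)] H by simp
  note assoc = assoc_mult_mat[of _ "Suc d" "Suc d" _ "Suc d" _ "Suc d"]
  have "transpose_mat U * U = H * (transpose_mat E * E) * H"
    unfolding Ut unfolding U_def using E H by (simp add: square_closed assoc)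
  also have "\<dots> = 1\<^sub>m (Suc d)" using H EE by simp
  finally have UU: "transpose_mat U * U = 1\<^sub>m (Suc d)" .
  have "A = (H * H) * A * (H * H)" unfolding H(3) using A by simp
  also have "\<dots> = H * B * H" unfolding B_def using A H(1) by (simp add: square_closed assoc)
  also have "\<dots> = transpose_mat U * mat_diag (Suc d) l * U"
    unfolding BE Ut unfolding U_def using E H mat_diag_dim[of "Suc d" l] by (simp add: square_closed assoc)
  finally show ?case using U UU by blast
qed

text \<open>
  The orthogonal matrix \<open>S = V U\<^sup>T\<close> intertwines the two diagonal matrices, so that \<open>S i j = 0\<close> unless
  \<open>l j = m i\<close>.  Hence it also intertwines their images under \<open>f\<close>.
\<close>

lemma diagonalization_function_unique:
  fixes U V :: "real mat"
  assumes U: "U \<in> carrier_mat d d" "transpose_mat U * U = 1\<^sub>m d"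
    and V: "V \<in> carrier_mat d d" "transpose_mat V * V = 1\<^sub>m d"
    and eq: "transpose_mat U * mat_diag d l * U = transpose_mat V * mat_diag d m * V"
  shows "transpose_mat U * mat_diag d (\<lambda>i. f (l i)) * U = transpose_mat V * mat_diag d (\<lambda>i. f (m i)) * V"
proof -
  note assoc = assoc_mult_mat[of _ d d _ d _ d]
  have UU': "U * transpose_mat U = 1\<^sub>m d" and VV': "V * transpose_mat V = 1\<^sub>m d"
    using mat_mult_left_right_inverse[OF _ U(1) U(2)] mat_mult_left_right_inverse[OF _ V(1) V(2)] U V by auto
  have cancel: "U * (transpose_mat U * X) = X" "V * (transpose_mat V * X) = X"
    "transpose_mat U * (U * X) = X" "transpose_mat V * (V * X) = X" if "X \<in> carrier_mat d d" for X
    using that U V UU' VV' by (simp_all flip: assoc)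
  define S where "S = V * transpose_mat U"
  have S: "S \<in> carrier_mat d d" using U V by (simp add: S_def)
  have "S * mat_diag d l = V * (transpose_mat U * mat_diag d l * U) * transpose_mat U"
    unfolding S_def using U V UU' by (simp add: square_closed assoc cancel right_mult_one_mat[of _ d d])
  also have "\<dots> = mat_diag d m * S"
    unfolding eq S_def using U V by (simp add: square_closed assoc cancel)
  finally have SD: "S * mat_diag d l = mat_diag d m * S" .
  have "S $$ (i, j) * f (l j) = f (m i) * S $$ (i, j)" if ij: "i < d" "j < d" for i j
  proof -
    have "S $$ (i, j) * l j = m i * S $$ (i, j)"
      using arg_cong[OF SD, of "\<lambda>M. M $$ (i, j)"] ij
      unfolding mat_diag_mult_left[OF S] mat_diag_mult_right[OF S] by simp
    then show ?thesis by (cases "S $$ (i, j) = 0") auto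
  qed
  then have "S * mat_diag d (\<lambda>i. f (l i)) = mat_diag d (\<lambda>i. f (m i)) * S"
    unfolding mat_diag_mult_left[OF S] mat_diag_mult_right[OF S] by (intro eq_matI) simp_all
  then have "transpose_mat V * (S * mat_diag d (\<lambda>i. f (l i))) * U = transpose_mat V * (mat_diag d (\<lambda>i. f (m i)) * S) * U"
    by simp
  then show ?thesis
    unfolding S_def using U V by (simp add: square_closed assoc cancel)
qed

lemma mat_powr_eqI:
  fixes U :: "real mat"
  assumes U: "U \<in> carrier_mat d d" "transpose_mat U * U = 1\<^sub>m d"
    and A: "A = transpose_mat U * mat_diag d l * U"
  shows "mat_powr A t = transpose_mat U * mat_diag d (\<lambda>i. l i powr t) * U"
proof -
  have dim: "dim_row A = d" using U A by simp
  let ?P = "\<lambda>P. \<exists>U l. U \<in> carrier_mat (dim_row A) (dim_row A) \<and>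
     transpose_mat U * U = 1\<^sub>m (dim_row A) \<and>
     A = transpose_mat U * mat_diag (dim_row A) l * U \<and>
     P = transpose_mat U * mat_diag (dim_row A) (\<lambda>i. l i powr t) * U"
  have "?P (transpose_mat U * mat_diag d (\<lambda>i. l i powr t) * U)"
    unfolding dim using U A by blast
  then have "?P (mat_powr A t)" unfolding mat_powr_def by (rule someI[of ?P])
  then obtain V m where V: "V \<in> carrier_mat d d" "transpose_mat V * V = 1\<^sub>m d"
    and AV: "A = transpose_mat V * mat_diag d m * V"
    and P: "mat_powr A t = transpose_mat V * mat_diag d (\<lambda>i. m i powr t) * V"
    unfolding dim by blast
  show ?thesis
    unfolding P using diagonalization_function_unique[OF V U, of m l "\<lambda>x. x powr t"] A AV by simp
qed

lemma psd_matD: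
  assumes "A \<in> psd_mat d"
  shows "A \<in> carrier_mat d d" "transpose_mat A = A" "v \<in> carrier_vec d \<Longrightarrow> 0 \<le> v \<bullet> (A *\<^sub>v v)"
  using assms by (auto simp: psd_mat_def)

lemma conjugated_diag_quadratic_form:
  fixes U :: "real mat"
  assumes U: "U \<in> carrier_mat d d" and v: "v \<in> carrier_vec d"
  shows "v \<bullet> ((transpose_mat U * mat_diag d l * U) *\<^sub>v v) = (\<Sum>i<d. l i * ((U *\<^sub>v v) $ i)\<^sup>2)"
proof -
  have Uv: "U *\<^sub>v v \<in> carrier_vec d" using U v by auto
  have D: "mat_diag d l *\<^sub>v w = vec d (\<lambda>i. l i * w $ i)" if "w \<in> carrier_vec d" for w :: "real vec"
    using that by (intro eq_vecI) (auto simp: mat_diag_def scalar_prod_def if_distrib[of "\<lambda>x. x * _"] cong: if_cong)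
  have "v \<bullet> ((transpose_mat U * mat_diag d l * U) *\<^sub>v v) = v \<bullet> (transpose_mat U *\<^sub>v (mat_diag d l *\<^sub>v (U *\<^sub>v v)))"
    using U v by (simp add: square_closed assoc_mult_mat_vec[of _ d d _ d])
  also have "\<dots> = (transpose_mat U *\<^sub>v (mat_diag d l *\<^sub>v (U *\<^sub>v v))) \<bullet> v"
    using U v mult_mat_vec_carrier[OF mat_diag_dim Uv, of l]
    by (intro comm_scalar_prod[of _ d] mult_mat_vec_carrier[of _ d d]) auto
  also have "\<dots> = (mat_diag d l *\<^sub>v (U *\<^sub>v v)) \<bullet> (U *\<^sub>v v)"
    using U v mult_mat_vec_carrier[OF mat_diag_dim Uv, of l] by (intro transpose_vec_mult_scalar) auto
  also have "\<dots> = (\<Sum>i<d. l i * ((U *\<^sub>v v) $ i)\<^sup>2)"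
  proof -
    have "vec d (\<lambda>i. l i * w $ i) \<bullet> w = (\<Sum>i<d. l i * (w $ i)\<^sup>2)" if "w \<in> carrier_vec d" for w :: "real vec"
      using that by (auto simp: scalar_prod_def power2_eq_square lessThan_atLeast0 mult.assoc intro!: sum.cong)
    with D Uv show ?thesis by simp
  qed
  finally show ?thesis .
qed

lemma conjugated_diag_psd:
  fixes U :: "real mat"
  assumes U: "U \<in> carrier_mat d d" and l: "\<And>i. i < d \<Longrightarrow> 0 \<le> l i"
  shows "transpose_mat U * mat_diag d l * U \<in> psd_mat d"
proof -
  have "transpose_mat (mat_diag d l) = mat_diag d l"
    by (rule eq_matI) (auto simp: mat_diag_def)
  then have "transpose_mat (transpose_mat U * mat_diag d l * U) = transpose_mat U * mat_diag d l * U"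
    using U by (simp add: square_closed transpose_mult[of _ d d _ d] assoc_mult_mat[of _ d d _ d _ d])
  then show ?thesis
    using U l by (auto simp: psd_mat_def conjugated_diag_quadratic_form intro!: sum_nonneg)
qed

lemma psd_mat_diagonalization:
  assumes A: "A \<in> psd_mat d"
  obtains U l where "U \<in> carrier_mat d d" "transpose_mat U * U = 1\<^sub>m d"
    "A = transpose_mat U * mat_diag d l * U" "\<And>i. i < d \<Longrightarrow> 0 \<le> l i"
proof -
  obtain U l where U: "U \<in> carrier_mat d d" "transpose_mat U * U = 1\<^sub>m d"
    and AU: "A = transpose_mat U * mat_diag d l * U"
    using spectral_theorem_real_symmetric[OF psd_matD(1,2)[OF A]] by blast
  have UU': "U * transpose_mat U = 1\<^sub>m d"
    using mat_mult_left_right_inverse[OF _ U(1) U(2)] U by auto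
  have "0 \<le> l i" if i: "i < d" for i
  proof -
    define v where "v = transpose_mat U *\<^sub>v unit_vec d i"
    have v: "v \<in> carrier_vec d" using U by (auto simp: v_def)
    have Uv: "U *\<^sub>v v = unit_vec d i"
      unfolding v_def using U UU' by (simp add: square_closed flip: assoc_mult_mat_vec[of _ d d _ d])
    have "0 \<le> (\<Sum>j<d. l j * ((U *\<^sub>v v) $ j)\<^sup>2)"
      using psd_matD(3)[OF A v] conjugated_diag_quadratic_form[OF U(1) v, of l] AU by simp
    also have "\<dots> = (\<Sum>j<d. if j = i then l i else 0)"
      unfolding Uv using i by (intro sum.cong) (auto simp: unit_vec_def)
    finally show ?thesis using i by simp
  qed
  with U AU that show ?thesis by blast
qed

lemma mat_powr_psd: "A \<in> psd_mat d \<Longrightarrow> mat_powr A t \<in> psd_mat d"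
  by (erule psd_mat_diagonalization) (simp add: mat_powr_eqI conjugated_diag_psd)

lemma mat_powr_smult:
  assumes A: "A \<in> psd_mat d" and c: "0 \<le> c"
  shows "mat_powr (c \<cdot>\<^sub>m A) t = (c powr t) \<cdot>\<^sub>m mat_powr A t"
proof -
  obtain U l where U: "U \<in> carrier_mat d d" "transpose_mat U * U = 1\<^sub>m d"
    and AU: "A = transpose_mat U * mat_diag d l * U" and l: "\<And>i. i < d \<Longrightarrow> 0 \<le> l i"
    using psd_mat_diagonalization[OF A] by metis
  have smult: "k \<cdot>\<^sub>m (transpose_mat U * mat_diag d m * U) = transpose_mat U * mat_diag d (\<lambda>i. k * m i) * U" for k m
  proof -
    have "mat_diag d (\<lambda>i. k * m i) = k \<cdot>\<^sub>m mat_diag d m"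
      by (rule eq_matI) (auto simp: mat_diag_def)
    then show ?thesis using U
      by (simp add: mult_smult_distrib[of _ d d _ d] mult_smult_assoc_mat[of _ d d _ d])
  qed
  have "mat_diag d (\<lambda>i. (c * l i) powr t) = mat_diag d (\<lambda>i. c powr t * l i powr t)"
    by (rule eq_matI) (auto simp: mat_diag_def powr_mult c l)
  then show ?thesis
    using mat_powr_eqI[OF U, of "c \<cdot>\<^sub>m A" "\<lambda>i. c * l i" t] mat_powr_eqI[OF U AU, of t]
    by (simp add: smult AU)
qed

lemma mat_powr_minus:
  assumes A: "A \<in> psd_mat d" and inv: "invertible_mat A"
  shows "invertible_mat (mat_powr A t)" "mat_powr A (- t) = minv (mat_powr A t)"
proof -
  obtain U l where U: "U \<in> carrier_mat d d" "transpose_mat U * U = 1\<^sub>m d"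
    and AU: "A = transpose_mat U * mat_diag d l * U" and l: "\<And>i. i < d \<Longrightarrow> 0 \<le> l i"
    using psd_mat_diagonalization[OF A] by metis
  have UU': "U * transpose_mat U = 1\<^sub>m d"
    using mat_mult_left_right_inverse[OF _ U(1) U(2)] U by auto
  have detU: "det U * det U = 1"
    using U by (metis det_mult det_one det_transpose transpose_carrier_mat)
  have "det A \<noteq> 0" using inv invertible_mat_iff_det[OF psd_matD(1)[OF A]] by blast
  moreover have "det A = det (mat_diag d l) * (det U * det U)"
    unfolding AU using U by (simp add: det_mult[of _ d] det_transpose mult_ac)
  ultimately have "det (mat_diag d l) \<noteq> 0" by auto
  moreover have "det (mat_diag d l) = (\<Prod>i\<in>{0..<d}. l i)"
    by (subst det_upper_triangular[of _ d]) (auto simp: mat_diag_def diag_mat_def prod.list_conv_set_nth)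
  ultimately have l0: "\<And>i. i < d \<Longrightarrow> l i \<noteq> 0" by auto
  note assoc = assoc_mult_mat[of _ d d _ d _ d]
  define P where "P = mat_powr A t"
  define Q where "Q = mat_powr A (- t)"
  have P: "P = transpose_mat U * mat_diag d (\<lambda>i. l i powr t) * U"
    and Q: "Q = transpose_mat U * mat_diag d (\<lambda>i. l i powr (- t)) * U"
    using mat_powr_eqI[OF U AU] by (auto simp: P_def Q_def)
  have PQc: "P \<in> carrier_mat d d" "Q \<in> carrier_mat d d" using U by (auto simp: P Q)
  have cancel: "U * (transpose_mat U * X) = X" if "X \<in> carrier_mat d d" for X
    using that U UU' by (simp add: square_closed flip: assoc)
  have cancel': "mat_diag d (\<lambda>i. l i powr t) * (mat_diag d (\<lambda>i. l i powr (- t)) * X) = X" if "X \<in> carrier_mat d d" for X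
  proof -
    have "mat_diag d (\<lambda>i. l i powr t * l i powr (- t)) = 1\<^sub>m d"
      using l0 by (intro eq_matI) (auto simp: mat_diag_def simp flip: powr_add)
    then show ?thesis using that by (simp add: square_closed flip: assoc)
  qed
  have PQ: "P * Q = 1\<^sub>m d"
    unfolding P Q using U by (simp add: square_closed assoc cancel cancel')
  then have "det P * det Q = 1" using PQc by (metis det_mult det_one)
  then show "invertible_mat (mat_powr A t)"
    using invertible_mat_iff_det[OF PQc(1)] by (auto simp: P_def)
  show "mat_powr A (- t) = minv (mat_powr A t)"
    using minv_eqI[OF PQc PQ] by (simp add: P_def Q_def)
qed

section \<open>Almost Auerbach bases\<close>

text \<open>
  Choose \<open>d\<close> vectors of \<open>S\<close> whose determinant is at least half the supremum.  By Cramer's rule the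
  coordinates of \<open>v\<close> are quotients of two such determinants, hence at most \<open>2\<close>.  Settling for
  half the supremum avoids any compactness argument.
\<close>

lemma near_auerbach_basis:
  fixes S :: "real vec set"
  assumes S: "S \<subseteq> carrier_vec d" and bdd: "\<And>v. v \<in> S \<Longrightarrow> vnorm v \<le> R"
    and A: "A \<in> carrier_mat d d" "det A \<noteq> 0" "\<And>i. i < d \<Longrightarrow> col A i \<in> S"
  obtains U where "U \<in> carrier_mat d d" "\<And>i. i < d \<Longrightarrow> col U i \<in> S"
    "\<And>v. v \<in> S \<Longrightarrow> \<exists>t\<in>carrier_vec d. v = U *\<^sub>v t \<and> (\<forall>i<d. \<bar>t $ i\<bar> \<le> 2)"
proof -
  define T where "T = {U \<in> carrier_mat d d. \<forall>i<d. col U i \<in> S}"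
  have AT: "A \<in> T" using A by (auto simp: T_def)
  have entry: "\<bar>U $$ (i, j)\<bar> \<le> \<bar>R\<bar>" if "U \<in> T" "i < d" "j < d" for U i j
  proof -
    have "U $$ (i, j) = col U j $ i" using that by (auto simp: T_def)
    also have "\<bar>\<dots>\<bar> \<le> vnorm (col U j)"
      using that by (intro abs_index_le_vnorm) (auto simp: T_def)
    also have "\<dots> \<le> R" using that by (intro bdd) (auto simp: T_def)
    finally show ?thesis by linarith
  qed
  define c where "c = (\<Sum>p\<in>{p. p permutes {0..<d}}. \<Prod>i = 0..<d. \<bar>R\<bar>)"
  have bound: "\<bar>det U\<bar> \<le> c" if U: "U \<in> T" for U
  proof -
    have "U \<in> carrier_mat d d" using U by (auto simp: T_def)
    from det_def'[OF this] have "\<bar>det U\<bar> \<le> (\<Sum>p\<in>{p. p permutes {0..<d}}. \<bar>signof p * (\<Prod>i = 0..<d. U $$ (i, p i))\<bar>)"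
      by simp
    also have "\<dots> \<le> c"
      unfolding c_def
    proof (intro sum_mono)
      fix p assume p: "p \<in> {p. p permutes {0..<d}}"
      have "\<bar>signof p * (\<Prod>i = 0..<d. U $$ (i, p i))\<bar> = (\<Prod>i = 0..<d. \<bar>U $$ (i, p i)\<bar>)"
        by (simp add: abs_mult abs_prod sign_def)
      also have "\<dots> \<le> (\<Prod>i = 0..<d. \<bar>R\<bar>)"
        using p entry[OF U] by (intro prod_mono) (auto simp: permutes_in_image)
      finally show "\<bar>signof p * (\<Prod>i = 0..<d. U $$ (i, p i))\<bar> \<le> (\<Prod>i = 0..<d. \<bar>R\<bar>)" .
    qed
    finally show ?thesis .
  qed
  (* The Leibniz formula bounds the determinant in terms of the bound for the entries. *)
  define s where "s = (SUP U\<in>T. \<bar>det U\<bar>)"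
  have upper: "\<bar>det U\<bar> \<le> s" if "U \<in> T" for U
    unfolding s_def using that bound by (intro cSUP_upper bdd_aboveI2) auto
  have s: "0 < s" using upper[OF AT] A by linarith
  then have "s / 2 < s" by simp
  then obtain U where U: "U \<in> T" "s / 2 < \<bar>det U\<bar>"
    unfolding s_def using less_cSUP_iff[of T "\<lambda>U. \<bar>det U\<bar>" "(SUP U\<in>T. \<bar>det U\<bar>) / 2"] AT bound
    by (metis bdd_aboveI2 empty_iff)
  have Uc: "U \<in> carrier_mat d d" using U by (auto simp: T_def)
  have detU: "det U \<noteq> 0" using U s by auto
  show ?thesis
  proof (rule that[OF Uc])
    show "col U i \<in> S" if "i < d" for i using U that by (auto simp: T_def)
  next
    fix v assume v: "v \<in> S"
    then have vc: "v \<in> carrier_vec d" using S by auto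
    define t where "t = minv U *\<^sub>v v"
    have inv: "invertible_mat U" using detU invertible_mat_iff_det[OF Uc] by blast
    have t: "t \<in> carrier_vec d" using Uc vc minv_carrier[OF Uc] by (auto simp: t_def intro!: square_closed)
    have vt: "U *\<^sub>v t = v"
      unfolding t_def using Uc vc minv_carrier[OF Uc] minv_right[OF Uc inv]
      by (simp add: square_closed flip: assoc_mult_mat_vec[of _ d d _ d])
    have "\<bar>t $ i\<bar> \<le> 2" if i: "i < d" for i
    proof -
      have "col (replace_col U v i) j = (if j = i then v else col U j)" if "j < d" for j
        using that Uc vc by (intro eq_vecI) (auto simp: replace_col_def)
      then have "replace_col U v i \<in> T"
        using U v Uc by (auto simp: T_def replace_col_def)
      from upper[OF this] have "\<bar>t $ i * det U\<bar> \<le> s"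
        using cramer_lemma_mat[OF Uc t i] vt by simp
      also have "s \<le> 2 * \<bar>det U\<bar>" using U by simp
      finally show ?thesis using detU by (simp add: abs_mult)
    qed
    then show "\<exists>t\<in>carrier_vec d. v = U *\<^sub>v t \<and> (\<forall>i<d. \<bar>t $ i\<bar> \<le> 2)"
      using t vt by blast
  qed
qed

section \<open>Measurability of matrix expressions\<close>

lemma borel_measurable_det:
  assumes "\<And>x. x \<in> space M \<Longrightarrow> A x \<in> carrier_mat d d"
    and "\<And>i j. i < d \<Longrightarrow> j < d \<Longrightarrow> (\<lambda>x. A x $$ (i, j)) \<in> borel_measurable M"
  shows "(\<lambda>x. det (A x) :: real) \<in> borel_measurable M"
proof -
  have "(\<lambda>x. \<Sum>p\<in>{p. p permutes {0..<d}}. signof p * (\<Prod>i = 0..<d. A x $$ (i, p i))) \<in> borel_measurable M"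
    using assms(2)
    by (intro borel_measurable_sum borel_measurable_times borel_measurable_prod) (auto simp: permutes_in_image)
  then show ?thesis
    by (subst measurable_cong[OF det_def'[OF assms(1)]])
qed

lemma borel_measurable_minv:
  fixes A :: "'a \<Rightarrow> real mat"
  assumes A: "\<And>x. x \<in> space M \<Longrightarrow> A x \<in> carrier_mat d d"
    and meas: "\<And>i j. i < d \<Longrightarrow> j < d \<Longrightarrow> (\<lambda>x. A x $$ (i, j)) \<in> borel_measurable M"
    and ij: "i < d" "j < d"
  shows "(\<lambda>x. minv (A x) $$ (i, j)) \<in> borel_measurable M"
proof -
  have del: "(\<lambda>x. det (mat_delete (A x) j i)) \<in> borel_measurable M"
  proof (rule borel_measurable_det[of _ _ "d - 1"])
    show "mat_delete (A x) j i \<in> carrier_mat (d - 1) (d - 1)" if "x \<in> space M" for x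
      using A[OF that] by (auto simp: mat_delete_def)
    fix k l assume kl: "k < d - 1" "l < d - 1"
    have "(\<lambda>x. A x $$ (if k < j then k else Suc k, if l < i then l else Suc l)) \<in> borel_measurable M"
      using kl by (intro meas) auto
    moreover have "mat_delete (A x) j i $$ (k, l) = A x $$ (if k < j then k else Suc k, if l < i then l else Suc l)"
      if "x \<in> space M" for x
      using A[OF that] kl by (simp add: mat_delete_def)
    ultimately show "(\<lambda>x. mat_delete (A x) j i $$ (k, l)) \<in> borel_measurable M"
      by (simp cong: measurable_cong)
  qed
  have "(\<lambda>x. inverse (det (A x)) * ((- 1) ^ (j + i) * det (mat_delete (A x) j i))) \<in> borel_measurable M"
    using del borel_measurable_det[OF A meas]
    by (intro borel_measurable_times borel_measurable_inverse) auto
  moreover have "minv (A x) $$ (i, j) = inverse (det (A x)) * ((- 1) ^ (j + i) * det (mat_delete (A x) j i))"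
    if "x \<in> space M" for x
    using A[OF that] ij by (simp add: minv_eq_adj_mat adj_mat_def cofactor_def)
  ultimately show ?thesis by (subst measurable_cong) auto
qed

lemma borel_measurable_mult_mat:
  fixes A B :: "'a \<Rightarrow> real mat"
  assumes A: "\<And>x. x \<in> space M \<Longrightarrow> A x \<in> carrier_mat d d"
    and "\<And>i j. i < d \<Longrightarrow> j < d \<Longrightarrow> (\<lambda>x. A x $$ (i, j)) \<in> borel_measurable M"
    and B: "\<And>x. x \<in> space M \<Longrightarrow> B x \<in> carrier_mat d d"
    and "\<And>i j. i < d \<Longrightarrow> j < d \<Longrightarrow> (\<lambda>x. B x $$ (i, j)) \<in> borel_measurable M"
    and ij: "i < d" "j < d"
  shows "(\<lambda>x. (A x * B x) $$ (i, j)) \<in> borel_measurable M"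
proof -
  have "(\<lambda>x. \<Sum>k = 0..<d. A x $$ (i, k) * B x $$ (k, j)) \<in> borel_measurable M"
    using assms by (intro borel_measurable_sum borel_measurable_times) auto
  moreover have "(A x * B x) $$ (i, j) = (\<Sum>k = 0..<d. A x $$ (i, k) * B x $$ (k, j))" if "x \<in> space M" for x
    using A[OF that] B[OF that] ij by (simp add: scalar_prod_def)
  ultimately show ?thesis by (subst measurable_cong) auto
qed

lemma borel_measurable_vnorm:
  assumes v: "\<And>x. x \<in> space M \<Longrightarrow> v x \<in> carrier_vec d"
    and "\<And>i. i < d \<Longrightarrow> (\<lambda>x. v x $ i) \<in> borel_measurable M"
  shows "(\<lambda>x. vnorm (v x)) \<in> borel_measurable M"
proof -
  have "(\<lambda>x. sqrt (\<Sum>i = 0..<d. v x $ i * v x $ i)) \<in> borel_measurable M"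
    using assms by (intro measurable_compose[OF _ borel_measurable_sqrt] borel_measurable_sum borel_measurable_times) auto
  moreover have "vnorm (v x) = sqrt (\<Sum>i = 0..<d. v x $ i * v x $ i)" if "x \<in> space M" for x
    using v[OF that] by (simp add: vnorm_def scalar_prod_def)
  ultimately show ?thesis by (subst measurable_cong) auto
qed

lemma borel_measurable_mult_mat_vec:
  fixes A :: "'a \<Rightarrow> real mat"
  assumes A: "\<And>x. x \<in> space M \<Longrightarrow> A x \<in> carrier_mat d d"
    and "\<And>i j. i < d \<Longrightarrow> j < d \<Longrightarrow> (\<lambda>x. A x $$ (i, j)) \<in> borel_measurable M"
    and v: "\<And>x. x \<in> space M \<Longrightarrow> v x \<in> carrier_vec d"
    and "\<And>i. i < d \<Longrightarrow> (\<lambda>x. v x $ i) \<in> borel_measurable M"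
    and i: "i < d"
  shows "(\<lambda>x. (A x *\<^sub>v v x) $ i) \<in> borel_measurable M"
proof -
  have "(\<lambda>x. \<Sum>k = 0..<d. A x $$ (i, k) * v x $ k) \<in> borel_measurable M"
    using assms by (intro borel_measurable_sum borel_measurable_times) auto
  moreover have "(A x *\<^sub>v v x) $ i = (\<Sum>k = 0..<d. A x $$ (i, k) * v x $ k)" if "x \<in> space M" for x
    using A[OF that] v[OF that] i by (simp add: scalar_prod_def)
  ultimately show ?thesis by (subst measurable_cong) auto
qed

lemma borel_measurable_vnorm_mult:
  fixes A :: "'a \<Rightarrow> real mat"
  assumes A: "\<And>x. x \<in> space M \<Longrightarrow> A x \<in> carrier_mat d d"
    and meas: "\<And>i j. i < d \<Longrightarrow> j < d \<Longrightarrow> (\<lambda>x. A x $$ (i, j)) \<in> borel_measurable M"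
    and v: "v \<in> carrier_vec d"
  shows "(\<lambda>x. vnorm (A x *\<^sub>v v)) \<in> borel_measurable M"
  using v
  by (intro borel_measurable_vnorm[of _ _ d] borel_measurable_mult_mat_vec[OF A meas]
      mult_mat_vec_carrier[OF A]) auto

text \<open>
  The bound \<open>op_norm A \<le> c\<close> is a condition on the countably many rational vectors, by continuity
  of both sides of \<open>|A v| \<le> c |v|\<close> in \<open>v\<close>.
\<close>

lemma borel_measurable_op_norm:
  fixes A :: "'a \<Rightarrow> real mat"
  assumes A: "\<And>x. x \<in> space M \<Longrightarrow> A x \<in> carrier_mat d d"
    and meas: "\<And>i j. i < d \<Longrightarrow> j < d \<Longrightarrow> (\<lambda>x. A x $$ (i, j)) \<in> borel_measurable M"
    and d: "0 < d"
  shows "(\<lambda>x. op_norm (A x)) \<in> borel_measurable M"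
proof (rule borel_measurable_iff_le[THEN iffD2], rule allI)
  fix c
  define Q :: "real vec set" where "Q = {v \<in> carrier_vec d. \<forall>i<d. v $ i \<in> \<rat>}"
  have Q: "countable Q"
  proof -
    have "Q \<subseteq> (\<lambda>xs. vec_of_list (map real_of_rat xs)) ` UNIV"
    proof
      fix v assume v: "v \<in> Q"
      then have "\<forall>i<d. \<exists>r. v $ i = real_of_rat r" by (auto simp: Q_def Rats_def)
      then obtain r where "\<forall>i<d. v $ i = real_of_rat (r i)" by metis
      then have "v = vec_of_list (map real_of_rat (map r [0..<d]))"
        using v by (intro eq_vecI) (auto simp: Q_def vec_of_list_index)
      then show "v \<in> (\<lambda>xs. vec_of_list (map real_of_rat xs)) ` UNIV" by blast
    qed
    then show ?thesis by (rule countable_subset) auto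
  qed
  have iff: "op_norm B \<le> c \<longleftrightarrow> (\<forall>v\<in>Q. vnorm (B *\<^sub>v v) \<le> c * vnorm v)" if B: "B \<in> carrier_mat d d" for B
  proof
    assume "op_norm B \<le> c"
    then have "op_norm B * vnorm v \<le> c * vnorm v" for v by (intro mult_right_mono) auto
    with vnorm_mult_mat_vec_le[OF B] show "\<forall>v\<in>Q. vnorm (B *\<^sub>v v) \<le> c * vnorm v"
      unfolding Q_def by (blast intro: order_trans)
  next
    assume le: "\<forall>v\<in>Q. vnorm (B *\<^sub>v v) \<le> c * vnorm v"
    show "op_norm B \<le> c"
    proof (rule op_norm_le[OF B d])
      fix v :: "real vec" assume v: "v \<in> carrier_vec d"
      define w where "w = (\<lambda>n. vec d (\<lambda>i. \<lfloor>real (Suc n) * v $ i\<rfloor> / real (Suc n)))"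
      have wQ: "w n \<in> Q" for n by (auto simp: w_def Q_def)
      have w: "(\<lambda>n. w n $ i) \<longlonglongrightarrow> v $ i" if i: "i < d" for i
      proof -
        have "\<bar>w n $ i - v $ i\<bar> \<le> 1 / real (Suc n)" for n
        proof -
          have "w n $ i - v $ i = (\<lfloor>real (Suc n) * v $ i\<rfloor> - real (Suc n) * v $ i) / real (Suc n)"
            using i by (simp add: w_def field_simps)
          moreover have "\<bar>\<lfloor>real (Suc n) * v $ i\<rfloor> - real (Suc n) * v $ i\<bar> \<le> 1" by linarith
          ultimately show ?thesis by (simp add: abs_divide divide_right_mono del: of_nat_Suc)
        qed
        then have "(\<lambda>n. w n $ i - v $ i) \<longlonglongrightarrow> 0"
          by (intro Lim_null_comparison[OF _ LIMSEQ_inverse_real_of_nat])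
             (auto simp: inverse_eq_divide)
        then show ?thesis using LIM_zero_iff by blast
      qed
      have 1: "(\<lambda>n. vnorm (w n)) \<longlonglongrightarrow> vnorm v"
      proof -
        have "(\<lambda>n. sqrt (\<Sum>i = 0..<d. w n $ i * w n $ i)) \<longlonglongrightarrow> sqrt (\<Sum>i = 0..<d. v $ i * v $ i)"
          using w by (intro tendsto_intros) auto
        moreover have "dim_vec (w n) = d" for n by (simp add: w_def)
        ultimately show ?thesis using v by (simp add: vnorm_def scalar_prod_def)
      qed
      have 2: "(\<lambda>n. vnorm (B *\<^sub>v w n)) \<longlonglongrightarrow> vnorm (B *\<^sub>v v)"
      proof -
        have "(\<lambda>n. sqrt (\<Sum>i = 0..<d. (\<Sum>j = 0..<d. B $$ (i, j) * w n $ j) * (\<Sum>j = 0..<d. B $$ (i, j) * w n $ j)))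
          \<longlonglongrightarrow> sqrt (\<Sum>i = 0..<d. (\<Sum>j = 0..<d. B $$ (i, j) * v $ j) * (\<Sum>j = 0..<d. B $$ (i, j) * v $ j))"
          using w by (intro tendsto_intros) auto
        moreover have "dim_vec (w n) = d" for n by (simp add: w_def)
        ultimately show ?thesis using v B by (simp add: vnorm_def scalar_prod_def)
      qed
      show "vnorm (B *\<^sub>v v) \<le> c * vnorm v"
        using le wQ by (intro LIMSEQ_le[OF 2 tendsto_mult[OF tendsto_const 1]]) auto
    qed
  qed
  have zero: "0\<^sub>v d \<in> Q" by (simp add: Q_def)
  have "{x \<in> space M. op_norm (A x) \<le> c} = {x \<in> space M. \<forall>v\<in>Q. vnorm (A x *\<^sub>v v) \<le> c * vnorm v}"
    using iff A by auto
  also have "\<dots> = (\<Inter>v\<in>Q. {x \<in> space M. vnorm (A x *\<^sub>v v) \<le> c * vnorm v})"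
    using zero by blast
  also have "\<dots> \<in> sets M"
  proof (intro sets.countable_INT' Q)
    show "(\<lambda>v. {x \<in> space M. vnorm (A x *\<^sub>v v) \<le> c * vnorm v}) ` Q \<subseteq> sets M"
    proof (intro image_subsetI)
      fix v assume "v \<in> Q"
      then have "(\<lambda>x. vnorm (A x *\<^sub>v v)) \<in> borel_measurable M"
        by (intro borel_measurable_vnorm_mult[OF A meas]) (auto simp: Q_def)
      then show "{x \<in> space M. vnorm (A x *\<^sub>v v) \<le> c * vnorm v} \<in> sets M" by measurable
    qed
  qed (use zero in auto)
  finally show "{x \<in> space M. op_norm (A x) \<le> c} \<in> sets M" .
qed

section \<open>Powers of nonnegative functions and the Rubio de Francia series\<close>

lemma epowr_top [simp]: "epowr top a = top"
  by (simp add: epowr_def)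

lemma epowr_ennreal: "0 \<le> x \<Longrightarrow> epowr (ennreal x) a = ennreal (x powr a)"
  by (simp add: epowr_def)

lemma epowr_zero [simp]: "epowr 0 a = 0"
  using epowr_ennreal[of 0 a] by simp

lemma epowr_eq_0_iff [simp]: "epowr x a = 0 \<longleftrightarrow> x = 0"
  by (cases x) (auto simp: epowr_ennreal)

lemma epowr_eq_top_iff [simp]: "epowr x a = top \<longleftrightarrow> x = top"
  by (cases x) (auto simp: epowr_ennreal)

lemma epowr_one [simp]: "epowr x 1 = x"
  by (cases x) (auto simp: epowr_ennreal)

lemma epowr_mono:
  assumes "x \<le> y" "0 \<le> a" shows "epowr x a \<le> epowr y a"
proof (cases y)
  case (real v)
  with assms have "x \<noteq> top" by (auto simp: top_unique)
  then obtain u where "x = ennreal u" "0 \<le> u" by (cases x) auto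
  with real assms show ?thesis by (auto simp: epowr_ennreal intro!: ennreal_leI powr_mono2)
qed simp

lemma epowr_mult: "epowr (x * y) a = epowr x a * epowr y a"
proof -
  have top: "epowr (top * z) a = top * epowr z a" for z
    by (cases "z = 0") (auto simp: ennreal_top_mult)
  show ?thesis
  proof (cases x)
    case (real u)
    show ?thesis
    proof (cases y)
      case (real v)
      with \<open>x = ennreal u\<close> \<open>0 \<le> u\<close> show ?thesis
        by (simp add: epowr_ennreal powr_mult flip: ennreal_mult)
    next
      case top
      then show ?thesis using \<open>\<And>z. epowr (top * z) a = top * epowr z a\<close>[of x] by (simp add: mult.commute)
    qed
  qed (use top in simp)
qed

lemma epowr_epowr: "epowr (epowr x a) b = epowr x (a * b)"
  by (cases x) (auto simp: epowr_ennreal powr_powr)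

lemma epowr_inverse_le:
  assumes "epowr x p \<le> y" "0 < p" shows "x \<le> epowr y (1 / p)"
  using epowr_mono[OF assms(1), of "1 / p"] assms(2) by (simp add: epowr_epowr)

lemma borel_measurable_epowr [measurable]:
  assumes [measurable]: "h \<in> borel_measurable M"
  shows "(\<lambda>x. epowr (h x) a) \<in> borel_measurable M"
  unfolding epowr_def by measurable

text \<open>
  Division by \<open>c\<close> maps the simple functions below \<open>c f\<close> to simple functions below \<open>f\<close>.  The inequality
  thus holds for nonmeasurable \<open>f\<close> too, and nested averages can be estimated without discussing the
  measurability of the inner ones.
\<close>

lemma nn_integral_cmult_le:
  fixes f :: "'a \<Rightarrow> ennreal"
  assumes c: "c < top"
  shows "(\<integral>\<^sup>+x. c * f x \<partial>M) \<le> c * (\<integral>\<^sup>+x. f x \<partial>M)"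
proof (cases "c = 0")
  case False
  have c': "c * inverse c = 1" using c False
    by (metis ennreal_divide_self divide_ennreal_def less_irrefl)
  show ?thesis
    unfolding nn_integral_def[of M "\<lambda>x. c * f x"]
  proof (rule SUP_least)
    fix g assume "g \<in> {g. simple_function M g \<and> g \<le> (\<lambda>x. c * f x)}"
    then have g: "simple_function M g" "\<And>x. g x \<le> c * f x" by (auto simp: le_fun_def)
    have g'[simp]: "simple_function M (\<lambda>x. inverse c * g x)" using g by auto
    have "inverse c * g x \<le> f x" for x
    proof -
      have "inverse c * g x \<le> inverse c * (c * f x)" using g(2) by (intro mult_left_mono) auto
      also have "\<dots> = f x" using c' by (simp add: mult.assoc[symmetric] mult.commute[of "inverse c"])
      finally show ?thesis .
    qed
    then have "(\<integral>\<^sup>+x. inverse c * g x \<partial>M) \<le> (\<integral>\<^sup>+x. f x \<partial>M)" by (intro nn_integral_mono)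
    then have "c * (\<integral>\<^sup>+x. inverse c * g x \<partial>M) \<le> c * (\<integral>\<^sup>+x. f x \<partial>M)" by (intro mult_left_mono) auto
    also have "c * (\<integral>\<^sup>+x. inverse c * g x \<partial>M) = (\<integral>\<^sup>+x. c * (inverse c * g x) \<partial>M)"
      using g' by (intro nn_integral_cmult[symmetric] borel_measurable_simple_function)
    also have "\<dots> = (\<integral>\<^sup>+x. g x \<partial>M)" using c' by (simp add: mult.assoc[symmetric])
    also have "\<dots> = integral\<^sup>S M g" using g(1) by (rule nn_integral_eq_simple_integral)
    finally show "integral\<^sup>S M g \<le> c * (\<integral>\<^sup>+x. f x \<partial>M)" .
  qed
qed simp

lemma weighted_arith_geo_mean:
  fixes u v :: real
  assumes "0 \<le> u" "0 \<le> v" "0 < \<theta>" "\<theta> < 1"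
  shows "u powr \<theta> * v powr (1 - \<theta>) \<le> \<theta> * u + (1 - \<theta>) * v"
proof (cases "u = 0 \<or> v = 0")
  case False
  then show ?thesis using assms by (intro Youngs_inequality_0) auto
qed (use assms in auto)

text \<open>
  The weighted inequality between arithmetic and geometric mean for \<open>u / \<integral> u\<close> and \<open>v / \<integral> v\<close>,
  integrated.
\<close>

lemma nn_integral_Holder:
  fixes u v :: "'a \<Rightarrow> real"
  assumes [measurable]: "u \<in> borel_measurable M" "v \<in> borel_measurable M"
    and u: "\<And>x. 0 \<le> u x" and v: "\<And>x. 0 \<le> v x" and \<theta>: "0 < \<theta>" "\<theta> < 1"
    and finu: "(\<integral>\<^sup>+x. u x \<partial>M) < top" and finv: "(\<integral>\<^sup>+x. v x \<partial>M) < top"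
  shows "(\<integral>\<^sup>+x. ennreal (u x powr \<theta> * v x powr (1 - \<theta>)) \<partial>M)
    \<le> epowr (\<integral>\<^sup>+x. u x \<partial>M) \<theta> * epowr (\<integral>\<^sup>+x. v x \<partial>M) (1 - \<theta>)"
proof -
  obtain U where U: "(\<integral>\<^sup>+x. u x \<partial>M) = ennreal U" "0 \<le> U" using finu by (cases "\<integral>\<^sup>+x. u x \<partial>M") auto
  obtain V where V: "(\<integral>\<^sup>+x. v x \<partial>M) = ennreal V" "0 \<le> V" using finv by (cases "\<integral>\<^sup>+x. v x \<partial>M") auto
  show ?thesis
  proof (cases "U = 0 \<or> V = 0")
    case True
    then have "AE x in M. u x = 0 \<or> v x = 0"
    proof
      assume "U = 0"
      with U(1) have "AE x in M. ennreal (u x) = 0"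
        using nn_integral_0_iff_AE[of "\<lambda>x. ennreal (u x)" M] by simp
      then show ?thesis by eventually_elim (use u in \<open>auto simp: ennreal_eq_0_iff antisym\<close>)
    next
      assume "V = 0"
      with V(1) have "AE x in M. ennreal (v x) = 0"
        using nn_integral_0_iff_AE[of "\<lambda>x. ennreal (v x)" M] by simp
      then show ?thesis by eventually_elim (use v in \<open>auto simp: ennreal_eq_0_iff antisym\<close>)
    qed
    then have "AE x in M. ennreal (u x powr \<theta> * v x powr (1 - \<theta>)) = 0"
      by eventually_elim auto
    then have "(\<integral>\<^sup>+x. ennreal (u x powr \<theta> * v x powr (1 - \<theta>)) \<partial>M) = 0"
      by (subst nn_integral_0_iff_AE) auto
    then show ?thesis by simp
  next
    case False
    then have pos: "0 < U" "0 < V" using U V by auto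
    let ?c = "U powr \<theta> * V powr (1 - \<theta>)"
    have pt: "u x powr \<theta> * v x powr (1 - \<theta>) \<le> ?c * (\<theta> / U) * u x + ?c * ((1 - \<theta>) / V) * v x" for x
    proof -
      have "u x powr \<theta> * v x powr (1 - \<theta>) = ?c * ((u x / U) powr \<theta> * (v x / V) powr (1 - \<theta>))"
        using pos u[of x] v[of x] by (simp add: powr_divide)
      also have "\<dots> \<le> ?c * (\<theta> * (u x / U) + (1 - \<theta>) * (v x / V))"
        using pos u v \<theta> by (intro mult_left_mono weighted_arith_geo_mean) auto
      finally show ?thesis by (simp add: algebra_simps)
    qed
    have "(\<integral>\<^sup>+x. ennreal (u x powr \<theta> * v x powr (1 - \<theta>)) \<partial>M)
       \<le> (\<integral>\<^sup>+x. ennreal (?c * (\<theta> / U)) * ennreal (u x) + ennreal (?c * ((1 - \<theta>) / V)) * ennreal (v x) \<partial>M)"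
      using pt pos \<theta> u v
      by (intro nn_integral_mono) (simp flip: ennreal_mult ennreal_plus add: ennreal_leI)
    also have "\<dots> = ennreal (?c * (\<theta> / U)) * ennreal U + ennreal (?c * ((1 - \<theta>) / V)) * ennreal V"
      by (simp add: nn_integral_add nn_integral_cmult U V)
    also have "\<dots> = ennreal (?c * (\<theta> / U) * U + ?c * ((1 - \<theta>) / V) * V)"
      using pos \<theta> by (simp flip: ennreal_mult ennreal_plus)
    also have "?c * (\<theta> / U) * U + ?c * ((1 - \<theta>) / V) * V = ?c"
      using pos by (simp add: field_simps)
    also have "ennreal ?c = epowr (ennreal U) \<theta> * epowr (ennreal V) (1 - \<theta>)"
      using U V by (simp add: epowr_ennreal ennreal_mult)
    finally show ?thesis by (simp add: U V)
  qed
qed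

lemma midpoint_powr_le:
  fixes u v :: real
  assumes "0 \<le> u" "0 \<le> v" "1 \<le> p"
  shows "(1/2 * u + 1/2 * v) powr p \<le> 1/2 * u powr p + 1/2 * v powr p"
proof -
  have half: "(1/2 :: real) powr p \<le> 1/2"
    using powr_mono'[of 1 p "1/2"] assms(3) by simp
  then have half': "(1/2 * w) powr p \<le> 1/2 * w powr p" if "0 \<le> w" for w :: real
    using mult_right_mono[OF half, of "w powr p"] unfolding powr_mult by simp
  consider "u = 0" | "v = 0" | "0 < u" "0 < v" using assms by linarith
  then show ?thesis
  proof cases
    case 3
    then show ?thesis
      using convex_onD[OF powr_convex[OF assms(3)], of "1/2" u v] by simp
  qed (use half' assms in auto)
qed

text \<open>
  Jensen's inequality for the weights \<open>2^(-i-1)\<close>, by iterating the midpoint case.  As the finitely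
  many weights add up to less than one, the missing mass sits at zero.
\<close>

lemma dyadic_sum_powr_le:
  fixes u :: "nat \<Rightarrow> real"
  assumes "\<And>i. 0 \<le> u i" and p: "1 \<le> p"
  shows "(\<Sum>i<n. (1/2) ^ Suc i * u i) powr p \<le> (\<Sum>i<n. (1/2) ^ Suc i * u i powr p)"
  using assms(1)
proof (induction n arbitrary: u)
  case 0 then show ?case by simp
next
  case (Suc n)
  let ?S = "\<Sum>i<n. (1/2) ^ Suc i * u (Suc i)"
  have split: "(\<Sum>i<Suc n. (1/2) ^ Suc i * f i) = 1/2 * f 0 + 1/2 * (\<Sum>i<n. (1/2) ^ Suc i * f (Suc i))" for f :: "nat \<Rightarrow> real"
    by (subst sum.lessThan_Suc_shift) (simp add: sum_distrib_left mult.assoc)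
  have "(1/2 * u 0 + 1/2 * ?S) powr p \<le> 1/2 * u 0 powr p + 1/2 * ?S powr p"
    using Suc.prems p by (intro midpoint_powr_le) (auto intro!: sum_nonneg)
  also have "\<dots> \<le> 1/2 * u 0 powr p + 1/2 * (\<Sum>i<n. (1/2) ^ Suc i * u (Suc i) powr p)"
    using Suc.IH[of "\<lambda>i. u (Suc i)"] Suc.prems by simp
  finally show ?case using split[of u] split[of "\<lambda>i. u i powr p"] by simp
qed

lemma dyadic_suminf_epowr_le:
  fixes u :: "nat \<Rightarrow> ennreal"
  assumes p: "1 \<le> p"
  shows "epowr (\<Sum>i. ennreal ((1/2) ^ Suc i) * u i) p \<le> (\<Sum>i. ennreal ((1/2) ^ Suc i) * epowr (u i) p)" (is "_ \<le> ?S")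
proof (cases "\<exists>i. u i = top")
  case True
  then obtain i where "u i = top" by blast
  then have "top \<le> ennreal ((1/2) ^ Suc i) * epowr (u i) p" by (simp add: ennreal_mult_top)
  also have "\<dots> = (\<Sum>j\<in>{i}. ennreal ((1/2) ^ Suc j) * epowr (u j) p)" by simp
  also have "\<dots> \<le> ?S" by (intro sum_le_suminf) auto
  finally have "?S = top" by (simp add: top_unique)
  then show ?thesis by simp
next
  case False
  define v where "v = (\<lambda>i. enn2real (u i))"
  have v: "u i = ennreal (v i)" "0 \<le> v i" for i
    using False by (auto simp: v_def less_top)
  have part: "(\<Sum>i<n. ennreal ((1/2) ^ Suc i) * u i) \<le> epowr ?S (1 / p)" for n
  proof (rule epowr_inverse_le)
    have "epowr (\<Sum>i<n. ennreal ((1/2) ^ Suc i) * u i) p = ennreal ((\<Sum>i<n. (1/2) ^ Suc i * v i) powr p)"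
      using v(2) by (simp add: v(1) sum_ennreal epowr_ennreal sum_nonneg flip: ennreal_mult)
    also have "\<dots> \<le> ennreal (\<Sum>i<n. (1/2) ^ Suc i * v i powr p)"
      using v(2) p by (intro ennreal_leI dyadic_sum_powr_le) auto
    also have "\<dots> = (\<Sum>i<n. ennreal ((1/2) ^ Suc i) * epowr (u i) p)"
      using v(2) by (simp add: v(1) sum_ennreal epowr_ennreal flip: ennreal_mult)
    also have "\<dots> \<le> ?S" by (intro sum_le_suminf) auto
    finally show "epowr (\<Sum>i<n. ennreal ((1/2) ^ Suc i) * u i) p \<le> ?S" .
  qed (use p in auto)
  have "(\<Sum>i. ennreal ((1/2) ^ Suc i) * u i) \<le> epowr ?S (1 / p)"
    unfolding suminf_eq_SUP[of "\<lambda>i. ennreal ((1/2) ^ Suc i) * u i"] by (rule SUP_least) (rule part)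
  from epowr_mono[OF this, of p] show ?thesis using p by (simp add: epowr_epowr)
qed

lemma epowr_sum_le:
  fixes m :: "nat \<Rightarrow> ennreal"
  assumes p: "0 \<le> p"
  shows "epowr (\<Sum>i<d. m i) p \<le> ennreal (real d powr p) * (\<Sum>i<d. epowr (m i) p)"
proof (cases "d = 0")
  case False
  have "Max (m ` {..<d}) \<in> m ` {..<d}" using False by (intro Max_in) auto
  then obtain j where j: "j < d" "m j = Max (m ` {..<d})" by auto
  have "(\<Sum>i<d. m i) \<le> (\<Sum>i<d. m j)" unfolding j(2) by (intro sum_mono Max_ge) auto
  also have "\<dots> = ennreal (real d) * m j" by (simp add: ennreal_of_nat_eq_real_of_nat)
  finally have "epowr (\<Sum>i<d. m i) p \<le> epowr (ennreal (real d) * m j) p" using p by (rule epowr_mono)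
  also have "\<dots> = ennreal (real d powr p) * epowr (m j) p" by (simp add: epowr_mult epowr_ennreal)
  also have "epowr (m j) p \<le> (\<Sum>i<d. epowr (m i) p)"
    using j(1) by (intro member_le_sum) auto
  finally show ?thesis by (simp add: mult_left_mono)
qed simp

text \<open>
  The majorant is \<open>H = \<Sum>k. T^k h / (2 C)^k\<close>.  Applying \<open>T\<close> shifts the series by one term, which
  costs the factor \<open>2 C\<close>.  The norm is estimated by Jensen's inequality instead of Minkowski's: up
  to the factor \<open>2\<close>, \<open>H\<close> is the mean of the functions \<open>T^k h / C^k\<close> with weights \<open>2^(-k-1)\<close>.
\<close>

lemma rubio_de_francia:
  fixes T :: "('a \<Rightarrow> ennreal) \<Rightarrow> 'a \<Rightarrow> ennreal"
  assumes p: "1 \<le> p" and C: "0 < C"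
    and bounded: "\<And>h. h \<in> borel_measurable M \<Longrightarrow> (\<integral>\<^sup>+x. epowr (h x) p \<partial>M) < top \<Longrightarrow>
      T h \<in> borel_measurable M \<and> (\<integral>\<^sup>+x. epowr (T h x) p \<partial>M) \<le> ennreal (C powr p) * (\<integral>\<^sup>+x. epowr (h x) p \<partial>M)"
    and subadd: "\<And>(h :: nat \<Rightarrow> 'a \<Rightarrow> ennreal) (c :: nat \<Rightarrow> ennreal) x. (\<And>k. h k \<in> borel_measurable M) \<Longrightarrow> x \<in> space M \<Longrightarrow>
      T (\<lambda>y. \<Sum>k. c k * h k y) x \<le> (\<Sum>k. c k * T (h k) x)"
    and h[measurable]: "h \<in> borel_measurable M" and fin: "(\<integral>\<^sup>+x. epowr (h x) p \<partial>M) < top"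
  obtains H where "H \<in> borel_measurable M" "\<And>x. h x \<le> H x"
    "(\<integral>\<^sup>+x. epowr (H x) p \<partial>M) \<le> ennreal (2 powr p) * (\<integral>\<^sup>+x. epowr (h x) p \<partial>M)"
    "\<And>x. x \<in> space M \<Longrightarrow> T H x \<le> ennreal (2 * C) * H x"
proof -
  define I where "I = (\<integral>\<^sup>+x. epowr (h x) p \<partial>M)"
  have it: "(T ^^ k) h \<in> borel_measurable M \<and> (\<integral>\<^sup>+x. epowr ((T ^^ k) h x) p \<partial>M) \<le> ennreal ((C ^ k) powr p) * I" for k
  proof (induction k)
    case 0 then show ?case by (simp add: I_def)
  next
    case (Suc k)
    have "ennreal ((C ^ k) powr p) * I < top"
      using fin by (simp add: I_def ennreal_mult_less_top)
    with Suc have "(\<integral>\<^sup>+x. epowr ((T ^^ k) h x) p \<partial>M) < top"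
      by (meson le_less_trans)
    from bounded[OF _ this] Suc have b: "T ((T ^^ k) h) \<in> borel_measurable M"
      "(\<integral>\<^sup>+x. epowr (T ((T ^^ k) h) x) p \<partial>M) \<le> ennreal (C powr p) * (\<integral>\<^sup>+x. epowr ((T ^^ k) h x) p \<partial>M)" by auto
    note b(2)
    also have "ennreal (C powr p) * (\<integral>\<^sup>+x. epowr ((T ^^ k) h x) p \<partial>M) \<le> ennreal (C powr p) * (ennreal ((C ^ k) powr p) * I)"
      using Suc by (intro mult_left_mono) auto
    also have "\<dots> = ennreal ((C ^ Suc k) powr p) * I"
      using C by (simp add: powr_mult ennreal_mult mult.assoc)
    finally show ?case using b(1) by simp
  qed
  then have [measurable]: "(T ^^ k) h \<in> borel_measurable M" for k by blast
  define c where "c = (\<lambda>k. ennreal ((1 / (2 * C)) ^ k))"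
  define H where "H = (\<lambda>x. \<Sum>k. c k * (T ^^ k) h x)"
  show ?thesis
  proof (rule that[of H])
    show [measurable]: "H \<in> borel_measurable M" unfolding H_def by measurable
    show "h x \<le> H x" for x
    proof -
      have "h x = (\<Sum>k\<in>{0}. c k * (T ^^ k) h x)" by (simp add: c_def)
      also have "\<dots> \<le> H x" unfolding H_def by (intro sum_le_suminf) auto
      finally show ?thesis .
    qed
    show "T H x \<le> ennreal (2 * C) * H x" if x: "x \<in> space M" for x
    proof -
      have "T H x \<le> (\<Sum>k. c k * T ((T ^^ k) h) x)"
        unfolding H_def using x by (intro subadd) auto
      also have "\<dots> = (\<Sum>k. ennreal (2 * C) * (c (Suc k) * (T ^^ Suc k) h x))"
      proof (intro suminf_cong)
        fix k
        have "c k = ennreal (2 * C) * c (Suc k)"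
          using C by (simp add: c_def flip: ennreal_mult)
        then show "c k * T ((T ^^ k) h) x = ennreal (2 * C) * (c (Suc k) * (T ^^ Suc k) h x)"
          by (simp add: mult.assoc)
      qed
      also have "\<dots> = ennreal (2 * C) * (\<Sum>k. c (Suc k) * (T ^^ Suc k) h x)" by (simp add: ennreal_suminf_cmult)
      also have "(\<Sum>k. c (Suc k) * (T ^^ Suc k) h x) \<le> H x"
        unfolding suminf_eq_SUP[of "\<lambda>k. c (Suc k) * (T ^^ Suc k) h x"]
      proof (rule SUP_least)
        fix n
        have "(\<Sum>k<n. c (Suc k) * (T ^^ Suc k) h x) \<le> (\<Sum>k<Suc n. c k * (T ^^ k) h x)"
          by (subst sum.lessThan_Suc_shift) simp
        also have "\<dots> \<le> H x" unfolding H_def by (intro sum_le_suminf) auto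
        finally show "(\<Sum>k<n. c (Suc k) * (T ^^ Suc k) h x) \<le> H x" .
      qed
      finally show ?thesis by (simp add: mult_left_mono)
    qed
    (* The functions u k all have norm at most that of h. *)
    define u where "u = (\<lambda>k x. ennreal ((1 / C) ^ k) * (T ^^ k) h x)"
    have [measurable]: "u k \<in> borel_measurable M" for k unfolding u_def by measurable
    have "H x = 2 * (\<Sum>k. ennreal ((1/2) ^ Suc k) * u k x)" for x
    proof -
      have "c k * (T ^^ k) h x = 2 * (ennreal ((1/2) ^ Suc k) * u k x)" for k
      proof -
        define A B where "A = (1/2 :: real) ^ Suc k" and "B = (1 / C) ^ k"
        have AB: "0 \<le> A" "0 \<le> B" using C by (auto simp: A_def B_def)
        have "c k = ennreal (2 * (A * B))"
          by (simp add: c_def A_def B_def power_divide power_mult_distrib)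
        also have "\<dots> = 2 * ennreal A * ennreal B"
          using AB by (simp add: ennreal_mult mult.assoc)
        also have "\<dots> = 2 * ennreal ((1/2) ^ Suc k) * ennreal ((1 / C) ^ k)" unfolding A_def B_def ..
        finally show ?thesis by (simp add: u_def mult.assoc)
      qed
      then show ?thesis by (simp add: H_def ennreal_suminf_cmult)
    qed
    then have "(\<integral>\<^sup>+x. epowr (H x) p \<partial>M) = (\<integral>\<^sup>+x. ennreal (2 powr p) * epowr (\<Sum>k. ennreal ((1/2) ^ Suc k) * u k x) p \<partial>M)"
      using epowr_ennreal[of 2 p] by (simp add: epowr_mult)
    also have "\<dots> = ennreal (2 powr p) * (\<integral>\<^sup>+x. epowr (\<Sum>k. ennreal ((1/2) ^ Suc k) * u k x) p \<partial>M)"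
      by (intro nn_integral_cmult) auto
    also have "(\<integral>\<^sup>+x. epowr (\<Sum>k. ennreal ((1/2) ^ Suc k) * u k x) p \<partial>M) \<le> (\<integral>\<^sup>+x. (\<Sum>k. ennreal ((1/2) ^ Suc k) * epowr (u k x) p) \<partial>M)"
      using p by (intro nn_integral_mono dyadic_suminf_epowr_le)
    also have "\<dots> = (\<Sum>k. ennreal ((1/2) ^ Suc k) * (\<integral>\<^sup>+x. epowr (u k x) p \<partial>M))"
      by (subst nn_integral_suminf) (auto intro!: suminf_cong nn_integral_cmult)
    also have "\<dots> \<le> (\<Sum>k. ennreal ((1/2) ^ Suc k) * I)"
    proof (intro suminf_le mult_left_mono)
      fix k
      have "(\<integral>\<^sup>+x. epowr (u k x) p \<partial>M) = ennreal (((1 / C) ^ k) powr p) * (\<integral>\<^sup>+x. epowr ((T ^^ k) h x) p \<partial>M)"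
        using C by (simp add: u_def epowr_mult epowr_ennreal nn_integral_cmult)
      also have "\<dots> \<le> ennreal (((1 / C) ^ k) powr p) * (ennreal ((C ^ k) powr p) * I)"
        using it by (intro mult_left_mono) auto
      also have "\<dots> = I"
        using C by (simp add: mult.assoc[symmetric] power_divide flip: ennreal_mult powr_mult)
      finally show "(\<integral>\<^sup>+x. epowr (u k x) p \<partial>M) \<le> I" .
    qed auto
    also have "\<dots> = (\<Sum>k. ennreal ((1/2) ^ Suc k)) * I" by simp
    also have "(\<Sum>k. ennreal ((1/2) ^ Suc k)) = 1"
      using power_half_series by (subst suminf_ennreal_eq[of _ 1]) auto
    finally show "(\<integral>\<^sup>+x. epowr (H x) p \<partial>M) \<le> ennreal (2 powr p) * (\<integral>\<^sup>+x. epowr (h x) p \<partial>M)"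
      by (simp add: I_def mult_left_mono)
  qed
qed

section \<open>Scalar estimates with two majorants\<close>

lemma AE_ennreal_eq_0D:
  fixes u :: "'a \<Rightarrow> real"
  assumes "(\<integral>\<^sup>+x. ennreal (u x) \<partial>M) = 0" "u \<in> borel_measurable M" "\<And>x. 0 \<le> u x"
  shows "AE x in M. u x = 0"
proof -
  have "AE x in M. ennreal (u x) = 0"
    using assms nn_integral_0_iff_AE[of "\<lambda>x. ennreal (u x)" M] by simp
  then show ?thesis by eventually_elim (use assms(3) in \<open>auto simp: ennreal_eq_0_iff antisym\<close>)
qed

text \<open>
  The scalar part of the extrapolation argument.  \<open>F\<close> and \<open>G\<close> stand for \<open>|W f|\<close> and \<open>|W g|\<close>, and \<open>X\<close>
  for the norm of \<open>F\<close> in \<open>L^q\<close>, where \<open>q = r s\<close>; similarly \<open>Y\<close> for that of \<open>G\<close> in \<open>L^p\<close>.  The initial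
  exponents are all functions of \<open>s\<close> and of \<open>i0 = 1 / r0\<close>, a number in \<open>[0, 1]\<close> which covers the
  infinite exponents: \<open>1 / q0 = i0 / s\<close> and \<open>1 / p0 = 1 - (1 - i0) / s\<close>.
\<close>

locale extrapolation_majorants =
  fixes M :: "'a measure" and F G a b :: "'a \<Rightarrow> real" and X Y D r s p i0 :: real
  assumes meas [measurable]: "F \<in> borel_measurable M" "G \<in> borel_measurable M"
      "a \<in> borel_measurable M" "b \<in> borel_measurable M"
    and F0: "\<And>x. 0 \<le> F x" and G0: "\<And>x. 0 \<le> G x"
    and a0: "\<And>x. 0 < a x" and b0: "\<And>x. 0 < b x"
    and r1: "1 < r" and s1: "1 \<le> s" and p1: "1 < p" and p_def: "1 / p = 1 / (r * s) + 1 - 1 / s"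
    and i0: "0 \<le> i0" "i0 \<le> 1" and X0: "0 < X" and Y0: "0 \<le> Y" and D1: "1 \<le> D"
    and inta: "(\<integral>\<^sup>+x. ennreal (a x powr (r / (r - 1))) \<partial>M) \<le> ennreal D"
    and intb: "(\<integral>\<^sup>+x. ennreal (b x powr r) \<partial>M) \<le> ennreal D"
    and intF: "(\<integral>\<^sup>+x. ennreal (F x powr (r * s)) \<partial>M) = ennreal (X powr (r * s))"
    and Fb: "AE x in M. F x \<le> X * b x powr (1 / s)"
    and Fa: "AE x in M. F x powr (r * s - s) \<le> X powr (r * s - s) * a x"
    and Gb: "AE x in M. G x \<le> Y * b x powr (r / p)"
begin

definition \<omega> :: "'a \<Rightarrow> real" where
  "\<omega> x = (a x powr i0 * b x powr (- (1 - i0))) powr (1 / s)"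

lemma omega_measurable [measurable]: "\<omega> \<in> borel_measurable M"
  unfolding \<omega>_def by measurable

lemma omega_pos: "0 < \<omega> x"
  using a0[of x] b0[of x] by (simp add: \<omega>_def)

lemma omega_eq: "\<omega> x = a x powr (i0 / s) * b x powr (- (1 - i0) / s)"
  using a0[of x] b0[of x] by (simp add: \<omega>_def powr_mult powr_powr)

lemma omega_powr: "\<omega> x powr t = a x powr (t * i0 / s) * b x powr (- (t * (1 - i0) / s))"
proof -
  have "i0 / s * t = t * i0 / s" "- (1 - i0) / s * t = - (t * (1 - i0) / s)"
    by (simp_all add: algebra_simps minus_divide_left)
  then show ?thesis unfolding omega_eq powr_mult powr_powr by (simp only:)
qed

text \<open>
  Weighted geometric means of \<open>a^r'\<close> and \<open>b^r\<close> are integrable by the inequality between arithmetic and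
  geometric mean.
\<close>

lemma geo_mean_integral_le:
  assumes "0 \<le> t" "0 \<le> u" "t + u = 1"
  shows "(\<integral>\<^sup>+x. ennreal (a x powr (t * (r / (r - 1))) * b x powr (u * r)) \<partial>M) \<le> ennreal D"
proof -
  have "(\<integral>\<^sup>+x. ennreal (a x powr (t * (r / (r - 1))) * b x powr (u * r)) \<partial>M)
      \<le> (\<integral>\<^sup>+x. ennreal t * ennreal (a x powr (r / (r - 1))) + ennreal u * ennreal (b x powr r) \<partial>M)"
  proof (rule nn_integral_mono)
    fix x
    have "a x powr (t * (r / (r - 1))) * b x powr (u * r) = (a x powr (r / (r - 1))) powr t * (b x powr r) powr u"
      by (simp add: powr_powr mult.commute)
    also have "\<dots> \<le> t * (a x powr (r / (r - 1))) + u * (b x powr r)"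
      using assms a0[of x] b0[of x] by (intro Youngs_inequality_0) auto
    finally show "ennreal (a x powr (t * (r / (r - 1))) * b x powr (u * r)) \<le> ennreal t * ennreal (a x powr (r / (r - 1))) + ennreal u * ennreal (b x powr r)"
      using assms by (simp add: ennreal_leI flip: ennreal_mult ennreal_plus)
  qed
  also have "\<dots> = ennreal t * (\<integral>\<^sup>+x. ennreal (a x powr (r / (r - 1))) \<partial>M) + ennreal u * (\<integral>\<^sup>+x. ennreal (b x powr r) \<partial>M)"
    by (subst nn_integral_add) (auto intro!: arg_cong2[where f="(+)"] nn_integral_cmult)
  also have "\<dots> \<le> ennreal t * ennreal D + ennreal u * ennreal D"
    by (intro add_mono mult_left_mono inta intb) auto
  also have "\<dots> = ennreal D"
  proof -
    have "ennreal t * ennreal D + ennreal u * ennreal D = ennreal (t * D + u * D)"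
      using assms D1 by (simp add: ennreal_mult ennreal_plus)
    also have "t * D + u * D = D" using assms(3) by (metis distrib_right mult_1)
    finally show ?thesis .
  qed
  finally show ?thesis .
qed

lemma integral_ab: "(\<integral>\<^sup>+x. ennreal (a x * b x) \<partial>M) \<le> ennreal D"
proof -
  have "(r - 1) / r * (r / (r - 1)) = 1" "1 / r * r = 1" "(r - 1) / r + 1 / r = 1"
    using r1 by (auto simp: field_simps)
  moreover have "a x powr 1 * b x powr 1 = a x * b x" for x using a0[of x] b0[of x] by simp
  ultimately show ?thesis
    using geo_mean_integral_le[of "(r - 1) / r" "1 / r"] r1 by simp
qed

text \<open>
  The duality step: \<open>a\<close> dominates the normalized dual function \<open>F^(q-s)\<close> of \<open>F^s\<close>.
\<close>

lemma integral_Fs_a: "ennreal (X powr s) \<le> (\<integral>\<^sup>+x. ennreal (a x * F x powr s) \<partial>M)"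
proof -
  have "ennreal (X powr (r * s - s)) * ennreal (X powr s) = ennreal (X powr (r * s))"
    using X0 by (simp flip: ennreal_mult powr_add)
  also have "\<dots> = (\<integral>\<^sup>+x. ennreal (F x powr (r * s)) \<partial>M)" by (simp add: intF)
  also have "\<dots> \<le> (\<integral>\<^sup>+x. ennreal (X powr (r * s - s)) * ennreal (a x * F x powr s) \<partial>M)"
  proof (rule nn_integral_mono_AE)
    show "AE x in M. ennreal (F x powr (r * s)) \<le> ennreal (X powr (r * s - s)) * ennreal (a x * F x powr s)"
      using Fa
    proof eventually_elim
      case (elim x)
      have "F x powr (r * s) = F x powr (r * s - s) * F x powr s" by (simp flip: powr_add)
      also have "\<dots> \<le> X powr (r * s - s) * a x * F x powr s" by (intro mult_right_mono elim) auto
      finally show ?case using a0[of x] by (simp add: ennreal_leI mult.assoc flip: ennreal_mult)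
    qed
  qed
  also have "\<dots> = ennreal (X powr (r * s - s)) * (\<integral>\<^sup>+x. ennreal (a x * F x powr s) \<partial>M)"
    by (intro nn_integral_cmult) auto
  finally show ?thesis
    using X0 by (simp add: ennreal_mult_le_mult_iff)
qed

lemma lower_endpoint:
  assumes q0: "i0 = 0"
  shows "Lp_norm M \<infinity> (\<lambda>x. ennreal (\<omega> x * F x)) < top"
    "ennreal X \<le> ennreal D * Lp_norm M \<infinity> (\<lambda>x. ennreal (\<omega> x * F x))"
proof -
  define Z where "Z = Lp_norm M \<infinity> (\<lambda>x. ennreal (\<omega> x * F x))"
  have Z: "Z = esssup M (\<lambda>x. ennreal (\<omega> x * F x))" by (simp add: Z_def Lp_norm_def)
  have om: "\<omega> x = b x powr (- (1 / s))" for x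
  proof -
    have "\<omega> x = a x powr (i0 / s) * b x powr (- (1 - i0) / s)" by (rule omega_eq)
    also have "\<dots> = b x powr (- (1 / s))" unfolding q0 using a0[of x] by simp
    finally show ?thesis .
  qed
  have "Z \<le> ennreal X"
    unfolding Z
  proof (rule esssup_I)
    show "AE x in M. ennreal (\<omega> x * F x) \<le> ennreal X"
      using Fb
    proof eventually_elim
      case (elim x)
      have "\<omega> x * F x \<le> \<omega> x * (X * b x powr (1 / s))"
        using omega_pos[of x] by (intro mult_left_mono elim) auto
      also have "\<dots> = X" using b0[of x] by (simp add: om flip: powr_add)
      finally show ?case by (rule ennreal_leI)
    qed
  qed measurable
  then show fin: "Z < top" by (auto intro: le_less_trans)
  then obtain z where z: "Z = ennreal z" "0 \<le> z" by (cases Z) auto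
  have "AE x in M. ennreal (\<omega> x * F x) \<le> ennreal z"
    using esssup_AE[of "\<lambda>x. ennreal (\<omega> x * F x)" M] unfolding Z[symmetric] z(1) .
  then have "AE x in M. \<omega> x * F x \<le> z" using z by simp
  then have "(\<integral>\<^sup>+x. ennreal (a x * F x powr s) \<partial>M) \<le> (\<integral>\<^sup>+x. ennreal (z powr s) * ennreal (a x * b x) \<partial>M)"
  proof (intro nn_integral_mono_AE, eventually_elim)
    case (elim x)
    have "F x = b x powr (1 / s) * (\<omega> x * F x)" using b0[of x] by (simp add: om flip: powr_add mult.assoc)
    also have "\<dots> powr s = b x * (\<omega> x * F x) powr s"
      using b0[of x] s1 by (simp add: powr_mult powr_powr)
    also have "\<dots> \<le> b x * z powr s"
      using b0[of x] elim s1 omega_pos[of x] F0[of x] by (intro mult_left_mono powr_mono2) auto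
    finally have "a x * F x powr s \<le> z powr s * (a x * b x)"
      using mult_left_mono[of "F x powr s" "b x * z powr s" "a x"] a0[of x] by (simp add: mult_ac)
    then show ?case using a0[of x] b0[of x] by (simp add: ennreal_leI flip: ennreal_mult)
  qed
  also have "\<dots> = ennreal (z powr s) * (\<integral>\<^sup>+x. ennreal (a x * b x) \<partial>M)"
    by (intro nn_integral_cmult) auto
  also have "\<dots> \<le> ennreal (z powr s) * ennreal D" by (intro mult_left_mono integral_ab) auto
  also have "\<dots> = ennreal (z powr s * D)" using D1 by (simp add: ennreal_mult)
  finally have "ennreal (X powr s) \<le> ennreal (z powr s * D)" using integral_Fs_a by (rule order_trans[rotated])
  then have "X powr s \<le> z powr s * D" using D1 by (simp add: ennreal_le_iff)
  also have "\<dots> \<le> z powr s * D powr s"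
    using powr_mono[of 1 s D] D1 s1 by (intro mult_left_mono) auto
  also have "\<dots> = (z * D) powr s" by (simp add: powr_mult)
  finally have "X \<le> z * D"
    using powr_less_mono2[of s "z * D" X] s1 z D1 by (force simp: not_less)
  then show "ennreal X \<le> ennreal D * Z"
    using z D1 by (simp add: mult.commute ennreal_leI flip: ennreal_mult)
qed

text \<open>
  Finiteness holds because \<open>F\<close> is bounded by a multiple of \<open>b^(1/s)\<close>, which makes \<open>(\<omega> F)^q0\<close> at most
  a multiple of \<open>a b\<close>.  For the lower bound write \<open>a F^s = ((\<omega> F)^q0)^i0 (a b)^(1 - i0)\<close> and apply
  Hoelder's inequality.
\<close>

lemma lower_interior:
  assumes q0: "0 < i0"
  shows "Lp_norm M (ereal (s / i0)) (\<lambda>x. ennreal (\<omega> x * F x)) < top"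
    "ennreal X \<le> ennreal D * Lp_norm M (ereal (s / i0)) (\<lambda>x. ennreal (\<omega> x * F x))"
proof -
  define I where "I = (\<integral>\<^sup>+x. ennreal ((\<omega> x * F x) powr (s / i0)) \<partial>M)"
  have norm: "Lp_norm M (ereal (s / i0)) (\<lambda>x. ennreal (\<omega> x * F x)) = epowr I (i0 / s)"
    using omega_pos F0 by (simp add: Lp_norm_def I_def epowr_ennreal less_imp_le)
  have om: "(\<omega> x * F x) powr (s / i0) = a x * b x powr (- ((1 - i0) / i0)) * F x powr (s / i0)" for x
    using q0 s1 a0[of x] by (simp add: powr_mult omega_powr)
  have "I \<le> (\<integral>\<^sup>+x. ennreal (X powr (s / i0)) * ennreal (a x * b x) \<partial>M)"
    unfolding I_def
  proof (rule nn_integral_mono_AE)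
    show "AE x in M. ennreal ((\<omega> x * F x) powr (s / i0)) \<le> ennreal (X powr (s / i0)) * ennreal (a x * b x)"
      using Fb
    proof eventually_elim
      case (elim x)
      have "F x powr (s / i0) \<le> (X * b x powr (1 / s)) powr (s / i0)"
        using elim F0[of x] q0 s1 by (intro powr_mono2) auto
      also have "\<dots> = X powr (s / i0) * b x powr (1 / i0)"
        using s1 by (simp add: powr_mult powr_powr)
      finally have "(\<omega> x * F x) powr (s / i0) \<le> a x * b x powr (- ((1 - i0) / i0)) * (X powr (s / i0) * b x powr (1 / i0))"
        unfolding om using a0[of x] by (intro mult_left_mono) auto
      also have "\<dots> = X powr (s / i0) * (a x * (b x powr (- ((1 - i0) / i0)) * b x powr (1 / i0)))" by (simp add: mult_ac)
      also have "b x powr (- ((1 - i0) / i0)) * b x powr (1 / i0) = b x"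
      proof -
        have "- ((1 - i0) / i0) + 1 / i0 = 1" using q0 by (simp add: field_simps)
        then show ?thesis using b0[of x] by (simp flip: powr_add)
      qed
      finally show ?case using a0[of x] b0[of x] by (simp add: ennreal_leI flip: ennreal_mult)
    qed
  qed
  also have "\<dots> = ennreal (X powr (s / i0)) * (\<integral>\<^sup>+x. ennreal (a x * b x) \<partial>M)"
    by (intro nn_integral_cmult) auto
  also have "\<dots> \<le> ennreal (X powr (s / i0)) * ennreal D" by (intro mult_left_mono integral_ab) auto
  also have "\<dots> < top" by (simp add: ennreal_mult_less_top)
  finally have fin: "I < top" .
  then show "Lp_norm M (ereal (s / i0)) (\<lambda>x. ennreal (\<omega> x * F x)) < top"
    unfolding norm using less_top by fastforce
  obtain z where z: "I = ennreal z" "0 \<le> z" using fin by (cases I) auto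
  have abfin: "(\<integral>\<^sup>+x. ennreal (a x * b x) \<partial>M) < top" using integral_ab by (auto intro: le_less_trans)
  have "(\<integral>\<^sup>+x. ennreal (a x * F x powr s) \<partial>M) \<le> epowr I i0 * ennreal D"
  proof (cases "i0 = 1")
    case True
    then have "I = (\<integral>\<^sup>+x. ennreal (a x * F x powr s) \<partial>M)"
      unfolding I_def om using b0 by (simp add: less_imp_neq[symmetric])
    then show ?thesis using True D1 mult_left_mono[of 1 "ennreal D" I] by simp
  next
    case False
    then have i1: "i0 < 1" using i0 by simp
    have "(\<integral>\<^sup>+x. ennreal (a x * F x powr s) \<partial>M)
      = (\<integral>\<^sup>+x. ennreal (((\<omega> x * F x) powr (s / i0)) powr i0 * (a x * b x) powr (1 - i0)) \<partial>M)"
    proof (rule nn_integral_cong)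
      fix x
      have "((\<omega> x * F x) powr (s / i0)) powr i0 = a x powr i0 * b x powr (- (1 - i0)) * F x powr s"
        using q0 s1 a0[of x] by (simp add: powr_powr powr_mult omega_powr)
      then have "((\<omega> x * F x) powr (s / i0)) powr i0 * (a x * b x) powr (1 - i0)
        = (a x powr i0 * a x powr (1 - i0)) * (b x powr (- (1 - i0)) * b x powr (1 - i0)) * F x powr s"
        by (simp add: powr_mult mult_ac)
      also have "\<dots> = a x * F x powr s"
        using a0[of x] b0[of x] by (simp flip: powr_add)
      finally show "ennreal (a x * F x powr s) = ennreal (((\<omega> x * F x) powr (s / i0)) powr i0 * (a x * b x) powr (1 - i0))"
        by simp
    qed
    also have "\<dots> \<le> epowr I i0 * epowr (\<integral>\<^sup>+x. ennreal (a x * b x) \<partial>M) (1 - i0)"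
      unfolding I_def
      by (rule nn_integral_Holder) (use q0 i1 a0 b0 abfin fin in \<open>auto simp: I_def less_imp_le\<close>)
    also have "\<dots> \<le> epowr I i0 * epowr (ennreal D) (1 - i0)"
      using i1 by (intro mult_left_mono epowr_mono integral_ab) auto
    also have "epowr (ennreal D) (1 - i0) \<le> ennreal D"
      using D1 i1 q0 powr_mono[of "1 - i0" 1 D] by (simp add: epowr_ennreal ennreal_leI)
    finally show ?thesis by (simp add: mult_left_mono)
  qed
  with integral_Fs_a have "ennreal (X powr s) \<le> ennreal (z powr i0) * ennreal D"
    using z by (simp add: epowr_ennreal)
  then have "X powr s \<le> z powr i0 * D"
    using D1 by (simp add: ennreal_le_iff flip: ennreal_mult)
  also have "\<dots> \<le> z powr i0 * D powr s"
    using powr_mono[of 1 s D] D1 s1 by (intro mult_left_mono) auto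
  also have "\<dots> = (z powr (i0 / s) * D) powr s" using s1 by (simp add: powr_mult powr_powr)
  finally have "X \<le> z powr (i0 / s) * D"
    using powr_less_mono2[of s "z powr (i0 / s) * D" X] s1 z D1 by (force simp: not_less)
  then show "ennreal X \<le> ennreal D * Lp_norm M (ereal (s / i0)) (\<lambda>x. ennreal (\<omega> x * F x))"
    unfolding norm using z D1 by (simp add: epowr_ennreal mult.commute ennreal_leI flip: ennreal_mult)
qed

lemma upper_endpoint:
  assumes "i0 = 0" "s = 1"
  shows "Lp_norm M \<infinity> (\<lambda>x. ennreal (\<omega> x * G x)) \<le> ennreal D * ennreal Y"
proof -
  have "p = r" using p_def assms r1 p1 by (simp add: field_simps)
  have om: "\<omega> x = b x powr (- 1)" for x
  proof -
    have "\<omega> x = a x powr (i0 / s) * b x powr (- (1 - i0) / s)" by (rule omega_eq)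
    also have "\<dots> = b x powr (- 1)" unfolding assms using a0[of x] by simp
    finally show ?thesis .
  qed
  have "Lp_norm M \<infinity> (\<lambda>x. ennreal (\<omega> x * G x)) \<le> ennreal Y"
    unfolding Lp_norm_def if_P[OF refl]
  proof (rule esssup_I)
    show "AE x in M. ennreal (\<omega> x * G x) \<le> ennreal Y"
      using Gb
    proof eventually_elim
      case (elim x)
      have "\<omega> x * G x \<le> \<omega> x * (Y * b x powr (r / p))"
        using omega_pos[of x] by (intro mult_left_mono elim) auto
      also have "\<dots> = Y" using b0[of x] r1 \<open>p = r\<close> by (simp add: om powr_minus)
      finally show ?case by (rule ennreal_leI)
    qed
  qed measurable
  also have "\<dots> \<le> ennreal D * ennreal Y" using D1 Y0 mult_right_mono[of 1 D Y]
    by (simp add: ennreal_leI flip: ennreal_mult)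
  finally show ?thesis .
qed

text \<open>
  As \<open>G\<close> is bounded by a multiple of \<open>b^(r/p)\<close>, the function \<open>(\<omega> G)^p0\<close> is at most a multiple of
  \<open>a^\<theta> b^\<phi>\<close>, and the relations between the exponents say exactly that \<open>\<theta> / r' + \<phi> / r = 1\<close>.
\<close>

lemma upper_interior:
  assumes p0: "0 < p0" and p0_def: "1 / p0 = 1 - (1 - i0) / s"
  shows "Lp_norm M (ereal p0) (\<lambda>x. ennreal (\<omega> x * G x)) \<le> ennreal D * ennreal Y"
proof -
  (* These are the exponents of a and b in (omega G)^p0. *)
  define \<theta> \<phi> where "\<theta> = p0 * i0 / s" and "\<phi> = p0 * (r / p - (1 - i0) / s)"
  have rp: "1 / s \<le> r / p"
  proof -
    have "r / p = r * (1 / p)" by simp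
    also have "\<dots> = 1 / s + r - r / s" unfolding p_def using r1 by (simp add: algebra_simps)
    finally have "r / p = 1 / s + r - r / s" .
    moreover have "r / s \<le> r" using s1 r1 by (simp add: divide_le_eq)
    ultimately show ?thesis by linarith
  qed
  have "(1 - i0) / s \<le> 1 / s" using i0 s1 by (intro divide_right_mono) auto
  with rp have \<phi>0: "0 \<le> \<phi>" using p0 by (simp add: \<phi>_def)
  have \<theta>0: "0 \<le> \<theta>" using p0 i0 s1 by (simp add: \<theta>_def)
  have sum1: "\<theta> * (r - 1) / r + \<phi> / r = 1"
  proof -
    have "\<theta> * (r - 1) / r + \<phi> / r = p0 * (i0 / s * (1 - 1 / r) + 1 / p - (1 - i0) / s * (1 / r))"
    proof -
      have "\<theta> * (r - 1) / r = p0 * (i0 / s * (1 - 1 / r))"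
        using r1 by (simp add: \<theta>_def field_simps)
      moreover have "\<phi> / r = p0 * (1 / p - (1 - i0) / s * (1 / r))"
      proof -
        have "\<phi> / r = p0 * ((r / p - (1 - i0) / s) / r)" by (simp add: \<phi>_def)
        also have "(r / p - (1 - i0) / s) / r = 1 / p - (1 - i0) / s * (1 / r)"
          unfolding diff_divide_distrib[of "r / p"] using r1 by simp
        finally show ?thesis .
      qed
      ultimately show ?thesis by (simp add: algebra_simps)
    qed
    also have "i0 / s * (1 - 1 / r) + 1 / p - (1 - i0) / s * (1 / r) = 1 - (1 - i0) / s"
      unfolding p_def using r1 s1 by (simp add: divide_inverse algebra_simps)
    also have "\<dots> = 1 / p0" by (simp add: p0_def)
    finally show ?thesis using p0 by simp
  qed
  have "(\<integral>\<^sup>+x. ennreal ((\<omega> x * G x) powr p0) \<partial>M) \<le> (\<integral>\<^sup>+x. ennreal (Y powr p0) * ennreal (a x powr \<theta> * b x powr \<phi>) \<partial>M)"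
  proof (rule nn_integral_mono_AE)
    show "AE x in M. ennreal ((\<omega> x * G x) powr p0) \<le> ennreal (Y powr p0) * ennreal (a x powr \<theta> * b x powr \<phi>)"
      using Gb
    proof eventually_elim
      case (elim x)
      have "G x powr p0 \<le> (Y * b x powr (r / p)) powr p0"
        using elim G0[of x] p0 by (intro powr_mono2) auto
      also have "\<dots> = Y powr p0 * b x powr (p0 * (r / p))" by (simp add: powr_mult powr_powr mult.commute)
      finally have "(\<omega> x * G x) powr p0 \<le> \<omega> x powr p0 * (Y powr p0 * b x powr (p0 * (r / p)))"
        unfolding powr_mult by (intro mult_left_mono) auto
      also have "\<dots> = Y powr p0 * (a x powr \<theta> * (b x powr (- (p0 * (1 - i0) / s)) * b x powr (p0 * (r / p))))"
        by (simp add: omega_powr \<theta>_def mult_ac)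
      also have "b x powr (- (p0 * (1 - i0) / s)) * b x powr (p0 * (r / p)) = b x powr \<phi>"
        by (simp add: \<phi>_def algebra_simps flip: powr_add)
      finally show ?case by (simp add: ennreal_leI flip: ennreal_mult)
    qed
  qed
  also have "\<dots> = ennreal (Y powr p0) * (\<integral>\<^sup>+x. ennreal (a x powr \<theta> * b x powr \<phi>) \<partial>M)"
    by (intro nn_integral_cmult) auto
  also have "(\<integral>\<^sup>+x. ennreal (a x powr \<theta> * b x powr \<phi>) \<partial>M) \<le> ennreal D"
    using geo_mean_integral_le[of "\<theta> * (r - 1) / r" "\<phi> / r"] \<theta>0 \<phi>0 sum1 r1 by simp
  finally have "(\<integral>\<^sup>+x. ennreal ((\<omega> x * G x) powr p0) \<partial>M) \<le> ennreal (Y powr p0 * D)"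
    using D1 by (simp add: mult_left_mono ennreal_mult)
  then have "epowr (\<integral>\<^sup>+x. ennreal ((\<omega> x * G x) powr p0) \<partial>M) (1 / p0) \<le> epowr (ennreal (Y powr p0 * D)) (1 / p0)"
    using p0 by (intro epowr_mono) auto
  also have "\<dots> = ennreal (Y * D powr (1 / p0))"
    using D1 p0 Y0 by (simp add: epowr_ennreal powr_mult powr_powr)
  also have "\<dots> \<le> ennreal (Y * D)"
  proof -
    have "1 / p0 \<le> 1" using p0_def i0 s1 by simp
    then have "D powr (1 / p0) \<le> D" using powr_mono[of "1 / p0" 1 D] D1 by simp
    then show ?thesis using Y0 by (intro ennreal_leI mult_left_mono) auto
  qed
  finally show ?thesis
    using omega_pos G0 p0 Y0 D1
    by (simp add: Lp_norm_def epowr_ennreal less_imp_le mult.commute flip: ennreal_mult)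
qed

end

section \<open>Averages and reducing bases\<close>

lemma avg_mono_AE:
  assumes "AE x in M. x \<in> B \<longrightarrow> h x \<le> g x"
  shows "avg M B h \<le> avg M B g"
  unfolding avg_def
proof (intro divide_right_mono_ennreal nn_integral_mono_AE)
  show "AE x in M. h x * indicator B x \<le> g x * indicator B x"
    using assms by eventually_elim (auto simp: indicator_def)
qed

lemma avg_cong_AE:
  assumes "AE x in M. x \<in> B \<longrightarrow> h x = g x"
  shows "avg M B h = avg M B g"
  using assms by (intro antisym avg_mono_AE) (auto elim: eventually_mono)

lemma avg_cmult_le:
  assumes "c < top"
  shows "avg M B (\<lambda>x. c * h x) \<le> c * avg M B h"
proof -
  have "avg M B (\<lambda>x. c * h x) \<le> (c * (\<integral>\<^sup>+x\<in>B. h x \<partial>M)) / emeasure M B"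
    unfolding avg_def using nn_integral_cmult_le[OF assms, of M "\<lambda>x. h x * indicator B x"]
    by (intro divide_right_mono_ennreal) (simp add: mult.assoc)
  then show ?thesis by (simp add: avg_def ennreal_times_divide)
qed

lemma avg_cmult:
  assumes [measurable]: "B \<in> sets M" "h \<in> borel_measurable M"
  shows "avg M B (\<lambda>x. c * h x) = c * avg M B h"
proof -
  have "(\<integral>\<^sup>+x\<in>B. c * h x \<partial>M) = c * (\<integral>\<^sup>+x\<in>B. h x \<partial>M)"
    by (simp add: mult.assoc nn_integral_cmult)
  then show ?thesis by (simp add: avg_def ennreal_times_divide)
qed

lemma avg_suminf:
  assumes [measurable]: "B \<in> sets M" "\<And>i. h i \<in> borel_measurable M"
  shows "avg M B (\<lambda>x. \<Sum>i. h i x) = (\<Sum>i. avg M B (h i))"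
proof -
  have "(\<integral>\<^sup>+x\<in>B. (\<Sum>i. h i x) \<partial>M) = (\<Sum>i. \<integral>\<^sup>+x\<in>B. h i x \<partial>M)"
    by (subst nn_integral_suminf[symmetric]) (auto simp: mult.commute[of _ "indicator B _"])
  then show ?thesis
    by (simp add: avg_def divide_ennreal_def mult.commute[of _ "inverse _"])
qed

lemma avg_sum:
  fixes h :: "nat \<Rightarrow> 'a \<Rightarrow> ennreal"
  assumes [measurable]: "B \<in> sets M" "\<And>i. i < d \<Longrightarrow> h i \<in> borel_measurable M"
  shows "avg M B (\<lambda>x. \<Sum>i<d. h i x) = (\<Sum>i<d. avg M B (h i))"
proof -
  have "(\<integral>\<^sup>+x\<in>B. (\<Sum>i<d. h i x) \<partial>M) = (\<Sum>i<d. \<integral>\<^sup>+x\<in>B. h i x \<partial>M)"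
    by (subst nn_integral_sum[symmetric]) (auto simp: sum_distrib_right)
  then show ?thesis
    by (simp add: avg_def divide_ennreal_def sum_distrib_right)
qed

text \<open>
  In the extended half-line \<open>0 / 0 = 0\<close>.
\<close>

lemma avg_null:
  assumes "B \<in> null_sets M"
  shows "avg M B h = 0"
proof -
  have "AE x in M. h x * indicator B x = 0"
    using AE_not_in[OF assms] by eventually_elim simp
  then have "(\<integral>\<^sup>+x\<in>B. h x \<partial>M) = (\<integral>\<^sup>+x. 0 \<partial>M)" by (rule nn_integral_cong_AE)
  then show ?thesis by (simp add: avg_def)
qed

lemma avg_const:
  assumes "B \<in> sets M" "0 < emeasure M B" "emeasure M B < top"
  shows "avg M B (\<lambda>x. c) = c"
proof -
  have "(\<integral>\<^sup>+x\<in>B. c \<partial>M) = c * emeasure M B" using assms by (simp add: nn_integral_cmult_indicator)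
  then show ?thesis using assms
    by (simp add: avg_def) (metis ennreal_divide_self ennreal_times_divide less_irrefl mult.right_neutral top.not_eq_extremum)
qed

lemma avg_pos:
  assumes [measurable]: "B \<in> sets M" "h \<in> borel_measurable M"
    and B: "0 < emeasure M B" "emeasure M B < top" and pos: "AE x in M. x \<in> B \<longrightarrow> 0 < h x"
  shows "0 < avg M B h"
proof -
  have "(\<integral>\<^sup>+x\<in>B. h x \<partial>M) \<noteq> 0"
  proof
    assume "(\<integral>\<^sup>+x\<in>B. h x \<partial>M) = 0"
    then have "AE x in M. h x * indicator B x = 0" by (subst (asm) nn_integral_0_iff_AE) auto
    with pos have "AE x in M. x \<notin> B" by eventually_elim (auto simp: indicator_def split: if_splits)
    then have "B \<in> null_sets M" using AE_iff_null_sets[of B M] by simp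
    with B show False by auto
  qed
  then show ?thesis using B by (simp add: avg_def ennreal_zero_less_divide zero_less_iff_neq_zero)
qed

text \<open>
  Otherwise \<open>h\<close> would be infinite almost everywhere on \<open>B\<close>.  The integral is monotone on nonmeasurable
  functions too, so that the average would be infinite.
\<close>

lemma avg_finite_witness:
  assumes B: "B \<in> sets M" "0 < emeasure M B" "emeasure M B < top"
    and fin: "avg M B h < top" and ae: "AE x in M. P x"
  obtains x where "x \<in> B" "P x" "h x < top"
proof -
  have "\<exists>x. x \<in> B \<and> P x \<and> h x < top"
  proof (rule ccontr)
    assume no: "\<not> ?thesis"
    from ae have "AE x in M. x \<in> B \<longrightarrow> top \<le> h x"
      by eventually_elim (use no in \<open>auto simp: not_less\<close>)
    then have "avg M B (\<lambda>x. top) \<le> avg M B h" by (rule avg_mono_AE)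
    with fin B show False by (simp add: avg_const)
  qed
  with that show ?thesis by blast
qed

text \<open>
  The quantity \<open>(avg_B |A v|^p)^(1/p)\<close> as a norm of the vector \<open>v\<close>; \<open>N v\<close> is its \<open>p\<close>-th power.  It is
  used for \<open>A = V^-1\<close> and \<open>p = r'\<close>, and for \<open>A = a V\<close> and \<open>p = 1\<close>.
\<close>

locale average_norm =
  fixes M :: "'a measure" and B :: "'a set" and d :: nat and A :: "'a \<Rightarrow> real mat" and p :: real
  assumes B: "B \<in> sets M" "0 < emeasure M B" "emeasure M B < top"
    and d: "0 < d"
    and A_carrier: "\<And>x. x \<in> space M \<Longrightarrow> A x \<in> carrier_mat d d"
    and A_meas: "\<And>i j. i < d \<Longrightarrow> j < d \<Longrightarrow> (\<lambda>x. A x $$ (i, j)) \<in> borel_measurable M"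
    and A_inv: "AE x in M. invertible_mat (A x)"
    and p: "0 < p"
    and finite_avg: "\<And>v. v \<in> carrier_vec d \<Longrightarrow> avg M B (\<lambda>x. epowr (ennreal (vnorm (A x *\<^sub>v v))) p) < top"
begin

definition N :: "real vec \<Rightarrow> ennreal" where
  "N v = avg M B (\<lambda>x. epowr (ennreal (vnorm (A x *\<^sub>v v))) p)"

lemma vnorm_measurable:
  assumes "v \<in> carrier_vec d"
  shows "(\<lambda>x. vnorm (A x *\<^sub>v v)) \<in> borel_measurable M"
  using assms by (intro borel_measurable_vnorm_mult[OF A_carrier A_meas])

lemma N_smult:
  assumes v: "v \<in> carrier_vec d"
  shows "N (c \<cdot>\<^sub>v v) = ennreal (\<bar>c\<bar> powr p) * N v"
proof -
  have [measurable]: "(\<lambda>x. vnorm (A x *\<^sub>v v)) \<in> borel_measurable M" by (rule vnorm_measurable[OF v])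
  have "N (c \<cdot>\<^sub>v v) = avg M B (\<lambda>x. ennreal (\<bar>c\<bar> powr p) * epowr (ennreal (vnorm (A x *\<^sub>v v))) p)"
    unfolding N_def
  proof (rule avg_cong_AE, rule AE_I2, rule impI)
    fix x assume "x \<in> space M"
    then show "epowr (ennreal (vnorm (A x *\<^sub>v (c \<cdot>\<^sub>v v)))) p = ennreal (\<bar>c\<bar> powr p) * epowr (ennreal (vnorm (A x *\<^sub>v v))) p"
      using mult_mat_vec[OF A_carrier v, of x c]
      by (simp add: vnorm_smult ennreal_mult epowr_mult epowr_ennreal)
  qed
  also have "\<dots> = ennreal (\<bar>c\<bar> powr p) * N v"
    unfolding N_def using B by (intro avg_cmult) auto
  finally show ?thesis .
qed

text \<open>
  Pointwise \<open>|v| \<le> m |A v|\<close>, where \<open>m\<close> is finite almost everywhere because \<open>A\<close> is invertible there.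
\<close>

lemma N_lower_bound:
  obtains k where "0 < k" "\<And>v. v \<in> carrier_vec d \<Longrightarrow> ennreal (k * vnorm v powr p) \<le> N v"
proof -
  (* Adding 1 keeps m away from zero, so that 1 / m is defined and bounded. *)
  define m where "m = (\<lambda>x. 1 + (\<Sum>i<d. vnorm (minv (A x) *\<^sub>v unit_vec d i)))"
  have m1: "1 \<le> m x" for x by (auto simp: m_def intro: sum_nonneg)
  have minv_meas: "(\<lambda>x. minv (A x) $$ (i, j)) \<in> borel_measurable M" if "i < d" "j < d" for i j
    using that by (intro borel_measurable_minv[OF A_carrier A_meas]) auto
  have [measurable]: "m \<in> borel_measurable M"
    unfolding m_def
    by (intro borel_measurable_add borel_measurable_const borel_measurable_sum
        borel_measurable_vnorm_mult[OF minv_carrier[OF A_carrier] minv_meas]) auto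
  define \<kappa> where "\<kappa> = avg M B (\<lambda>x. ennreal ((1 / m x) powr p))"
  have "0 < \<kappa>"
    unfolding \<kappa>_def using m1 B
  proof (intro avg_pos)
    show "AE x in M. x \<in> B \<longrightarrow> 0 < ennreal ((1 / m x) powr p)"
    proof (intro AE_I2 impI)
      fix x
      have "0 < m x" using m1[of x] by linarith
      then show "0 < ennreal ((1 / m x) powr p)" by simp
    qed
  qed auto
  moreover have "\<kappa> \<le> 1"
  proof -
    have "(1 / m x) powr p \<le> 1" for x
      using powr_mono2[of p "1 / m x" 1] m1[of x] p by simp
    then have "\<kappa> \<le> avg M B (\<lambda>x. 1)" unfolding \<kappa>_def by (intro avg_mono_AE) auto
    then show ?thesis using B by (simp add: avg_const)
  qed
  ultimately obtain k where k: "\<kappa> = ennreal k" "0 < k" by (cases \<kappa>) (auto simp: top_unique)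
  show ?thesis
  proof (rule that[OF k(2)])
    fix v :: "real vec" assume v: "v \<in> carrier_vec d"
    have "ennreal (k * vnorm v powr p) = ennreal (vnorm v powr p) * \<kappa>"
      using k by (simp add: ennreal_mult mult.commute)
    also have "\<dots> = avg M B (\<lambda>x. ennreal (vnorm v powr p) * ennreal ((1 / m x) powr p))"
      unfolding \<kappa>_def using B by (intro avg_cmult[symmetric]) auto
    also have "\<dots> \<le> N v"
      unfolding N_def
    proof (rule avg_mono_AE)
      show "AE x in M. x \<in> B \<longrightarrow> ennreal (vnorm v powr p) * ennreal ((1 / m x) powr p) \<le> epowr (ennreal (vnorm (A x *\<^sub>v v))) p"
        using A_inv AE_space
      proof eventually_elim
        case (elim x)
        note Ax = A_carrier[OF elim(2)]
        have Av: "A x *\<^sub>v v \<in> carrier_vec d" using Ax v by auto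
        have "v = minv (A x) *\<^sub>v (A x *\<^sub>v v)"
          using minv_left[OF Ax elim(1)] Ax v minv_carrier[OF Ax] by (simp flip: assoc_mult_mat_vec[of _ d d _ d])
        then have "vnorm v \<le> (\<Sum>i<d. vnorm (minv (A x) *\<^sub>v unit_vec d i)) * vnorm (A x *\<^sub>v v)"
          using vnorm_mult_mat_vec_le_sum_columns[OF minv_carrier[OF Ax] Av] by simp
        also have "\<dots> \<le> m x * vnorm (A x *\<^sub>v v)" unfolding m_def by (intro mult_right_mono) auto
        finally have "vnorm v / m x \<le> vnorm (A x *\<^sub>v v)" using m1[of x] by (simp add: field_simps)
        then have "(vnorm v / m x) powr p \<le> vnorm (A x *\<^sub>v v) powr p"
          using p m1[of x] by (intro powr_mono2) auto
        then show ?case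
          using powr_mult[of "vnorm v" "1 / m x" p] by (simp add: epowr_ennreal ennreal_leI flip: ennreal_mult)
      qed
    qed
    finally show "ennreal (k * vnorm v powr p) \<le> N v" .
  qed
qed

text \<open>
  The unit ball of \<open>N\<close> is bounded and contains multiples of the unit vectors, so that
  \<open>near_auerbach_basis\<close> applies to it.  This replaces reducing matrices, which would require John
  ellipsoids.
\<close>

lemma reducing_basis:
  obtains u :: "nat \<Rightarrow> real vec"
  where "\<And>i. i < d \<Longrightarrow> u i \<in> carrier_vec d" "\<And>i. i < d \<Longrightarrow> N (u i) \<le> 1"
    "\<And>C v. C \<in> carrier_mat d d \<Longrightarrow> v \<in> carrier_vec d \<Longrightarrow>
      ennreal (vnorm (C *\<^sub>v v)) \<le> 2 * epowr (N v) (1 / p) * ennreal (\<Sum>i<d. vnorm (C *\<^sub>v u i))"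
proof -
  obtain k where k: "0 < k" "\<And>v. v \<in> carrier_vec d \<Longrightarrow> ennreal (k * vnorm v powr p) \<le> N v"
    using N_lower_bound by blast
  define S where "S = {v \<in> carrier_vec d. N v \<le> 1}"
  have bdd: "vnorm v \<le> (1 / k) powr (1 / p)" if "v \<in> S" for v
  proof -
    have v: "v \<in> carrier_vec d" "N v \<le> 1" using that by (auto simp: S_def)
    have "ennreal (k * vnorm v powr p) \<le> 1" by (rule order_trans[OF k(2)[OF v(1)] v(2)])
    then have "vnorm v powr p \<le> 1 / k" using k(1) by (simp add: field_simps)
    then have "(vnorm v powr p) powr (1 / p) \<le> (1 / k) powr (1 / p)"
      using p by (intro powr_mono2) auto
    then show ?thesis using p by (simp add: powr_powr)
  qed
  (* Scaling by c moves all unit vectors into the unit ball of N at once. *)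
  define c where "c = (1 + (\<Sum>i<d. enn2real (N (unit_vec d i)))) powr (- (1 / p))"
  have sum0: "0 \<le> (\<Sum>i<d. enn2real (N (unit_vec d i)))" by (intro sum_nonneg) auto
  then have c: "0 < c" unfolding c_def by simp
  have cS: "c \<cdot>\<^sub>v unit_vec d i \<in> S" if i: "i < d" for i
  proof -
    have cp: "c powr p = inverse (1 + (\<Sum>i<d. enn2real (N (unit_vec d i))))"
      using sum0 p unfolding c_def powr_powr by (simp add: powr_minus)
    have "N (unit_vec d i) = ennreal (enn2real (N (unit_vec d i)))"
      using finite_avg[of "unit_vec d i"] by (simp add: N_def)
    moreover have "enn2real (N (unit_vec d i)) \<le> (\<Sum>i<d. enn2real (N (unit_vec d i)))"
      using i by (intro member_le_sum) auto
    ultimately have "N (c \<cdot>\<^sub>v unit_vec d i) \<le> ennreal (c powr p) * ennreal (1 + (\<Sum>i<d. enn2real (N (unit_vec d i))))"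
      using c by (simp add: N_smult) (metis add.commute add_increasing2 ennreal_leI mult_left_mono zero_le zero_le_one)
    also have "\<dots> = 1"
    proof -
      have "1 + (\<Sum>i<d. enn2real (N (unit_vec d i))) \<noteq> 0" using sum0 by linarith
      then show ?thesis
        unfolding cp using sum0 by (subst ennreal_mult[symmetric]) auto
    qed
    finally show ?thesis by (simp add: S_def)
  qed
  obtain U where U: "U \<in> carrier_mat d d" "\<And>i. i < d \<Longrightarrow> col U i \<in> S"
    "\<And>v. v \<in> S \<Longrightarrow> \<exists>t\<in>carrier_vec d. v = U *\<^sub>v t \<and> (\<forall>i<d. \<bar>t $ i\<bar> \<le> 2)"
  proof (rule near_auerbach_basis[of S d "(1 / k) powr (1 / p)" "c \<cdot>\<^sub>m 1\<^sub>m d"])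
    show "col (c \<cdot>\<^sub>m 1\<^sub>m d) i \<in> S" if "i < d" for i
      using cS[OF that] that by (simp add: col_smult)
  qed (use c bdd in \<open>auto simp: S_def\<close>)
  show ?thesis
  proof (rule that[of "col U"])
    fix i assume "i < d"
    with U(2)[of i] show "col U i \<in> carrier_vec d" "N (col U i) \<le> 1" by (auto simp: S_def)
  next
    fix C :: "real mat" and v :: "real vec"
    assume C: "C \<in> carrier_mat d d" and v: "v \<in> carrier_vec d"
    show "ennreal (vnorm (C *\<^sub>v v)) \<le> 2 * epowr (N v) (1 / p) * ennreal (\<Sum>i<d. vnorm (C *\<^sub>v col U i))"
    proof (cases "vnorm v = 0")
      case True
      then have "v = 0\<^sub>v d" using v vnorm_eq_0 by blast
      then have "C *\<^sub>v v = 0\<^sub>v d" using C by auto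
      then show ?thesis by simp
    next
      case False
      then have "0 < vnorm v" using vnorm_nonneg[of v] by linarith
      then have "0 < ennreal (k * vnorm v powr p)" using k by simp
      then have "0 < N v" using k(2)[OF v] by (rule less_le_trans)
      moreover have "N v < top" using finite_avg[OF v] by (simp add: N_def)
      ultimately obtain n where n: "N v = ennreal n" "0 < n" by (cases "N v") auto
      define t where "t = n powr (1 / p)"
      have t: "0 < t" using n by (simp add: t_def)
      have tp: "(1 / t) powr p = 1 / n" using n p by (simp add: t_def powr_divide powr_powr)
      have "N ((1 / t) \<cdot>\<^sub>v v) = 1"
        using v t n by (simp add: N_smult tp flip: ennreal_mult)
      then have "(1 / t) \<cdot>\<^sub>v v \<in> S" using v by (simp add: S_def)
      from U(3)[OF this] obtain \<tau> where \<tau>: "\<tau> \<in> carrier_vec d" "(1 / t) \<cdot>\<^sub>v v = U *\<^sub>v \<tau>" "\<forall>i<d. \<bar>\<tau> $ i\<bar> \<le> 2"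
        by blast
      have CU: "C * U \<in> carrier_mat d d" using C U by auto
      have Ui: "(C * U) *\<^sub>v unit_vec d i = C *\<^sub>v col U i" if "i < d" for i
        using C U that by (simp add: assoc_mult_mat_vec[of _ d d _ d] mult_unit_vec_eq_col[of _ d])
      have "(1 / t) * vnorm (C *\<^sub>v v) = vnorm (C *\<^sub>v ((1 / t) \<cdot>\<^sub>v v))"
        using t C v by (simp add: mult_mat_vec vnorm_smult)
      also have "\<dots> = vnorm ((C * U) *\<^sub>v \<tau>)"
        unfolding \<tau>(2) using C U \<tau> by (simp add: assoc_mult_mat_vec[of _ d d _ d])
      also have "\<dots> \<le> (\<Sum>i<d. \<bar>\<tau> $ i\<bar> * vnorm ((C * U) *\<^sub>v unit_vec d i))"
        by (rule vnorm_mult_mat_vec_le_columns[OF CU \<tau>(1)])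
      also have "\<dots> \<le> (\<Sum>i<d. 2 * vnorm (C *\<^sub>v col U i))"
        using \<tau>(3) Ui by (intro sum_mono mult_mono) auto
      finally have "vnorm (C *\<^sub>v v) \<le> 2 * t * (\<Sum>i<d. vnorm (C *\<^sub>v col U i))"
        using t by (simp add: field_simps sum_distrib_left)
      then have "ennreal (vnorm (C *\<^sub>v v)) \<le> ennreal (2 * t * (\<Sum>i<d. vnorm (C *\<^sub>v col U i)))"
        by (rule ennreal_leI)
      also have "\<dots> = 2 * epowr (N v) (1 / p) * ennreal (\<Sum>i<d. vnorm (C *\<^sub>v col U i))"
        using n t by (simp add: ennreal_mult sum_nonneg epowr_ennreal t_def)
      finally show ?thesis .
    qed
  qed
qed

text \<open>
  Separation of variables: in applications \<open>C\<close> depends on one point and \<open>E\<close> on another one, while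
  the left-hand side mixes them.
\<close>

lemma op_norm_mult_le:
  assumes basis: "\<And>i. i < d \<Longrightarrow> u i \<in> carrier_vec d"
    "\<And>C v. C \<in> carrier_mat d d \<Longrightarrow> v \<in> carrier_vec d \<Longrightarrow>
      ennreal (vnorm (C *\<^sub>v v)) \<le> 2 * epowr (N v) (1 / p) * ennreal (\<Sum>i<d. vnorm (C *\<^sub>v u i))"
    and C: "C \<in> carrier_mat d d" and E: "E \<in> carrier_mat d d"
  shows "ennreal (op_norm (C * E)) \<le>
    2 * epowr (avg M B (\<lambda>x. epowr (ennreal (op_norm (A x * E))) p)) (1 / p) * ennreal (\<Sum>i<d. vnorm (C *\<^sub>v u i))"
    (is "_ \<le> ?R")
proof (cases "?R = top")
  case False
  then obtain c where c: "?R = ennreal c" "0 \<le> c" by (cases ?R) auto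
  have "op_norm (C * E) \<le> c"
  proof (rule op_norm_le[OF _ d])
    show "C * E \<in> carrier_mat d d" using C E by auto
    fix v :: "real vec" assume v: "v \<in> carrier_vec d"
    have Ev: "E *\<^sub>v v \<in> carrier_vec d" using E v by auto
    have "N (E *\<^sub>v v) \<le> avg M B (\<lambda>x. ennreal (vnorm v powr p) * epowr (ennreal (op_norm (A x * E))) p)"
      unfolding N_def
    proof (rule avg_mono_AE, rule AE_I2, rule impI)
      fix x assume "x \<in> space M"
      note Ax = A_carrier[OF this]
      have AE: "A x * E \<in> carrier_mat d d" using Ax E by auto
      have "vnorm (A x *\<^sub>v (E *\<^sub>v v)) = vnorm ((A x * E) *\<^sub>v v)"
        using Ax E v by (simp add: assoc_mult_mat_vec[of _ d d _ d])
      also have "\<dots> \<le> vnorm v * op_norm (A x * E)"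
        using vnorm_mult_mat_vec_le[OF AE v] by (simp add: mult.commute)
      finally have "epowr (ennreal (vnorm (A x *\<^sub>v (E *\<^sub>v v)))) p \<le> epowr (ennreal (vnorm v * op_norm (A x * E))) p"
        using p by (intro epowr_mono ennreal_leI) auto
      then show "epowr (ennreal (vnorm (A x *\<^sub>v (E *\<^sub>v v)))) p
          \<le> ennreal (vnorm v powr p) * epowr (ennreal (op_norm (A x * E))) p"
        using op_norm_nonneg[OF AE d] by (simp add: ennreal_mult epowr_mult epowr_ennreal)
    qed
    also have "\<dots> \<le> ennreal (vnorm v powr p) * avg M B (\<lambda>x. epowr (ennreal (op_norm (A x * E))) p)"
      by (rule avg_cmult_le) simp
    finally have "epowr (N (E *\<^sub>v v)) (1 / p) \<le> epowr (ennreal (vnorm v powr p) * avg M B (\<lambda>x. epowr (ennreal (op_norm (A x * E))) p)) (1 / p)"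
      using p by (intro epowr_mono) auto
    also have "\<dots> = ennreal (vnorm v) * epowr (avg M B (\<lambda>x. epowr (ennreal (op_norm (A x * E))) p)) (1 / p)"
      using p by (simp add: epowr_mult epowr_ennreal powr_powr)
    finally have "2 * epowr (N (E *\<^sub>v v)) (1 / p) * ennreal (\<Sum>i<d. vnorm (C *\<^sub>v u i)) \<le> ennreal (vnorm v) * ?R"
      using mult_right_mono[OF mult_left_mono[of _ _ 2], of _ _ "ennreal (\<Sum>i<d. vnorm (C *\<^sub>v u i))"]
      by (fastforce simp: mult_ac)
    with basis(2)[OF C Ev] have "ennreal (vnorm (C *\<^sub>v (E *\<^sub>v v))) \<le> ennreal (vnorm v) * ?R"
      by (rule order_trans)
    then have "ennreal (vnorm (C *\<^sub>v (E *\<^sub>v v))) \<le> ennreal (vnorm v * c)"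
      unfolding c using c(2) by (simp add: ennreal_mult)
    then have "vnorm (C *\<^sub>v (E *\<^sub>v v)) \<le> vnorm v * c"
      using c(2) by (simp add: ennreal_le_iff)
    then show "vnorm ((C * E) *\<^sub>v v) \<le> c * vnorm v"
      using C E v by (simp add: assoc_mult_mat_vec[of _ d d _ d] mult.commute)
  qed
  then show ?thesis unfolding c by (rule ennreal_leI)
qed simp

end

section \<open>Duality of the classes of matrix weights\<close>

lemma matrix_weightD:
  assumes "matrix_weight n d W"
  shows "x \<in> space (leb n) \<Longrightarrow> W x \<in> psd_mat d"
    "x \<in> space (leb n) \<Longrightarrow> W x \<in> carrier_mat d d"
    "x \<in> space (leb n) \<Longrightarrow> transpose_mat (W x) = W x"
    "i < d \<Longrightarrow> j < d \<Longrightarrow> (\<lambda>x. W x $$ (i, j)) \<in> borel_measurable (leb n)"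
    "AE x in leb n. invertible_mat (W x)"
  using assms psd_matD by (auto simp: matrix_weight_def)

lemma op_norm_minv_mult:
  assumes A: "A \<in> carrier_mat d d" "transpose_mat A = A" "invertible_mat A"
    and E: "E \<in> carrier_mat d d" "transpose_mat E = E" and d: "0 < d"
  shows "op_norm (minv A * E) = op_norm (E * minv A)"
proof -
  have "transpose_mat (E * minv A) = transpose_mat (minv A) * transpose_mat E"
    using E A by (intro transpose_mult) auto
  also have "\<dots> = minv A * E" using minv_transpose[OF A(1,3)] A E by simp
  finally show ?thesis
    using op_norm_transpose[of "E * minv A" d d] A E d by (metis minv_carrier mult_carrier_mat)
qed

definition weight_kernel :: "('a \<Rightarrow> real mat) \<Rightarrow> 'a \<Rightarrow> 'a \<Rightarrow> real" where
  "weight_kernel V x y = op_norm (V x * minv (V y))"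

text \<open>
  The constants of \<open>V\<close> and \<open>V^-1\<close> are mixed norms \<open>L^r_x L^r'_y\<close> of \<open>|V(x) V(y)^-1|\<close> taken in opposite
  orders.  A reducing basis \<open>u_i\<close> for the average of \<open>|V^-1 v|^r'\<close> dominates this function by a product: with
  \<open>\<alpha>(x) = \<Sum>_i |V(x)^-1 u_i|\<close> and \<open>\<beta>(y) = avg |V(y) V^-1|^r'\<close>, one has
  \<open>|V(y) V(x)^-1| \<le> 2 \<alpha>(x) \<beta>(y)^(1/r')\<close>, and the order no longer matters.
\<close>

lemma A_const_dual_finite:
  assumes d: "0 < d" and r: "1 < r"
    and sets: "\<And>B. B \<in> \<B> \<Longrightarrow> B \<in> sets (leb n) \<and> emeasure (leb n) B < top"
    and V: "matrix_weight n d V" and fin: "A_const n \<B> (ereal r) V < top"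
    and Vi: "AE x in leb n. Vi x = minv (V x)"
  shows "A_const n \<B> (ereal (r / (r - 1))) Vi < top"
proof -
  let ?M = "leb n"
  define r' where "r' = r / (r - 1)"
  have r': "1 < r'" using r by (simp add: r'_def field_simps)
  have r'r: "r' / (r' - 1) = r" using r by (simp add: r'_def field_simps)
  note V_carrier = matrix_weightD(2)[OF V] and V_inv = matrix_weightD(5)[OF V]
  define L where "L = A_const n \<B> (ereal r) V"
  have L: "L = (SUP B\<in>\<B>. epowr (avg ?M B (\<lambda>x. epowr (avg ?M B (\<lambda>y. epowr (ennreal (weight_kernel V x y)) r')) (r / r'))) (1 / r))"
    using r by (simp add: L_def A_const_def conj_exp_ereal Let_def r'_def weight_kernel_def one_ereal_def)
  let ?dual = "\<lambda>B x. avg ?M B (\<lambda>y. epowr (ennreal (op_norm (Vi x * minv (Vi y)))) r)"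
  have goal: "A_const n \<B> (ereal r') Vi = (SUP B\<in>\<B>. epowr (avg ?M B (\<lambda>x. epowr (?dual B x) (r' / r))) (1 / r'))"
    using r' by (simp add: A_const_def conj_exp_ereal Let_def r'r one_ereal_def)
  (* A bound that does not depend on B. *)
  define R where "R = 2 * ennreal (real d) * L * epowr (ennreal (real d)) (1 / r')"
  have "epowr (avg ?M B (\<lambda>x. epowr (?dual B x) (r' / r))) (1 / r') \<le> R"
    if "B \<in> \<B>" for B
  proof (cases "emeasure ?M B = 0")
    case True
    then have "B \<in> null_sets ?M" using sets[OF that] by auto
    then show ?thesis by (simp add: avg_null)
  next
    case False
    have B: "B \<in> sets ?M" "0 < emeasure ?M B" "emeasure ?M B < top"
      using sets[OF that] False by (auto simp: zero_less_iff_neq_zero)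
    note [measurable] = B(1)
    define \<beta> where "\<beta> = (\<lambda>y. avg ?M B (\<lambda>y'. epowr (ennreal (weight_kernel V y y')) r'))"
    have "epowr (avg ?M B (\<lambda>x. epowr (\<beta> x) (r / r'))) (1 / r) \<le> L"
      unfolding L \<beta>_def using that by (intro SUP_upper2[of B]) auto
    from epowr_mono[OF this, of r] have \<beta>L: "avg ?M B (\<lambda>x. epowr (\<beta> x) (r / r')) \<le> epowr L r"
      using r by (simp add: epowr_epowr)
    also have "\<dots> < top" using fin by (simp add: L_def flip: less_top)
    finally have "avg ?M B (\<lambda>x. epowr (\<beta> x) (r / r')) < top" .
    from avg_finite_witness[OF B this V_inv] obtain y0 where
      y0: "y0 \<in> B" "invertible_mat (V y0)" "epowr (\<beta> y0) (r / r') < top" .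
    have y0s: "y0 \<in> space ?M" using y0(1) sets.sets_into_space[OF B(1)] by auto
    note Vy0 = V_carrier[OF y0s]
    have Vmi_meas: "(\<lambda>x. minv (V x) $$ (i, j)) \<in> borel_measurable ?M" if "i < d" "j < d" for i j
      using that by (intro borel_measurable_minv[OF V_carrier matrix_weightD(4)[OF V]]) auto
    interpret average_norm ?M B d "\<lambda>x. minv (V x)" r'
    proof
      show "AE x in ?M. invertible_mat (minv (V x))"
        using V_inv AE_space by eventually_elim (rule invertible_minv[OF V_carrier])
      fix v :: "real vec" assume v: "v \<in> carrier_vec d"
      define w where "w = minv (V y0) *\<^sub>v v"
      have w: "w \<in> carrier_vec d" using mult_mat_vec_carrier[OF minv_carrier[OF Vy0] v] by (simp add: w_def)
      have "avg ?M B (\<lambda>x. epowr (ennreal (vnorm (minv (V x) *\<^sub>v v))) r')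
          \<le> avg ?M B (\<lambda>x. ennreal (vnorm w powr r') * epowr (ennreal (weight_kernel V y0 x)) r')"
      proof (rule avg_mono_AE)
        show "AE x in ?M. x \<in> B \<longrightarrow> epowr (ennreal (vnorm (minv (V x) *\<^sub>v v))) r'
            \<le> ennreal (vnorm w powr r') * epowr (ennreal (weight_kernel V y0 x)) r'"
          using V_inv AE_space
        proof eventually_elim
          case (elim x)
          note Vx = V_carrier[OF elim(2)]
          have prod: "minv (V x) * V y0 \<in> carrier_mat d d" using minv_carrier[OF Vx] Vy0 by auto
          have "v = V y0 *\<^sub>v w"
            unfolding w_def using minv_right[OF Vy0 y0(2)] Vy0 v minv_carrier[OF Vy0]
            by (simp flip: assoc_mult_mat_vec[of _ d d _ d])
          then have "minv (V x) *\<^sub>v v = (minv (V x) * V y0) *\<^sub>v w"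
            using minv_carrier[OF Vx] Vy0 w by (simp add: assoc_mult_mat_vec[of _ d d _ d])
          then have "vnorm (minv (V x) *\<^sub>v v) \<le> op_norm (minv (V x) * V y0) * vnorm w"
            using vnorm_mult_mat_vec_le[OF prod w] by simp
          also have "op_norm (minv (V x) * V y0) = weight_kernel V y0 x"
            unfolding weight_kernel_def using matrix_weightD(3)[OF V] elim y0s Vx Vy0 d by (intro op_norm_minv_mult) auto
          finally have "ennreal (vnorm (minv (V x) *\<^sub>v v)) \<le> ennreal (vnorm w) * ennreal (weight_kernel V y0 x)"
            by (simp add: ennreal_leI mult.commute flip: ennreal_mult')
          from epowr_mono[OF this, of r'] show ?case using r' by (simp add: epowr_mult epowr_ennreal)
        qed
      qed
      also have "\<dots> \<le> ennreal (vnorm w powr r') * \<beta> y0"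
        unfolding \<beta>_def by (rule avg_cmult_le) simp
      also have "\<dots> < top" using y0(3) by (simp add: ennreal_mult_eq_top_iff flip: less_top)
      finally show "avg ?M B (\<lambda>x. epowr (ennreal (vnorm (minv (V x) *\<^sub>v v))) r') < top" .
    qed (use B d r' minv_carrier[OF V_carrier] Vmi_meas in auto)
    obtain u where u: "\<And>i. i < d \<Longrightarrow> u i \<in> carrier_vec d" "\<And>i. i < d \<Longrightarrow> N (u i) \<le> 1"
      "\<And>C v. C \<in> carrier_mat d d \<Longrightarrow> v \<in> carrier_vec d \<Longrightarrow>
        ennreal (vnorm (C *\<^sub>v v)) \<le> 2 * epowr (N v) (1 / r') * ennreal (\<Sum>i<d. vnorm (C *\<^sub>v u i))"
      using reducing_basis by blast
    define \<alpha> where "\<alpha> = (\<lambda>x. \<Sum>i<d. vnorm (minv (V x) *\<^sub>v u i))"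
    have op: "ennreal (op_norm (Vi x * minv (Vi y))) \<le> 2 * epowr (\<beta> y) (1 / r') * ennreal (\<alpha> x)"
      if x: "x \<in> space ?M" "Vi x = minv (V x)" and y: "y \<in> space ?M" "Vi y = minv (V y)" "invertible_mat (V y)" for x y
    proof -
      note Vx = V_carrier[OF x(1)] and Vy = V_carrier[OF y(1)]
      have "Vi x * minv (Vi y) = minv (V x) * V y"
        using x y minv_minv[OF Vy y(3)] by simp
      then have "ennreal (op_norm (Vi x * minv (Vi y))) \<le>
          2 * epowr (avg ?M B (\<lambda>x. epowr (ennreal (op_norm (minv (V x) * V y))) r')) (1 / r') * ennreal (\<alpha> x)"
        using op_norm_mult_le[OF u(1,3) minv_carrier[OF Vx] Vy] by (simp add: \<alpha>_def)
      also have "avg ?M B (\<lambda>x. epowr (ennreal (op_norm (minv (V x) * V y))) r') = \<beta> y"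
        unfolding \<beta>_def
      proof (rule avg_cong_AE)
        show "AE x in ?M. x \<in> B \<longrightarrow> epowr (ennreal (op_norm (minv (V x) * V y))) r' = epowr (ennreal (weight_kernel V y x)) r'"
          using V_inv AE_space
        proof eventually_elim
          case (elim z)
          then show ?case unfolding weight_kernel_def using matrix_weightD(3)[OF V] y(1) Vy V_carrier[OF elim(2)] d
            by (subst op_norm_minv_mult[of "V z" d]) auto
        qed
      qed
      finally show ?thesis .
    qed
    have inner: "?dual B x \<le> epowr (2 * ennreal (\<alpha> x) * L) r"
      if x: "x \<in> space ?M" "Vi x = minv (V x)" for x
    proof -
      have "?dual B x
        \<le> avg ?M B (\<lambda>y. epowr (2 * ennreal (\<alpha> x)) r * epowr (\<beta> y) (r / r'))"
      proof (rule avg_mono_AE)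
        show "AE y in ?M. y \<in> B \<longrightarrow> epowr (ennreal (op_norm (Vi x * minv (Vi y)))) r \<le> epowr (2 * ennreal (\<alpha> x)) r * epowr (\<beta> y) (r / r')"
          using V_inv Vi AE_space
        proof eventually_elim
          case (elim y)
          have "epowr (ennreal (op_norm (Vi x * minv (Vi y)))) r \<le> epowr (2 * ennreal (\<alpha> x) * epowr (\<beta> y) (1 / r')) r"
            using op[OF x elim(3,2,1)] r by (intro epowr_mono) (auto simp: mult_ac)
          also have "\<dots> = epowr (2 * ennreal (\<alpha> x)) r * epowr (\<beta> y) (r / r')"
            by (simp add: epowr_mult epowr_epowr)
          finally show ?case by simp
        qed
      qed
      also have "\<dots> \<le> epowr (2 * ennreal (\<alpha> x)) r * avg ?M B (\<lambda>y. epowr (\<beta> y) (r / r'))"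
        by (rule avg_cmult_le) (simp add: ennreal_mult_eq_top_iff flip: less_top)
      also have "\<dots> \<le> epowr (2 * ennreal (\<alpha> x)) r * epowr L r"
        by (intro mult_left_mono \<beta>L) auto
      also have "\<dots> = epowr (2 * ennreal (\<alpha> x) * L) r" by (simp add: epowr_mult)
      finally show ?thesis .
    qed
    have [measurable]: "(\<lambda>x. vnorm (minv (V x) *\<^sub>v u i)) \<in> borel_measurable ?M" if "i < d" for i
      using u(1)[OF that] by (rule vnorm_measurable)
    have "avg ?M B (\<lambda>x. epowr (?dual B x) (r' / r))
      \<le> avg ?M B (\<lambda>x. epowr (2 * L) r' * (ennreal (real d powr r') * (\<Sum>i<d. epowr (ennreal (vnorm (minv (V x) *\<^sub>v u i))) r')))"
    proof (rule avg_mono_AE)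
      show "AE x in ?M. x \<in> B \<longrightarrow> epowr (?dual B x) (r' / r)
        \<le> epowr (2 * L) r' * (ennreal (real d powr r') * (\<Sum>i<d. epowr (ennreal (vnorm (minv (V x) *\<^sub>v u i))) r'))"
        using Vi AE_space
      proof eventually_elim
        case (elim x)
        have "epowr (?dual B x) (r' / r) \<le> epowr (epowr (2 * ennreal (\<alpha> x) * L) r) (r' / r)"
          using inner[OF elim(2,1)] r r' by (intro epowr_mono) auto
        also have "\<dots> = epowr (2 * L) r' * epowr (ennreal (\<alpha> x)) r'"
          using r by (simp add: epowr_epowr epowr_mult mult_ac)
        also have "epowr (ennreal (\<alpha> x)) r' \<le> ennreal (real d powr r') * (\<Sum>i<d. epowr (ennreal (vnorm (minv (V x) *\<^sub>v u i))) r')"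
          using epowr_sum_le[of r' "\<lambda>i. ennreal (vnorm (minv (V x) *\<^sub>v u i))" d] r'
          by (simp add: \<alpha>_def sum_ennreal)
        finally show ?case by (simp add: mult_left_mono)
      qed
    qed
    also have "\<dots> = epowr (2 * L) r' * (ennreal (real d powr r') * (\<Sum>i<d. N (u i)))"
      unfolding N_def by (subst avg_cmult, simp, measurable, subst avg_cmult, simp, measurable, subst avg_sum) auto
    also have "\<dots> \<le> epowr (2 * L) r' * (ennreal (real d powr r') * (\<Sum>i<d. 1))"
      by (intro mult_left_mono sum_mono u(2)) auto
    also have "\<dots> = epowr (2 * L * ennreal (real d)) r' * ennreal (real d)"
      by (simp add: epowr_mult epowr_ennreal mult.assoc ennreal_of_nat_eq_real_of_nat)
    finally have "epowr (avg ?M B (\<lambda>x. epowr (?dual B x) (r' / r))) (1 / r')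
      \<le> epowr (epowr (2 * L * ennreal (real d)) r' * ennreal (real d)) (1 / r')"
      using r' by (intro epowr_mono) auto
    also have "\<dots> = R"
      using r' unfolding R_def epowr_mult[of "epowr _ _"] by (simp add: epowr_epowr mult_ac)
    finally show ?thesis .
  qed
  then have "A_const n \<B> (ereal r') Vi \<le> R" unfolding goal by (rule SUP_least)
  also have "R < top"
    using fin unfolding R_def L_def
    by (simp add: ennreal_mult_eq_top_iff epowr_ennreal flip: less_top)
  finally show ?thesis by (simp add: r'_def)
qed

section \<open>Lebesgue measure and bases\<close>

lemma sigma_finite_completion:
  assumes "sigma_finite_measure M"
  shows "sigma_finite_measure (completion M)"
proof -
  interpret sigma_finite_measure M by fact
  obtain A :: "nat \<Rightarrow> 'a set" where "range A \<subseteq> sets M" "(\<Union>i. A i) = space M" "\<And>i. emeasure M (A i) \<noteq> \<infinity>"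
    using sigma_finite by auto
  then show ?thesis
    by (intro sigma_finite_measure.intro exI[of _ "range A"]) auto
qed

lemma sigma_finite_leb: "sigma_finite_measure (leb n)"
proof -
  interpret product_sigma_finite "\<lambda>_ :: nat. lborel :: real measure"
    by (intro product_sigma_finite.intro sigma_finite_lborel)
  show ?thesis
    unfolding leb_def by (intro sigma_finite_completion sigma_finite) simp
qed

text \<open>
  An open set is a countable union of boxes whose sides belong to a countable base of the line.
\<close>

lemma openin_euclid_top_sets:
  assumes "openin (euclid_top n) S"
  shows "S \<in> sets (leb n)"
proof -
  obtain C :: "real set set" where C: "countable C" "topological_basis C"
    using ex_countable_basis by blast
  define P where "P = {c \<in> {..<n} \<rightarrow>\<^sub>E C. (\<Pi>\<^sub>E i\<in>{..<n}. c i) \<subseteq> S}"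
  have "countable P"
  proof -
    have "countable ({..<n} \<rightarrow>\<^sub>E C)" using C by (intro countable_PiE) auto
    then show ?thesis by (rule countable_subset[rotated]) (auto simp: P_def)
  qed
  have "S = (\<Union>c\<in>P. \<Pi>\<^sub>E i\<in>{..<n}. c i)"
  proof (intro equalityI subsetI)
    fix x assume x: "x \<in> S"
    with assms obtain U where U: "\<And>i. i < n \<Longrightarrow> open (U i)" "x \<in> (\<Pi>\<^sub>E i\<in>{..<n}. U i)" "(\<Pi>\<^sub>E i\<in>{..<n}. U i) \<subseteq> S"
      using openin_product_topology_alt[of "\<lambda>_. euclidean" "{..<n}" S] unfolding euclid_top_def
      by (metis lessThan_iff open_openin)
    have "\<exists>c\<in>C. x i \<in> c \<and> c \<subseteq> U i" if "i < n" for i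
    proof -
      have "x i \<in> U i" using U(2) that by auto
      from topological_basisE[OF C(2) U(1)[OF that] this] show ?thesis by metis
    qed
    then obtain c where c: "\<And>i. i < n \<Longrightarrow> c i \<in> C \<and> x i \<in> c i \<and> c i \<subseteq> U i" by metis
    define c' where "c' = restrict c {..<n}"
    have "(\<Pi>\<^sub>E i\<in>{..<n}. c' i) \<subseteq> (\<Pi>\<^sub>E i\<in>{..<n}. U i)"
      using c by (intro PiE_mono) (auto simp: c'_def)
    then have "(\<Pi>\<^sub>E i\<in>{..<n}. c' i) \<subseteq> S" using U(3) by (rule subset_trans)
    moreover have "c' \<in> {..<n} \<rightarrow>\<^sub>E C" using c by (auto simp: c'_def)
    ultimately have "c' \<in> P" by (simp add: P_def)
    moreover have "x \<in> (\<Pi>\<^sub>E i\<in>{..<n}. c' i)" using c U(2) by (auto simp: c'_def PiE_def)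
    ultimately show "x \<in> (\<Union>c\<in>P. \<Pi>\<^sub>E i\<in>{..<n}. c i)" by blast
  qed (auto simp: P_def)
  also have "\<dots> \<in> sets (Pi\<^sub>M {..<n} (\<lambda>_. lborel))"
  proof (intro sets.countable_UN'' \<open>countable P\<close> sets_PiM_I_finite)
    fix c i assume "c \<in> P" "i \<in> {..<n}"
    then have "open (c i)" using topological_basis_open[OF C(2), of "c i"] by (auto simp: P_def)
    then show "c i \<in> sets lborel" by simp
  qed simp
  finally show ?thesis unfolding leb_def by simp
qed

lemma basis_sets:
  assumes "basis n \<B>" "B \<in> \<B>"
  shows "B \<in> sets (leb n)" "emeasure (leb n) B < top"
  using assms openin_euclid_top_sets unfolding basis_def by auto

section \<open>Majorants from the maximal operator\<close>

locale muckenhoupt_weight =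
  fixes n d :: nat and \<B> :: "(nat \<Rightarrow> real) set set" and K :: "nat \<Rightarrow> real \<Rightarrow> real \<Rightarrow> real"
    and p :: real and V :: "(nat \<Rightarrow> real) \<Rightarrow> real mat"
  assumes mb: "matrix_muckenhoupt_basis n \<B> K" and d: "1 \<le> d" and p: "1 < p"
    and V_class: "V \<in> A_class n d \<B> (ereal p)"
begin

abbreviation "M \<equiv> leb n"

definition \<kappa> :: real where "\<kappa> = K d p (enn2real (A_const n \<B> (ereal p) V))"

lemma kappa_nonneg: "0 \<le> \<kappa>"
  using mb d p by (simp add: \<kappa>_def matrix_muckenhoupt_basis_def)

lemma V_weight: "matrix_weight n d V"
  using V_class by (simp add: A_class_def)

lemmas V_carrier = matrix_weightD(2)[OF V_weight]
lemmas V_meas = matrix_weightD(4)[OF V_weight]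
lemmas V_inv = matrix_weightD(5)[OF V_weight]

lemma B_sets: "B \<in> \<B> \<Longrightarrow> B \<in> sets M" "B \<in> \<B> \<Longrightarrow> emeasure M B < top"
  using mb basis_sets[of n \<B> B] by (auto simp: matrix_muckenhoupt_basis_def)

lemma minv_V_meas: "i < d \<Longrightarrow> j < d \<Longrightarrow> (\<lambda>y. minv (V y) $$ (i, j)) \<in> borel_measurable M"
  by (intro borel_measurable_minv[OF V_carrier V_meas]) auto

lemma product_carrier: "x \<in> space M \<Longrightarrow> y \<in> space M \<Longrightarrow> V x * minv (V y) \<in> carrier_mat d d"
  by (intro square_closed V_carrier minv_carrier)

lemma product_meas:
  assumes "x \<in> space M" "i < d" "j < d"
  shows "(\<lambda>y. (V x * minv (V y)) $$ (i, j)) \<in> borel_measurable M"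
  using assms
  by (intro borel_measurable_mult_mat[of _ _ d] minv_V_meas minv_carrier[OF V_carrier] V_carrier) auto

lemma column_meas:
  assumes "x \<in> space M" "v \<in> carrier_vec d"
  shows "(\<lambda>y. vnorm ((V x * minv (V y)) *\<^sub>v v)) \<in> borel_measurable M"
  using assms by (intro borel_measurable_vnorm_mult[OF product_carrier product_meas])

text \<open>
  The maximal operator applied to \<open>h\<close> times the \<open>i\<close>-th unit vector.  It accepts functions
  \<open>h\<close> with values in the extended half-line, which makes the sum \<open>T\<close> of these operators countably
  subadditive without exception (lemma \<open>T_subadditive\<close>); for almost everywhere finite \<open>h\<close> it is literally a
  maximal function (lemma \<open>column_op_eq_maximal_op\<close>).
\<close>

definition column_op :: "nat \<Rightarrow> ((nat \<Rightarrow> real) \<Rightarrow> ennreal) \<Rightarrow> (nat \<Rightarrow> real) \<Rightarrow> ennreal" where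
  "column_op i h x = (SUP B\<in>\<B>. avg M B (\<lambda>y. ennreal (vnorm ((V x * minv (V y)) *\<^sub>v unit_vec d i)) * h y) * indicator B x)"

definition T :: "((nat \<Rightarrow> real) \<Rightarrow> ennreal) \<Rightarrow> (nat \<Rightarrow> real) \<Rightarrow> ennreal" where
  "T h x = (\<Sum>i<d. column_op i h x)"

lemma column_op_eq_maximal_op:
  assumes fin: "AE y in M. h y \<noteq> top" and x: "x \<in> space M"
  shows "maximal_op n \<B> V (\<lambda>y. enn2real (h y) \<cdot>\<^sub>v unit_vec d i) x = column_op i h x"
proof -
  have "avg M B (\<lambda>y. ennreal (vnorm ((V x * minv (V y)) *\<^sub>v (enn2real (h y) \<cdot>\<^sub>v unit_vec d i))))
     = avg M B (\<lambda>y. ennreal (vnorm ((V x * minv (V y)) *\<^sub>v unit_vec d i)) * h y)" for B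
  proof (rule avg_cong_AE)
    show "AE y in M. y \<in> B \<longrightarrow> ennreal (vnorm ((V x * minv (V y)) *\<^sub>v (enn2real (h y) \<cdot>\<^sub>v unit_vec d i)))
      = ennreal (vnorm ((V x * minv (V y)) *\<^sub>v unit_vec d i)) * h y"
      using fin AE_space
    proof eventually_elim
      case (elim y)
      then have "h y = ennreal (enn2real (h y))" by (simp add: less_top)
      then obtain c where c: "h y = ennreal c" "0 \<le> c" "enn2real (h y) = c" by (metis enn2real_nonneg)
      then show ?case
        using mult_mat_vec[OF product_carrier[OF x elim(2)], of "unit_vec d i" c]
        by (simp add: vnorm_smult ennreal_mult mult.commute)
    qed
  qed
  then show ?thesis by (simp add: maximal_op_def column_op_def)
qed

lemma column_op_bounded:
  assumes h [measurable]: "h \<in> borel_measurable M" and fin: "(\<integral>\<^sup>+x. epowr (h x) p \<partial>M) < top" and i: "i < d"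
  shows "column_op i h \<in> borel_measurable M"
    "(\<integral>\<^sup>+x. epowr (column_op i h x) p \<partial>M) \<le> ennreal (\<kappa> powr p) * (\<integral>\<^sup>+x. epowr (h x) p \<partial>M)"
proof -
  define f where "f = (\<lambda>y. enn2real (h y) \<cdot>\<^sub>v unit_vec d i)"
  have "AE y in M. epowr (h y) p \<noteq> \<infinity>" using fin by (intro nn_integral_PInf_AE) auto
  then have hfin: "AE y in M. h y \<noteq> top" by simp
  have f: "vec_measurable n d f"
    unfolding vec_measurable_def f_def
  proof (intro conjI ballI allI impI)
    fix j assume "j < d"
    then show "(\<lambda>x. (enn2real (h x) \<cdot>\<^sub>v unit_vec d i) $ j) \<in> borel_measurable M" by simp
  qed auto
  have "(\<integral>\<^sup>+x. epowr (ennreal (vnorm (f x))) p \<partial>M) = (\<integral>\<^sup>+x. epowr (h x) p \<partial>M)"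
  proof (rule nn_integral_cong_AE)
    show "AE x in M. epowr (ennreal (vnorm (f x))) p = epowr (h x) p"
      using hfin by eventually_elim (use i in \<open>simp add: f_def vnorm_smult less_top\<close>)
  qed
  then have norm_f: "Lp_norm M (ereal p) (\<lambda>x. ennreal (vnorm (f x))) = epowr (\<integral>\<^sup>+x. epowr (h x) p \<partial>M) (1 / p)"
    by (simp add: Lp_norm_def)
  then have "Lp_norm M (ereal p) (\<lambda>x. ennreal (vnorm (f x))) < \<infinity>" using fin by (simp flip: less_top)
  with mb d p V_class f have max: "maximal_op n \<B> V f \<in> borel_measurable M"
      "Lp_norm M (ereal p) (maximal_op n \<B> V f) \<le> ennreal \<kappa> * Lp_norm M (ereal p) (\<lambda>x. ennreal (vnorm (f x)))"
    unfolding matrix_muckenhoupt_basis_def \<kappa>_def by blast+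
  have eq: "maximal_op n \<B> V f x = column_op i h x" if "x \<in> space M" for x
    unfolding f_def using hfin that by (rule column_op_eq_maximal_op)
  show "column_op i h \<in> borel_measurable M"
    using max(1) by (subst (asm) measurable_cong[OF eq])
  have "(\<integral>\<^sup>+x. epowr (maximal_op n \<B> V f x) p \<partial>M) = (\<integral>\<^sup>+x. epowr (column_op i h x) p \<partial>M)"
    by (intro nn_integral_cong) (simp add: eq)
  with max(2) have "epowr (\<integral>\<^sup>+x. epowr (column_op i h x) p \<partial>M) (1 / p) \<le> ennreal \<kappa> * epowr (\<integral>\<^sup>+x. epowr (h x) p \<partial>M) (1 / p)"
    unfolding norm_f by (simp add: Lp_norm_def)
  from epowr_mono[OF this, of p] show "(\<integral>\<^sup>+x. epowr (column_op i h x) p \<partial>M) \<le> ennreal (\<kappa> powr p) * (\<integral>\<^sup>+x. epowr (h x) p \<partial>M)"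
    using p kappa_nonneg by (simp add: epowr_epowr epowr_mult epowr_ennreal)
qed

lemma T_bounded:
  assumes h [measurable]: "h \<in> borel_measurable M" and fin: "(\<integral>\<^sup>+x. epowr (h x) p \<partial>M) < top"
  shows "T h \<in> borel_measurable M"
    "(\<integral>\<^sup>+x. epowr (T h x) p \<partial>M) \<le> ennreal ((real d ^ 2 * \<kappa>) powr p) * (\<integral>\<^sup>+x. epowr (h x) p \<partial>M)"
proof -
  note col [measurable] = column_op_bounded(1)[OF assms]
  show "T h \<in> borel_measurable M" unfolding T_def by measurable
  let ?I = "\<integral>\<^sup>+x. epowr (h x) p \<partial>M"
  have "(\<integral>\<^sup>+x. epowr (T h x) p \<partial>M) \<le> (\<integral>\<^sup>+x. ennreal (real d powr p) * (\<Sum>i<d. epowr (column_op i h x) p) \<partial>M)"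
    unfolding T_def using p by (intro nn_integral_mono epowr_sum_le) auto
  also have "\<dots> = ennreal (real d powr p) * (\<Sum>i<d. \<integral>\<^sup>+x. epowr (column_op i h x) p \<partial>M)"
    by (subst nn_integral_cmult) (auto intro!: arg_cong2[where f="(*)"] nn_integral_sum)
  also have "\<dots> \<le> ennreal (real d powr p) * (\<Sum>i<d. ennreal (\<kappa> powr p) * ?I)"
    by (intro mult_left_mono sum_mono column_op_bounded(2)[OF assms]) auto
  also have "\<dots> = ennreal (real d powr p * (real d * \<kappa> powr p)) * ?I"
    by (simp add: ennreal_mult ennreal_of_nat_eq_real_of_nat mult.assoc)
  also have "\<dots> \<le> ennreal ((real d ^ 2 * \<kappa>) powr p) * ?I"
  proof (intro mult_right_mono ennreal_leI)
    have "real d \<le> real d powr p" using powr_mono[of 1 p "real d"] p d by simp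
    then have "real d powr p * (real d * \<kappa> powr p) \<le> real d powr p * (real d powr p * \<kappa> powr p)"
      by (intro mult_left_mono mult_right_mono) auto
    also have "\<dots> = (real d ^ 2 * \<kappa>) powr p" by (simp add: powr_mult power2_eq_square)
    finally show "real d powr p * (real d * \<kappa> powr p) \<le> (real d ^ 2 * \<kappa>) powr p" .
  qed auto
  finally show "(\<integral>\<^sup>+x. epowr (T h x) p \<partial>M) \<le> ennreal ((real d ^ 2 * \<kappa>) powr p) * ?I" .
qed

lemma T_subadditive:
  assumes [measurable]: "\<And>k. h k \<in> borel_measurable M" and x: "x \<in> space M"
  shows "T (\<lambda>y. \<Sum>k. c k * h k y) x \<le> (\<Sum>k. c k * T (h k) x)"
proof -
  have "column_op i (\<lambda>y. \<Sum>k. c k * h k y) x \<le> (\<Sum>k. c k * column_op i (h k) x)" if "i < d" for i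
    unfolding column_op_def[of i "\<lambda>y. \<Sum>k. c k * h k y"]
  proof (rule SUP_least)
    fix B assume B: "B \<in> \<B>"
    define m where "m = (\<lambda>y. ennreal (vnorm ((V x * minv (V y)) *\<^sub>v unit_vec d i)))"
    have [measurable]: "m \<in> borel_measurable M"
      unfolding m_def using column_meas[OF x, of "unit_vec d i"] by simp
    have "avg M B (\<lambda>y. m y * (\<Sum>k. c k * h k y)) = avg M B (\<lambda>y. \<Sum>k. c k * (m y * h k y))"
      by (simp add: mult_ac flip: ennreal_suminf_cmult)
    also have "\<dots> = (\<Sum>k. c k * avg M B (\<lambda>y. m y * h k y))"
      using B_sets(1)[OF B] by (subst avg_suminf) (auto simp: avg_cmult)
    finally have "avg M B (\<lambda>y. m y * (\<Sum>k. c k * h k y)) * indicator B x = (\<Sum>k. c k * (avg M B (\<lambda>y. m y * h k y) * indicator B x))"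
      by (simp add: mult.assoc[symmetric] mult.commute[of _ "indicator B x"] ennreal_suminf_cmult) (simp add: mult_ac flip: ennreal_suminf_cmult)
    also have "\<dots> \<le> (\<Sum>k. c k * column_op i (h k) x)"
      unfolding column_op_def m_def using B by (intro suminf_le mult_left_mono SUP_upper) auto
    finally show "avg M B (\<lambda>y. ennreal (vnorm ((V x * minv (V y)) *\<^sub>v unit_vec d i)) * (\<Sum>k. c k * h k y)) * indicator B x
        \<le> (\<Sum>k. c k * column_op i (h k) x)" by (simp add: m_def)
  qed
  then have "T (\<lambda>y. \<Sum>k. c k * h k y) x \<le> (\<Sum>i<d. \<Sum>k. c k * column_op i (h k) x)"
    unfolding T_def by (intro sum_mono) auto
  also have "\<dots> = (\<Sum>k. \<Sum>i<d. c k * column_op i (h k) x)"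
    by (intro suminf_sum[symmetric]) auto
  finally show ?thesis by (simp add: T_def sum_distrib_left)
qed

lemma avg_kernel_le_T:
  assumes h [measurable]: "h \<in> borel_measurable M" and B: "B \<in> \<B>" "x \<in> B"
  shows "avg M B (\<lambda>y. ennreal (weight_kernel V x y) * h y) \<le> T h x"
proof -
  have x: "x \<in> space M" using B B_sets(1)[OF B(1)] sets.sets_into_space by blast
  have [measurable]: "(\<lambda>y. vnorm ((V x * minv (V y)) *\<^sub>v unit_vec d i)) \<in> borel_measurable M" for i
    using x by (intro column_meas) auto
  have "avg M B (\<lambda>y. ennreal (weight_kernel V x y) * h y)
    \<le> avg M B (\<lambda>y. \<Sum>i<d. ennreal (vnorm ((V x * minv (V y)) *\<^sub>v unit_vec d i)) * h y)"
  proof (rule avg_mono_AE, rule AE_I2, rule impI)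
    fix y assume "y \<in> space M"
    from op_norm_le_sum_columns[OF product_carrier[OF x this]] d
    have "ennreal (weight_kernel V x y) \<le> (\<Sum>i<d. ennreal (vnorm ((V x * minv (V y)) *\<^sub>v unit_vec d i)))"
      unfolding weight_kernel_def by (simp add: sum_ennreal ennreal_leI)
    then show "ennreal (weight_kernel V x y) * h y \<le> (\<Sum>i<d. ennreal (vnorm ((V x * minv (V y)) *\<^sub>v unit_vec d i)) * h y)"
      by (simp add: mult_right_mono flip: sum_distrib_right)
  qed
  also have "\<dots> = (\<Sum>i<d. avg M B (\<lambda>y. ennreal (vnorm ((V x * minv (V y)) *\<^sub>v unit_vec d i)) * h y))"
    using B_sets(1)[OF B(1)] by (intro avg_sum) auto
  also have "\<dots> = (\<Sum>i<d. avg M B (\<lambda>y. ennreal (vnorm ((V x * minv (V y)) *\<^sub>v unit_vec d i)) * h y) * indicator B x)"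
    using B(2) by simp
  also have "\<dots> \<le> T h x"
    unfolding T_def column_op_def using B(1) by (intro sum_mono SUP_upper) auto
  finally show ?thesis .
qed

lemma product_nonzero:
  assumes "x \<in> space M" "y \<in> space M" "invertible_mat (V x)" "invertible_mat (V y)"
    and v: "v \<in> carrier_vec d" "v \<noteq> 0\<^sub>v d"
  shows "0 < vnorm ((V x * minv (V y)) *\<^sub>v v)"
proof (rule ccontr)
  assume "\<not> 0 < vnorm ((V x * minv (V y)) *\<^sub>v v)"
  then have "vnorm ((V x * minv (V y)) *\<^sub>v v) = 0" using vnorm_nonneg antisym not_less by blast
  note Vx = V_carrier[OF assms(1)] and Vy = V_carrier[OF assms(2)]
  note mVx = minv_carrier[OF Vx] and mVy = minv_carrier[OF Vy]
  have w: "minv (V y) *\<^sub>v v \<in> carrier_vec d" using mVy v by auto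
  have "(V x * minv (V y)) *\<^sub>v v = 0\<^sub>v d"
    using \<open>vnorm _ = 0\<close> vnorm_eq_0 mult_mat_vec_carrier[OF product_carrier[OF assms(1,2)] v(1)] by blast
  then have "V x *\<^sub>v (minv (V y) *\<^sub>v v) = 0\<^sub>v d" using Vx mVy v by (simp add: assoc_mult_mat_vec[of _ d d _ d])
  then have "minv (V x) *\<^sub>v (V x *\<^sub>v (minv (V y) *\<^sub>v v)) = 0\<^sub>v d" using mVx by auto
  moreover have "minv (V x) *\<^sub>v (V x *\<^sub>v (minv (V y) *\<^sub>v v)) = (minv (V x) * V x) *\<^sub>v (minv (V y) *\<^sub>v v)"
    using mVx Vx w by (simp add: assoc_mult_mat_vec[of _ d d _ d])
  ultimately have "minv (V y) *\<^sub>v v = 0\<^sub>v d" using minv_left[OF Vx assms(3)] w by simp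
  then have "V y *\<^sub>v (minv (V y) *\<^sub>v v) = 0\<^sub>v d" using Vy by auto
  moreover have "V y *\<^sub>v (minv (V y) *\<^sub>v v) = v"
    using minv_right[OF Vy assms(4)] Vy mVy v by (simp flip: assoc_mult_mat_vec[of _ d d _ d])
  ultimately show False using v(2) by simp
qed

text \<open>
  If some set of the basis has positive measure, the maximal function of a positive function times
  a unit vector is positive almost everywhere on it, as the weight is invertible almost everywhere.  This excludes
  the bound \<open>0\<close>, by which the Rubio de Francia series could not be normalized.
\<close>

lemma kappa_pos:
  assumes B: "B \<in> \<B>" "emeasure M B \<noteq> 0"
    and h [measurable]: "h \<in> borel_measurable M" and h0: "\<And>x. 0 < h x" and fin: "(\<integral>\<^sup>+x. epowr (h x) p \<partial>M) < top"
  shows "0 < \<kappa>"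
proof (rule ccontr)
  assume "\<not> 0 < \<kappa>"
  with kappa_nonneg have "\<kappa> = 0" by simp
  have d0: "0 < d" using d by simp
  note Bs = B_sets[OF B(1)]
  from column_op_bounded(2)[OF h fin d0] \<open>\<kappa> = 0\<close>
  have "(\<integral>\<^sup>+x. epowr (column_op 0 h x) p \<partial>M) = 0" by simp
  then have zero: "AE x in M. column_op 0 h x = 0"
    using column_op_bounded(1)[OF h fin d0] by (subst (asm) nn_integral_0_iff_AE) auto
  have unit: "unit_vec d 0 \<noteq> (0\<^sub>v d :: real vec)"
    using vnorm_unit[OF d0] by (metis vnorm_zero zero_neq_one)
  have "AE x in M. x \<notin> B"
    using zero V_inv AE_space
  proof eventually_elim
    case (elim x)
    show ?case
    proof
      assume x: "x \<in> B"
      have "0 < avg M B (\<lambda>y. ennreal (vnorm ((V x * minv (V y)) *\<^sub>v unit_vec d 0)) * h y)"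
      proof (rule avg_pos)
        show "AE y in M. y \<in> B \<longrightarrow> 0 < ennreal (vnorm ((V x * minv (V y)) *\<^sub>v unit_vec d 0)) * h y"
          using V_inv AE_space
        proof eventually_elim
          case (elim y)
          with product_nonzero[OF \<open>x \<in> space M\<close> elim(2) \<open>invertible_mat (V x)\<close> elim(1) _ unit]
          show ?case using h0[of y] by (simp add: ennreal_zero_less_mult_iff)
        qed
      qed (use Bs B column_meas[OF elim(3), of "unit_vec d 0"] in \<open>auto simp: zero_less_iff_neq_zero\<close>)
      also have "\<dots> = avg M B (\<lambda>y. ennreal (vnorm ((V x * minv (V y)) *\<^sub>v unit_vec d 0)) * h y) * indicator B x"
        using x by simp
      also have "\<dots> \<le> column_op 0 h x" unfolding column_op_def using B(1) by (intro SUP_upper)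
      finally show False using elim(1) by simp
    qed
  qed
  then have "B \<in> null_sets M" using AE_iff_null_sets[OF Bs(1)] by simp
  with B(2) show False by auto
qed

text \<open>
  The Rubio de Francia series of \<open>T\<close>.  If all sets of the basis are null sets, all averages vanish and
  \<open>h\<close> itself is a majorant.
\<close>

lemma majorant:
  fixes h :: "(nat \<Rightarrow> real) \<Rightarrow> real"
  assumes [measurable]: "h \<in> borel_measurable M" and h0: "\<And>x. 0 < h x"
    and fin: "(\<integral>\<^sup>+x. ennreal (h x powr p) \<partial>M) < top"
  obtains a where "a \<in> borel_measurable M" "\<And>x. 0 < a x" "AE x in M. h x \<le> a x"
    "(\<integral>\<^sup>+x. ennreal (a x powr p) \<partial>M) \<le> ennreal (2 powr p) * (\<integral>\<^sup>+x. ennreal (h x powr p) \<partial>M)"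
    "AE x in M. \<forall>B\<in>\<B>. x \<in> B \<longrightarrow> avg M B (\<lambda>y. ennreal (weight_kernel V x y) * ennreal (a y)) \<le> ennreal (2 * (real d ^ 2 * \<kappa>)) * ennreal (a x)"
proof (cases "\<exists>B\<in>\<B>. emeasure M B \<noteq> 0")
  case False
  show ?thesis
  proof (rule that[of h])
    have "avg M B (\<lambda>y. ennreal (weight_kernel V x y) * ennreal (h y)) = 0" if "B \<in> \<B>" for B x
      using False that B_sets[OF that] by (intro avg_null) auto
    then show "AE x in M. \<forall>B\<in>\<B>. x \<in> B \<longrightarrow> avg M B (\<lambda>y. ennreal (weight_kernel V x y) * ennreal (h y)) \<le> ennreal (2 * (real d ^ 2 * \<kappa>)) * ennreal (h x)"
      by simp
    have "1 \<le> (2::real) powr p" using powr_mono[of 0 p 2] p by simp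
    then have "1 * (\<integral>\<^sup>+x. ennreal (h x powr p) \<partial>M) \<le> ennreal (2 powr p) * (\<integral>\<^sup>+x. ennreal (h x powr p) \<partial>M)"
      by (intro mult_right_mono) auto
    then show "(\<integral>\<^sup>+x. ennreal (h x powr p) \<partial>M) \<le> ennreal (2 powr p) * (\<integral>\<^sup>+x. ennreal (h x powr p) \<partial>M)" by simp
  qed (use h0 in auto)
next
  case True
  define h' where "h' = (\<lambda>x. ennreal (h x))"
  have [measurable]: "h' \<in> borel_measurable M" by (simp add: h'_def)
  have h'p: "(\<integral>\<^sup>+x. epowr (h' x) p \<partial>M) = (\<integral>\<^sup>+x. ennreal (h x powr p) \<partial>M)"
    using h0 by (simp add: h'_def epowr_ennreal less_imp_le)
  have h'0: "0 < h' x" for x using h0 by (simp add: h'_def)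
  have \<kappa>: "0 < \<kappa>" using True kappa_pos[of _ h'] h'0 fin h'p by auto
  define C where "C = real d ^ 2 * \<kappa>"
  have C: "0 < C" using \<kappa> d by (simp add: C_def)
  obtain H where [measurable]: "H \<in> borel_measurable M" and H: "\<And>x. h' x \<le> H x"
    "(\<integral>\<^sup>+x. epowr (H x) p \<partial>M) \<le> ennreal (2 powr p) * (\<integral>\<^sup>+x. epowr (h' x) p \<partial>M)"
    "\<And>x. x \<in> space M \<Longrightarrow> T H x \<le> ennreal (2 * C) * H x"
  proof (rule rubio_de_francia[of p C M T h'])
    show "T h \<in> borel_measurable M \<and> (\<integral>\<^sup>+x. epowr (T h x) p \<partial>M) \<le> ennreal (C powr p) * (\<integral>\<^sup>+x. epowr (h x) p \<partial>M)"
      if "h \<in> borel_measurable M" "(\<integral>\<^sup>+x. epowr (h x) p \<partial>M) < top" for h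
      using T_bounded[OF that] by (simp add: C_def)
    show "(\<integral>\<^sup>+x. epowr (h' x) p \<partial>M) < top" using fin h'p by simp
  qed (use p C T_subadditive in auto)
  have "(\<integral>\<^sup>+x. epowr (H x) p \<partial>M) < top"
    using H(2) fin by (intro le_less_trans[OF H(2)]) (simp add: h'p ennreal_mult_less_top)
  then have "AE x in M. epowr (H x) p \<noteq> \<infinity>" by (intro nn_integral_PInf_AE) auto
  then have Hfin: "AE x in M. H x \<noteq> top" by simp
  (* H is infinite on a null set only; any positive value will do there. *)
  define a where "a = (\<lambda>x. if H x = top then 1 else enn2real (H x))"
  have aH: "AE x in M. ennreal (a x) = H x"
    using Hfin by eventually_elim (simp add: a_def less_top)
  show ?thesis
  proof (rule that[of a])
    show "a \<in> borel_measurable M" unfolding a_def by measurable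
    show "0 < a x" for x
    proof (cases "H x = top")
      case False
      have "0 < H x" using h'0[of x] H(1)[of x] by (rule less_le_trans)
      with False show ?thesis by (simp add: a_def enn2real_positive_iff less_top)
    qed (simp add: a_def)
    note a_pos = this
    show "AE x in M. h x \<le> a x"
      using aH
    proof eventually_elim
      case (elim x)
      then have "ennreal (h x) \<le> ennreal (a x)" using H(1)[of x] by (simp add: h'_def)
      then show ?case using a_pos[of x] by (simp add: ennreal_le_iff)
    qed
    have "(\<integral>\<^sup>+x. ennreal (a x powr p) \<partial>M) = (\<integral>\<^sup>+x. epowr (H x) p \<partial>M)"
      using aH a_pos by (intro nn_integral_cong_AE) (auto elim!: eventually_mono simp: epowr_ennreal less_imp_le dest!: sym[of _ "H _"])
    then show "(\<integral>\<^sup>+x. ennreal (a x powr p) \<partial>M) \<le> ennreal (2 powr p) * (\<integral>\<^sup>+x. ennreal (h x powr p) \<partial>M)"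
      using H(2) h'p by simp
    show "AE x in M. \<forall>B\<in>\<B>. x \<in> B \<longrightarrow> avg M B (\<lambda>y. ennreal (weight_kernel V x y) * ennreal (a y)) \<le> ennreal (2 * (real d ^ 2 * \<kappa>)) * ennreal (a x)"
      using aH AE_space
    proof eventually_elim
      case (elim x)
      show ?case
      proof (intro ballI impI)
        fix B assume B: "B \<in> \<B>" "x \<in> B"
        have "avg M B (\<lambda>y. ennreal (weight_kernel V x y) * ennreal (a y)) = avg M B (\<lambda>y. ennreal (weight_kernel V x y) * H y)"
          using aH by (intro avg_cong_AE) (auto elim: eventually_mono)
        also have "\<dots> \<le> T H x" using B by (intro avg_kernel_le_T) auto
        also have "\<dots> \<le> ennreal (2 * C) * H x" by (rule H(3)[OF elim(2)])
        finally show "avg M B (\<lambda>y. ennreal (weight_kernel V x y) * ennreal (a y)) \<le> ennreal (2 * (real d ^ 2 * \<kappa>)) * ennreal (a x)"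
          using elim by (simp add: C_def)
      qed
    qed
  qed
qed

end

section \<open>Scalar multiples of a matrix weight\<close>

lemma esssup_on_le:
  assumes B: "B \<in> sets M" and h: "h \<in> borel_measurable M" and le: "AE x in M. x \<in> B \<longrightarrow> h x \<le> c"
  shows "esssup_on M B h \<le> c"
  unfolding esssup_on_def
proof (rule esssup_I)
  show "h \<in> borel_measurable (restrict_space M B)" using h by (rule measurable_restrict_space1)
  have "B \<inter> space M \<in> sets M" using B by auto
  then show "AE x in restrict_space M B. h x \<le> c"
    using le by (subst AE_restrict_space_iff) auto
qed

lemma A_const_null:
  assumes "\<And>B. B \<in> \<B> \<Longrightarrow> B \<in> null_sets (leb n)"
  shows "A_const n \<B> r W = 0"
proof -
  have "avg (leb n) B h = 0" if "B \<in> \<B>" for B h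
    using assms[OF that] by (rule avg_null)
  moreover have "esssup_on (leb n) B (\<lambda>x. 0) = 0" if "B \<in> \<B>" for B
    using esssup_on_le[of B "leb n" "\<lambda>_. 0 :: ennreal" 0] assms[OF that] by auto
  ultimately show ?thesis
    unfolding A_const_def Let_def
    by (cases "\<B> = {}") (auto simp: bot_ennreal cong: SUP_cong)
qed

text \<open>
  By definition the essential supremum of a nonmeasurable function is infinite, so that at the
  endpoints the inner average must be shown to be measurable.
\<close>

lemma avg_op_norm_measurable:
  fixes P Q :: "(nat \<Rightarrow> real) \<Rightarrow> real mat"
  assumes P: "\<And>x. x \<in> space (leb n) \<Longrightarrow> P x \<in> carrier_mat d d"
      "\<And>i j. i < d \<Longrightarrow> j < d \<Longrightarrow> (\<lambda>x. P x $$ (i, j)) \<in> borel_measurable (leb n)"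
    and Q: "\<And>x. x \<in> space (leb n) \<Longrightarrow> Q x \<in> carrier_mat d d"
      "\<And>i j. i < d \<Longrightarrow> j < d \<Longrightarrow> (\<lambda>x. Q x $$ (i, j)) \<in> borel_measurable (leb n)"
    and d: "0 < d" and [measurable]: "B \<in> sets (leb n)"
  shows "(\<lambda>x. avg (leb n) B (\<lambda>y. ennreal (op_norm (P x * Q y)))) \<in> borel_measurable (leb n)"
proof -
  interpret sigma_finite_measure "leb n" by (rule sigma_finite_leb)
  let ?P = "leb n \<Otimes>\<^sub>M leb n"
  have carrP: "P (fst z) \<in> carrier_mat d d" and carrQ: "Q (snd z) \<in> carrier_mat d d" if "z \<in> space ?P" for z
    using that P(1) Q(1) by (auto simp: space_pair_measure)
  have measP: "(\<lambda>z. P (fst z) $$ (i, j)) \<in> borel_measurable ?P" and measQ: "(\<lambda>z. Q (snd z) $$ (i, j)) \<in> borel_measurable ?P"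
    if "i < d" "j < d" for i j
    using measurable_compose[OF measurable_fst P(2)[OF that]] measurable_compose[OF measurable_snd Q(2)[OF that]] by auto
  have [measurable]: "(\<lambda>z. op_norm (P (fst z) * Q (snd z))) \<in> borel_measurable ?P"
  proof (rule borel_measurable_op_norm[OF _ _ d])
    show "P (fst z) * Q (snd z) \<in> carrier_mat d d" if "z \<in> space ?P" for z
      using carrP[OF that] carrQ[OF that] by (rule square_closed)
    show "(\<lambda>z. (P (fst z) * Q (snd z)) $$ (i, j)) \<in> borel_measurable ?P" if "i < d" "j < d" for i j
      by (rule borel_measurable_mult_mat[OF carrP measP carrQ measQ that])
  qed
  have "(\<lambda>x. \<integral>\<^sup>+y. ennreal (op_norm (P x * Q y)) * indicator B y \<partial>leb n) \<in> borel_measurable (leb n)"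
  proof (rule borel_measurable_nn_integral)
    show "(\<lambda>(x, y). ennreal (op_norm (P x * Q y)) * indicator B y) \<in> borel_measurable ?P"
      unfolding case_prod_beta' by measurable
  qed
  then show ?thesis unfolding avg_def by measurable
qed

text \<open>
  The inequalities for \<open>a\<close> and \<open>b\<close> say that \<open>a V\<close> is an \<open>A_1\<close> weight with constant \<open>c1\<close>, and that
  \<open>b^-1 V\<close> is an \<open>A_\<infinity>\<close> weight with constant \<open>c2\<close>; \<open>V0\<close> is their geometric mean with weights
  \<open>i0 = 1 / r0\<close> and \<open>1 - i0\<close>.
\<close>

locale factored_weight =
  fixes n d :: nat and \<B> :: "(nat \<Rightarrow> real) set set" and V Vi V0 :: "(nat \<Rightarrow> real) \<Rightarrow> real mat"
    and a b :: "(nat \<Rightarrow> real) \<Rightarrow> real" and c1 c2 i0 :: real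
  assumes d: "0 < d" and sets: "\<And>B. B \<in> \<B> \<Longrightarrow> B \<in> sets (leb n)" "\<And>B. B \<in> \<B> \<Longrightarrow> emeasure (leb n) B < top"
    and V_weight: "matrix_weight n d V" and V0_weight: "matrix_weight n d V0"
    and Vi: "AE x in leb n. Vi x = minv (V x)"
    and a_meas [measurable]: "a \<in> borel_measurable (leb n)" and b_meas [measurable]: "b \<in> borel_measurable (leb n)"
    and a0: "\<And>x. 0 < a x" and b0: "\<And>x. 0 < b x" and c1: "0 < c1" and c2: "0 < c2"
    and a_A1: "AE x in leb n. \<forall>B\<in>\<B>. x \<in> B \<longrightarrow> avg (leb n) B (\<lambda>y. ennreal (weight_kernel Vi x y) * ennreal (a y)) \<le> ennreal c1 * ennreal (a x)"
    and b_A1: "AE x in leb n. \<forall>B\<in>\<B>. x \<in> B \<longrightarrow> avg (leb n) B (\<lambda>y. ennreal (weight_kernel V x y) * ennreal (b y)) \<le> ennreal c2 * ennreal (b x)"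
    and i0: "0 \<le> i0" "i0 \<le> 1"
    and V0: "\<And>x. x \<in> space (leb n) \<Longrightarrow> V0 x = (a x powr i0 * b x powr (- (1 - i0))) \<cdot>\<^sub>m V x"
begin

abbreviation "M \<equiv> leb n"

lemmas V_carrier = matrix_weightD(2)[OF V_weight]
lemmas V_sym = matrix_weightD(3)[OF V_weight]
lemmas V_inv = matrix_weightD(5)[OF V_weight]

definition w :: "(nat \<Rightarrow> real) \<Rightarrow> real" where "w x = a x powr i0 * b x powr (- (1 - i0))"

lemma w_pos: "0 < w x"
  using a0[of x] b0[of x] by (simp add: w_def)

lemma V0_eq: "x \<in> space M \<Longrightarrow> V0 x = w x \<cdot>\<^sub>m V x"
  by (simp add: V0 w_def)

lemma kernel_nonneg: "x \<in> space M \<Longrightarrow> y \<in> space M \<Longrightarrow> 0 \<le> weight_kernel V x y"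
  unfolding weight_kernel_def by (intro op_norm_nonneg[OF square_closed(1)[of _ d] d] V_carrier minv_carrier)

lemma kernel_V0:
  assumes "x \<in> space M" "y \<in> space M" "invertible_mat (V y)"
  shows "weight_kernel V0 x y = w x / w y * weight_kernel V x y"
proof -
  note Vx = V_carrier[OF assms(1)] and Vy = V_carrier[OF assms(2)]
  have "V0 x * minv (V0 y) = (w x \<cdot>\<^sub>m V x) * (inverse (w y) \<cdot>\<^sub>m minv (V y))"
    using w_pos[of y] by (simp add: V0_eq[OF assms(1)] V0_eq[OF assms(2)] minv_smult[OF Vy _ assms(3)])
  also have "\<dots> = (w x * inverse (w y)) \<cdot>\<^sub>m (V x * minv (V y))"
    by (rule smult_mult_smult_mat[OF Vx minv_carrier[OF Vy]])
  finally show ?thesis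
    unfolding weight_kernel_def using w_pos[of x] w_pos[of y] square_closed(1)[OF Vx minv_carrier[OF Vy]]
    by (simp add: op_norm_smult[OF _ d] divide_inverse)
qed

lemma kernel_V0':
  assumes "x \<in> space M" "y \<in> space M" "invertible_mat (V x)"
  shows "op_norm (minv (V0 x) * V0 y) = w y / w x * weight_kernel V y x"
proof -
  note Vx = V_carrier[OF assms(1)] and Vy = V_carrier[OF assms(2)]
  have "minv (V0 x) * V0 y = (inverse (w x) \<cdot>\<^sub>m minv (V x)) * (w y \<cdot>\<^sub>m V y)"
    using w_pos[of x] by (simp add: V0_eq[OF assms(1)] V0_eq[OF assms(2)] minv_smult[OF Vx _ assms(3)])
  also have "\<dots> = (inverse (w x) * w y) \<cdot>\<^sub>m (minv (V x) * V y)"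
    by (rule smult_mult_smult_mat[OF minv_carrier[OF Vx] Vy])
  finally show ?thesis
    unfolding weight_kernel_def using w_pos[of x] w_pos[of y] square_closed(1)[OF minv_carrier[OF Vx] Vy]
      op_norm_minv_mult[OF Vx V_sym[OF assms(1)] assms(3) Vy V_sym[OF assms(2)] d]
    by (simp add: op_norm_smult[OF _ d] divide_inverse mult.commute)
qed

text \<open>
  Transposition exchanges the roles of the two points.
\<close>

lemma a_A1': "AE y in M. \<forall>B\<in>\<B>. y \<in> B \<longrightarrow> avg M B (\<lambda>x. ennreal (a x) * ennreal (weight_kernel V x y)) \<le> ennreal (c1 * a y)"
  using a_A1 Vi V_inv AE_space
proof eventually_elim
  case (elim y)
  have "avg M B (\<lambda>x. ennreal (a x) * ennreal (weight_kernel V x y)) = avg M B (\<lambda>x. ennreal (weight_kernel Vi y x) * ennreal (a x))" for B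
  proof (rule avg_cong_AE)
    show "AE x in M. x \<in> B \<longrightarrow> ennreal (a x) * ennreal (weight_kernel V x y) = ennreal (weight_kernel Vi y x) * ennreal (a x)"
      using Vi V_inv AE_space
    proof eventually_elim
      case (elim x)
      have "weight_kernel Vi y x = op_norm (minv (V y) * V x)"
        unfolding weight_kernel_def using elim \<open>Vi y = minv (V y)\<close> minv_minv[OF V_carrier[OF elim(3)] elim(2)] by simp
      also have "\<dots> = weight_kernel V x y"
        unfolding weight_kernel_def
        using op_norm_minv_mult[OF V_carrier V_sym _ V_carrier V_sym d] elim \<open>invertible_mat (V y)\<close> \<open>y \<in> space M\<close> by blast
      finally show ?case by (simp add: mult.commute)
    qed
  qed
  with elim show ?case using c1 a0[of y] by (simp add: ennreal_mult)
qed

text \<open>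
  The reducing basis of the norm \<open>avg_B a |V v|\<close> bounds \<open>|V(x) V(y)^-1|\<close> by \<open>2 \<alpha>(x)\<close> times the average of
  \<open>a |V V(y)^-1|\<close>, and the latter is at most \<open>c1 a(y)\<close>.
\<close>

lemma kernel_factorization:
  assumes B: "B \<in> \<B>" "emeasure M B \<noteq> 0"
  obtains \<alpha> :: "(nat \<Rightarrow> real) \<Rightarrow> real" where "\<alpha> \<in> borel_measurable M" "\<And>x. 0 \<le> \<alpha> x"
    "\<And>x. x \<in> space M \<Longrightarrow> AE y in M. y \<in> B \<longrightarrow> weight_kernel V x y \<le> 2 * c1 * a y * \<alpha> x"
    "avg M B (\<lambda>x. ennreal (a x * \<alpha> x)) \<le> ennreal (real d)"
proof -
  have Bs: "B \<in> sets M" "0 < emeasure M B" "emeasure M B < top"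
    using sets[OF B(1)] B(2) by (auto simp: zero_less_iff_neq_zero)
  have "avg M B (\<lambda>x. 0) < top" using Bs by (simp add: avg_const)
  from avg_finite_witness[OF Bs this AE_conjI[OF a_A1' AE_conjI[OF V_inv AE_space]]]
  obtain y0 where y0: "y0 \<in> B" "invertible_mat (V y0)" "y0 \<in> space M"
    "avg M B (\<lambda>x. ennreal (a x) * ennreal (weight_kernel V x y0)) \<le> ennreal (c1 * a y0)"
    using B(1) by blast
  note Vy0 = V_carrier[OF y0(3)]
  note in_basis = B(1)
  interpret average_norm M B d "\<lambda>x. a x \<cdot>\<^sub>m V x" 1
  proof
    show "a x \<cdot>\<^sub>m V x \<in> carrier_mat d d" if "x \<in> space M" for x using V_carrier[OF that] by simp
    show "(\<lambda>x. (a x \<cdot>\<^sub>m V x) $$ (i, j)) \<in> borel_measurable M" if "i < d" "j < d" for i j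
    proof -
      have "(\<lambda>x. a x * V x $$ (i, j)) \<in> borel_measurable M"
        using matrix_weightD(4)[OF V_weight that] by measurable
      moreover have "(a x \<cdot>\<^sub>m V x) $$ (i, j) = a x * V x $$ (i, j)" if "x \<in> space M" for x
        using V_carrier[OF that] \<open>i < d\<close> \<open>j < d\<close> by simp
      ultimately show ?thesis by (simp cong: measurable_cong)
    qed
    show "AE x in M. invertible_mat (a x \<cdot>\<^sub>m V x)"
      using V_inv AE_space
    proof eventually_elim
      case (elim x)
      then show ?case using V_carrier[OF elim(2)] a0[of x]
        by (simp add: invertible_mat_iff_det[of _ d])
    qed
    fix v :: "real vec" assume v: "v \<in> carrier_vec d"
    define z where "z = V y0 *\<^sub>v v"
    have z: "z \<in> carrier_vec d" using Vy0 v by (auto simp: z_def)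
    have "avg M B (\<lambda>x. epowr (ennreal (vnorm ((a x \<cdot>\<^sub>m V x) *\<^sub>v v))) 1)
      \<le> avg M B (\<lambda>x. ennreal (vnorm z) * (ennreal (a x) * ennreal (weight_kernel V x y0)))"
    proof (rule avg_mono_AE, rule AE_I2, rule impI)
      fix x assume x: "x \<in> space M"
      note Vx = V_carrier[OF x]
      have carr: "V x * minv (V y0) \<in> carrier_mat d d" using square_closed(1)[OF Vx minv_carrier[OF Vy0]] .
      have "v = minv (V y0) *\<^sub>v z"
        unfolding z_def using minv_left[OF Vy0 y0(2)] Vy0 v minv_carrier[OF Vy0]
        by (simp flip: assoc_mult_mat_vec[of _ d d _ d])
      then have "V x *\<^sub>v v = (V x * minv (V y0)) *\<^sub>v z"
        using Vx minv_carrier[OF Vy0] z by (simp add: assoc_mult_mat_vec[of _ d d _ d])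
      then have "vnorm ((a x \<cdot>\<^sub>m V x) *\<^sub>v v) = a x * vnorm ((V x * minv (V y0)) *\<^sub>v z)"
        using a0[of x] smult_mat_mult_mat_vec[OF Vx v, of "a x"] by (simp add: vnorm_smult)
      also have "\<dots> \<le> a x * (weight_kernel V x y0 * vnorm z)"
        unfolding weight_kernel_def using a0[of x] by (intro mult_left_mono vnorm_mult_mat_vec_le[OF carr z]) auto
      finally have "ennreal (vnorm ((a x \<cdot>\<^sub>m V x) *\<^sub>v v)) \<le> ennreal (vnorm z * (a x * weight_kernel V x y0))"
        by (intro ennreal_leI) (simp add: mult_ac)
      then show "epowr (ennreal (vnorm ((a x \<cdot>\<^sub>m V x) *\<^sub>v v))) 1 \<le> ennreal (vnorm z) * (ennreal (a x) * ennreal (weight_kernel V x y0))"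
        using a0[of x] by (simp add: ennreal_mult')
    qed
    also have "\<dots> \<le> ennreal (vnorm z) * avg M B (\<lambda>x. ennreal (a x) * ennreal (weight_kernel V x y0))"
      by (rule avg_cmult_le) simp
    also have "\<dots> \<le> ennreal (vnorm z) * ennreal (c1 * a y0)" by (intro mult_left_mono y0(4)) auto
    also have "\<dots> < top" by (simp add: ennreal_mult_less_top)
    finally show "avg M B (\<lambda>x. epowr (ennreal (vnorm ((a x \<cdot>\<^sub>m V x) *\<^sub>v v))) 1) < top" .
  qed (use Bs d in auto)
  obtain u where u: "\<And>i. i < d \<Longrightarrow> u i \<in> carrier_vec d" "\<And>i. i < d \<Longrightarrow> N (u i) \<le> 1"
    "\<And>C v. C \<in> carrier_mat d d \<Longrightarrow> v \<in> carrier_vec d \<Longrightarrow>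
      ennreal (vnorm (C *\<^sub>v v)) \<le> 2 * epowr (N v) (1 / 1) * ennreal (\<Sum>i<d. vnorm (C *\<^sub>v u i))"
    using reducing_basis by blast
  define \<alpha> where "\<alpha> = (\<lambda>x. \<Sum>i<d. vnorm (V x *\<^sub>v u i))"
  have \<alpha>0: "0 \<le> \<alpha> x" for x unfolding \<alpha>_def by (intro sum_nonneg) auto
  have meas [measurable]: "(\<lambda>x. vnorm (V x *\<^sub>v u i)) \<in> borel_measurable M" if "i < d" for i
    using u(1)[OF that] by (intro borel_measurable_vnorm_mult[OF V_carrier matrix_weightD(4)[OF V_weight]])
  show ?thesis
  proof (rule that[of \<alpha>])
    show "\<alpha> \<in> borel_measurable M" unfolding \<alpha>_def by measurable
    show "0 \<le> \<alpha> x" for x by (rule \<alpha>0)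
    show "AE y in M. y \<in> B \<longrightarrow> weight_kernel V x y \<le> 2 * c1 * a y * \<alpha> x" if x: "x \<in> space M" for x
      using a_A1' AE_space
    proof eventually_elim
      case (elim y)
      note Vx = V_carrier[OF x] and Vy = V_carrier[OF elim(2)]
      show ?case
      proof
        assume y: "y \<in> B"
        have "avg M B (\<lambda>z. epowr (ennreal (op_norm ((a z \<cdot>\<^sub>m V z) * minv (V y)))) 1)
          = avg M B (\<lambda>z. ennreal (a z) * ennreal (weight_kernel V z y))"
        proof (rule avg_cong_AE, rule AE_I2, rule impI)
          fix z assume z: "z \<in> space M"
          have "(a z \<cdot>\<^sub>m V z) * minv (V y) = a z \<cdot>\<^sub>m (V z * minv (V y))"
            using V_carrier[OF z] minv_carrier[OF Vy] by (intro mult_smult_assoc_mat[of _ d d _ d]) auto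
          then show "epowr (ennreal (op_norm ((a z \<cdot>\<^sub>m V z) * minv (V y)))) 1 = ennreal (a z) * ennreal (weight_kernel V z y)"
            using op_norm_smult[OF square_closed(1)[OF V_carrier[OF z] minv_carrier[OF Vy]] d, of "a z"] a0[of z]
            by (simp add: weight_kernel_def ennreal_mult')
        qed
        also have "\<dots> \<le> ennreal (c1 * a y)" by (rule elim(1)[rule_format, OF in_basis y])
        finally have le: "avg M B (\<lambda>z. epowr (ennreal (op_norm ((a z \<cdot>\<^sub>m V z) * minv (V y)))) 1) \<le> ennreal (c1 * a y)" .
        have "ennreal (weight_kernel V x y) \<le> 2 * avg M B (\<lambda>z. epowr (ennreal (op_norm ((a z \<cdot>\<^sub>m V z) * minv (V y)))) 1) * ennreal (\<alpha> x)"
          unfolding weight_kernel_def \<alpha>_def using op_norm_mult_le[OF u(1,3) Vx minv_carrier[OF Vy]] by simp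
        also have "\<dots> \<le> 2 * ennreal (c1 * a y) * ennreal (\<alpha> x)"
          by (intro mult_right_mono mult_left_mono le) auto
        also have "\<dots> = ennreal (2 * c1 * a y * \<alpha> x)"
          using c1 a0[of y] \<alpha>0[of x] by (simp add: ennreal_mult mult.assoc)
        finally show "weight_kernel V x y \<le> 2 * c1 * a y * \<alpha> x"
          using c1 a0[of y] \<alpha>0[of x] by (subst (asm) ennreal_le_iff) auto
      qed
    qed
    have "avg M B (\<lambda>x. ennreal (a x * \<alpha> x)) = avg M B (\<lambda>x. \<Sum>i<d. ennreal (a x) * ennreal (vnorm (V x *\<^sub>v u i)))"
    proof -
      have "ennreal (a x * \<alpha> x) = (\<Sum>i<d. ennreal (a x) * ennreal (vnorm (V x *\<^sub>v u i)))" for x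
      proof -
        have "ennreal (a x * \<alpha> x) = ennreal (a x) * ennreal (\<alpha> x)"
          using a0[of x] by (intro ennreal_mult') simp
        also have "ennreal (\<alpha> x) = (\<Sum>i<d. ennreal (vnorm (V x *\<^sub>v u i)))"
          unfolding \<alpha>_def by (rule sum_ennreal[symmetric]) simp
        finally show ?thesis by (simp only: sum_distrib_left)
      qed
      then show ?thesis by (simp only:)
    qed
    also have "\<dots> = (\<Sum>i<d. avg M B (\<lambda>x. ennreal (a x) * ennreal (vnorm (V x *\<^sub>v u i))))"
      using Bs(1) by (intro avg_sum) auto
    also have "\<dots> \<le> (\<Sum>i<d. 1)"
    proof (rule sum_mono)
      fix i assume "i \<in> {..<d}"
      then have i: "i < d" by simp
      have "avg M B (\<lambda>x. ennreal (a x) * ennreal (vnorm (V x *\<^sub>v u i))) = N (u i)"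
        unfolding N_def
      proof (rule avg_cong_AE, rule AE_I2, rule impI)
        fix x assume x: "x \<in> space M"
        show "ennreal (a x) * ennreal (vnorm (V x *\<^sub>v u i)) = epowr (ennreal (vnorm ((a x \<cdot>\<^sub>m V x) *\<^sub>v u i))) 1"
          using smult_mat_mult_mat_vec[OF V_carrier[OF x] u(1)[OF i], of "a x"] a0[of x]
          by (simp add: vnorm_smult ennreal_mult)
      qed
      with u(2)[OF i] show "avg M B (\<lambda>x. ennreal (a x) * ennreal (vnorm (V x *\<^sub>v u i))) \<le> 1" by simp
    qed
    finally show "avg M B (\<lambda>x. ennreal (a x * \<alpha> x)) \<le> ennreal (real d)"
      by (simp add: ennreal_of_nat_eq_real_of_nat)
  qed
qed

definition R :: real where "R = 2 * real d * (c1 powr i0 * c2 powr (1 - i0))"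

lemma A_const_one:
  assumes "i0 = 1"
  shows "A_const n \<B> 1 V0 \<le> ennreal R"
proof -
  have wa: "w x = a x" for x unfolding w_def[of x] unfolding assms using a0[of x] b0[of x] by simp
  have "esssup_on M B (\<lambda>x. avg M B (\<lambda>y. ennreal (op_norm (minv (V0 x) * V0 y)))) \<le> ennreal R" if B: "B \<in> \<B>" for B
  proof (rule esssup_on_le)
    show "B \<in> sets M" by (rule sets(1)[OF B])
    then show "(\<lambda>x. avg M B (\<lambda>y. ennreal (op_norm (minv (V0 x) * V0 y)))) \<in> borel_measurable M"
      by (intro avg_op_norm_measurable[of _ _ d] minv_carrier borel_measurable_minv[of _ _ d]
          matrix_weightD(2,4)[OF V0_weight] d) auto
    show "AE x in M. x \<in> B \<longrightarrow> avg M B (\<lambda>y. ennreal (op_norm (minv (V0 x) * V0 y))) \<le> ennreal R"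
      using a_A1' V_inv AE_space
    proof eventually_elim
      case (elim x)
      show ?case
      proof
        assume "x \<in> B"
        have "avg M B (\<lambda>y. ennreal (op_norm (minv (V0 x) * V0 y)))
          = avg M B (\<lambda>y. ennreal (1 / a x) * (ennreal (a y) * ennreal (weight_kernel V y x)))"
        proof (rule avg_cong_AE, rule AE_I2, rule impI)
          fix y assume y: "y \<in> space M"
          have "a y / a x * weight_kernel V y x = 1 / a x * (a y * weight_kernel V y x)" by simp
          then show "ennreal (op_norm (minv (V0 x) * V0 y)) = ennreal (1 / a x) * (ennreal (a y) * ennreal (weight_kernel V y x))"
            using kernel_V0'[OF elim(3) y elim(2)] kernel_nonneg[OF y elim(3)] a0[of x] a0[of y]
            by (simp only: wa ennreal_mult'[symmetric] less_imp_le divide_nonneg_nonneg zero_le_one mult_nonneg_nonneg)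
        qed
        also have "\<dots> \<le> ennreal (1 / a x) * avg M B (\<lambda>y. ennreal (a y) * ennreal (weight_kernel V y x))"
          by (rule avg_cmult_le) simp
        also have "\<dots> \<le> ennreal (1 / a x) * ennreal (c1 * a x)"
          using elim(1) B \<open>x \<in> B\<close> by (intro mult_left_mono) auto
        also have "\<dots> = ennreal c1" using a0[of x] c1 by (simp flip: ennreal_mult)
        also have "\<dots> \<le> ennreal R"
          unfolding R_def unfolding assms
          using c1 c2 d mult_right_mono[of 1 "2 * real d" c1] by (intro ennreal_leI) simp
        finally show "avg M B (\<lambda>y. ennreal (op_norm (minv (V0 x) * V0 y))) \<le> ennreal R" .
      qed
    qed
  qed
  then show ?thesis unfolding A_const_def by (auto intro: SUP_least)
qed

lemma A_const_infinity:
  assumes "i0 = 0"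
  shows "A_const n \<B> \<infinity> V0 \<le> ennreal R"
proof -
  have wb: "w x = 1 / b x" for x
    unfolding w_def[of x] unfolding assms using a0[of x] b0[of x] by (simp add: powr_minus divide_inverse)
  have "esssup_on M B (\<lambda>x. avg M B (\<lambda>y. ennreal (op_norm (V0 x * minv (V0 y))))) \<le> ennreal R" if B: "B \<in> \<B>" for B
  proof (rule esssup_on_le)
    show "B \<in> sets M" by (rule sets(1)[OF B])
    then show "(\<lambda>x. avg M B (\<lambda>y. ennreal (op_norm (V0 x * minv (V0 y))))) \<in> borel_measurable M"
      by (intro avg_op_norm_measurable[of _ _ d] minv_carrier borel_measurable_minv[of _ _ d]
          matrix_weightD(2,4)[OF V0_weight] d) auto
    show "AE x in M. x \<in> B \<longrightarrow> avg M B (\<lambda>y. ennreal (op_norm (V0 x * minv (V0 y)))) \<le> ennreal R"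
      using b_A1 AE_space
    proof eventually_elim
      case (elim x)
      show ?case
      proof
        assume "x \<in> B"
        have "avg M B (\<lambda>y. ennreal (op_norm (V0 x * minv (V0 y))))
          = avg M B (\<lambda>y. ennreal (1 / b x) * (ennreal (weight_kernel V x y) * ennreal (b y)))"
        proof (rule avg_cong_AE)
          show "AE y in M. y \<in> B \<longrightarrow> ennreal (op_norm (V0 x * minv (V0 y))) = ennreal (1 / b x) * (ennreal (weight_kernel V x y) * ennreal (b y))"
            using V_inv AE_space
          proof eventually_elim
            case (elim y)
            have "op_norm (V0 x * minv (V0 y)) = 1 / b x * (weight_kernel V x y * b y)"
              using kernel_V0[OF \<open>x \<in> space M\<close> elim(2,1)] by (simp add: weight_kernel_def wb)
            then show ?case
              using kernel_nonneg[OF \<open>x \<in> space M\<close> elim(2)] b0[of x] b0[of y]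
              by (simp only: ennreal_mult[symmetric] less_imp_le divide_nonneg_nonneg zero_le_one mult_nonneg_nonneg simp_thms)
          qed
        qed
        also have "\<dots> \<le> ennreal (1 / b x) * avg M B (\<lambda>y. ennreal (weight_kernel V x y) * ennreal (b y))"
          by (rule avg_cmult_le) simp
        also have "\<dots> \<le> ennreal (1 / b x) * (ennreal c2 * ennreal (b x))"
          using elim(1) B \<open>x \<in> B\<close> by (intro mult_left_mono) auto
        also have "\<dots> = ennreal c2" using b0[of x] c2 by (simp flip: ennreal_mult)
        also have "\<dots> \<le> ennreal R"
          unfolding R_def unfolding assms
          using c1 c2 d mult_right_mono[of 1 "2 * real d" c2] by (intro ennreal_leI) simp
        finally show "avg M B (\<lambda>y. ennreal (op_norm (V0 x * minv (V0 y)))) \<le> ennreal R" .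
      qed
    qed
  qed
  then show ?thesis unfolding A_const_def by (auto intro: SUP_least)
qed

text \<open>
  Of the \<open>1 + e\<close> factors \<open>k\<close>, all but one are estimated by \<open>2 c1 a(y) \<alpha>(x)\<close>.  This cancels the negative
  power of \<open>a(y)\<close>, and the remaining \<open>k b(y)\<close> is of the form that the condition on \<open>b\<close> controls.
\<close>

lemma interior_pointwise:
  fixes t e ax ay bx by' k \<alpha> :: real
  assumes "1 < t" "e = 1 / (t - 1)" "0 < ax" "0 < ay" "0 < bx" "0 < by'" "0 \<le> \<alpha>" "0 \<le> k" "k \<le> 2 * c1 * ay * \<alpha>"
  shows "(ax powr (1 / t) * bx powr (- (1 - 1 / t)) / (ay powr (1 / t) * by' powr (- (1 - 1 / t))) * k) powr (t / (t - 1))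
    \<le> (ax powr e * inverse bx * (2 * c1 * \<alpha>) powr e) * (k * by')"
proof -
  have e: "0 < e" using assms(1,2) by simp
  have e': "1 / t * (t / (t - 1)) = e" "(1 - 1 / t) * (t / (t - 1)) = 1" "t / (t - 1) = 1 + e"
    using assms(1) unfolding assms(2) by (auto simp: field_simps)
  have split: "(ax powr (1 / t) * bx powr (- (1 - 1 / t)) / (ay powr (1 / t) * by' powr (- (1 - 1 / t))) * k) powr (t / (t - 1))
     = ax powr e * inverse bx / (ay powr e * inverse by') * k powr (1 + e)"
  proof -
    have "(x powr (1 / t)) powr (t / (t - 1)) = x powr e" for x :: real
      unfolding powr_powr e'(1) ..
    moreover have "(x powr (- (1 - 1 / t))) powr (t / (t - 1)) = inverse x" if "0 < x" for x :: real
      using that unfolding powr_powr minus_mult_left[symmetric] e'(2) by (simp add: powr_minus)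
    moreover note assms(5,6)
    ultimately show ?thesis
      by (simp only: powr_mult powr_divide) (simp only: e'(3))
  qed
  have "k powr (1 + e) = k * k powr e"
    using assms(8) by (cases "k = 0") (auto simp: powr_add)
  also have "\<dots> \<le> k * ((2 * c1 * \<alpha>) * ay) powr e"
    using assms e by (intro mult_left_mono powr_mono2) (auto simp: mult_ac)
  also have "\<dots> = k * ((2 * c1 * \<alpha>) powr e * ay powr e)" by (simp add: powr_mult)
  finally have "ax powr e * inverse bx / (ay powr e * inverse by') * k powr (1 + e)
     \<le> ax powr e * inverse bx / (ay powr e * inverse by') * (k * ((2 * c1 * \<alpha>) powr e * ay powr e))"
    using assms by (intro mult_left_mono) auto
  also have "\<dots> = (ax powr e * inverse bx * (2 * c1 * \<alpha>) powr e) * (k * by')"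
    using assms by (simp add: field_simps)
  finally show ?thesis unfolding split .
qed

text \<open>
  After \<open>interior_pointwise\<close>, the condition on \<open>b\<close> bounds the inner average by
  \<open>c2 (2 c1 a(x) \<alpha>(x))^e\<close>, since the powers of \<open>b(x)\<close> cancel.  Raised to the power \<open>t - 1 = 1 / e\<close>, it
  is linear in \<open>a \<alpha>\<close>, whose average is at most \<open>d\<close>.
\<close>

lemma A_const_interior:
  assumes t: "1 < t" and i0t: "i0 = 1 / t"
  shows "A_const n \<B> (ereal t) V0 \<le> ennreal R"
proof -
  define t' where "t' = t / (t - 1)"
  define e where "e = 1 / (t - 1)"
  have tt': "t / t' = t - 1" and e0: "e * (t - 1) = 1"
    using t by (auto simp: t'_def e_def)
  let ?inner = "\<lambda>B x. avg M B (\<lambda>y. epowr (ennreal (weight_kernel V0 x y)) t')"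
  have A: "A_const n \<B> (ereal t) V0 = (SUP B\<in>\<B>. epowr (avg M B (\<lambda>x. epowr (?inner B x) (t / t'))) (1 / t))"
    using t by (simp add: A_const_def conj_exp_ereal Let_def t'_def weight_kernel_def one_ereal_def)
  have "epowr (avg M B (\<lambda>x. epowr (?inner B x) (t / t'))) (1 / t) \<le> ennreal R"
    if B: "B \<in> \<B>" for B
  proof (cases "emeasure M B = 0")
    case True
    then have "B \<in> null_sets M" using sets[OF B] by auto
    then show ?thesis by (simp add: avg_null)
  next
    case False
    note [measurable] = sets(1)[OF B]
    obtain \<alpha> where [measurable]: "\<alpha> \<in> borel_measurable M" and \<alpha>0: "\<And>x. 0 \<le> \<alpha> x"
      and \<alpha>: "\<And>x. x \<in> space M \<Longrightarrow> AE y in M. y \<in> B \<longrightarrow> weight_kernel V x y \<le> 2 * c1 * a y * \<alpha> x"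
      and avg\<alpha>: "avg M B (\<lambda>x. ennreal (a x * \<alpha> x)) \<le> ennreal (real d)"
      by (rule kernel_factorization[OF B False], rule that)
    have "avg M B (\<lambda>x. epowr (?inner B x) (t / t'))
      \<le> avg M B (\<lambda>x. ennreal (c2 powr (t - 1) * (2 * c1)) * ennreal (a x * \<alpha> x))"
    proof (rule avg_mono_AE)
      show "AE x in M. x \<in> B \<longrightarrow> epowr (?inner B x) (t / t')
        \<le> ennreal (c2 powr (t - 1) * (2 * c1)) * ennreal (a x * \<alpha> x)"
        using b_A1 AE_space
      proof eventually_elim
        case (elim x)
        show ?case
        proof
          assume x: "x \<in> B"
          define C where "C = a x powr e * inverse (b x) * (2 * c1 * \<alpha> x) powr e"
          have C0: "0 \<le> C" using b0[of x] by (simp add: C_def)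
          have "?inner B x
            \<le> avg M B (\<lambda>y. ennreal C * (ennreal (weight_kernel V x y) * ennreal (b y)))"
          proof (rule avg_mono_AE)
            show "AE y in M. y \<in> B \<longrightarrow> epowr (ennreal (weight_kernel V0 x y)) t' \<le> ennreal C * (ennreal (weight_kernel V x y) * ennreal (b y))"
              using \<alpha>[OF elim(2)] V_inv AE_space
            proof eventually_elim
              case (elim y)
              show ?case
              proof
                assume "y \<in> B"
                then have k: "weight_kernel V x y \<le> 2 * c1 * a y * \<alpha> x" using elim(1) by simp
                note k0 = kernel_nonneg[OF \<open>x \<in> space M\<close> elim(3)]
                have kV0: "weight_kernel V0 x y = w x / w y * weight_kernel V x y" by (rule kernel_V0[OF \<open>x \<in> space M\<close> elim(3,2)])
                have "0 \<le> weight_kernel V0 x y" unfolding kV0 using w_pos[of x] w_pos[of y] k0 by simp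
                then have "epowr (ennreal (weight_kernel V0 x y)) t' = ennreal ((w x / w y * weight_kernel V x y) powr t')"
                  by (simp add: epowr_ennreal kV0)
                also have "\<dots> \<le> ennreal (C * (weight_kernel V x y * b y))"
                  unfolding C_def w_def unfolding i0t t'_def
                  by (intro ennreal_leI interior_pointwise[OF t e_def a0 a0 b0 b0 \<alpha>0 k0 k])
                also have "\<dots> = ennreal C * (ennreal (weight_kernel V x y) * ennreal (b y))"
                  using C0 k0 b0[of y] by (simp add: ennreal_mult)
                finally show "epowr (ennreal (weight_kernel V0 x y)) t' \<le> ennreal C * (ennreal (weight_kernel V x y) * ennreal (b y))" .
              qed
            qed
          qed
          also have "\<dots> \<le> ennreal C * avg M B (\<lambda>y. ennreal (weight_kernel V x y) * ennreal (b y))"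
            by (rule avg_cmult_le) simp
          also have "\<dots> \<le> ennreal C * (ennreal c2 * ennreal (b x))"
            using elim(1) B x by (intro mult_left_mono) auto
          also have "\<dots> = ennreal (c2 * (2 * c1 * (a x * \<alpha> x)) powr e)"
          proof -
            have "(2 * c1 * (a x * \<alpha> x)) powr e = a x powr e * (2 * c1 * \<alpha> x) powr e"
              by (simp add: powr_mult mult_ac)
            then have "C * (c2 * b x) = c2 * (2 * c1 * (a x * \<alpha> x)) powr e"
              using b0[of x] by (simp add: C_def)
            then show ?thesis using C0 c2 b0[of x] by (simp flip: ennreal_mult)
          qed
          finally have "epowr (?inner B x) (t / t') \<le> epowr (ennreal (c2 * (2 * c1 * (a x * \<alpha> x)) powr e)) (t - 1)"
            unfolding tt' using t by (intro epowr_mono) auto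
          also have "\<dots> = ennreal (c2 powr (t - 1) * (2 * c1 * (a x * \<alpha> x)))"
          proof -
            have "((2 * c1 * (a x * \<alpha> x)) powr e) powr (t - 1) = 2 * c1 * (a x * \<alpha> x)"
              unfolding powr_powr e0 using c1 a0[of x] \<alpha>0[of x] by simp
            then show ?thesis using c2 by (simp add: epowr_ennreal powr_mult)
          qed
          finally show "epowr (?inner B x) (t / t')
            \<le> ennreal (c2 powr (t - 1) * (2 * c1)) * ennreal (a x * \<alpha> x)"
            using c1 c2 a0[of x] \<alpha>0[of x] by (simp add: mult.assoc flip: ennreal_mult)
        qed
      qed
    qed
    also have "\<dots> \<le> ennreal (c2 powr (t - 1) * (2 * c1)) * avg M B (\<lambda>x. ennreal (a x * \<alpha> x))"
      by (rule avg_cmult_le) simp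
    also have "\<dots> \<le> ennreal (c2 powr (t - 1) * (2 * c1)) * ennreal (real d)"
      by (intro mult_left_mono avg\<alpha>) auto
    also have "\<dots> = ennreal (2 * real d * (c1 * c2 powr (t - 1)))"
      using c1 by (simp add: mult_ac flip: ennreal_mult)
    finally have "epowr (avg M B (\<lambda>x. epowr (?inner B x) (t / t'))) (1 / t)
      \<le> epowr (ennreal (2 * real d * (c1 * c2 powr (t - 1)))) (1 / t)"
      using t by (intro epowr_mono) auto
    also have "\<dots> = ennreal ((2 * real d) powr (1 / t) * (c1 powr i0 * c2 powr (1 - i0)))"
    proof -
      have "(t - 1) * (1 / t) = 1 - i0" using t by (simp add: i0t field_simps)
      then have "(c2 powr (t - 1)) powr (1 / t) = c2 powr (1 - i0)" unfolding powr_powr by simp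
      then show ?thesis using c1 c2 by (simp add: epowr_ennreal powr_mult i0t)
    qed
    also have "\<dots> \<le> ennreal R"
    proof -
      have "(2 * real d) powr (1 / t) \<le> 2 * real d"
        using powr_mono[of "1 / t" 1 "2 * real d"] t d by simp
      then show ?thesis unfolding R_def by (intro ennreal_leI mult_right_mono) auto
    qed
    finally show ?thesis .
  qed
  then show ?thesis unfolding A by (rule SUP_least)
qed

end

section \<open>Extrapolation\<close>

lemma borel_measurable_completion_AE_eq:
  assumes g: "g \<in> borel_measurable (completion N)" and eq: "AE x in completion N. f x = g x"
  shows "f \<in> borel_measurable (completion N)"
proof (rule borel_measurableI)
  fix S :: "'b set" assume S: "open S"
  have AE: "AE x in N. f x = g x" using eq by (simp add: AE_completion_iff)
  have "Measurable.pred (completion N) (\<lambda>x. f x \<in> S \<and> f x \<noteq> g x)" "Measurable.pred (completion N) (\<lambda>x. g x \<in> S \<and> f x \<noteq> g x)"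
    using AE by (auto intro!: sets_completion_AE elim: eventually_mono)
  moreover have "Measurable.pred (completion N) (\<lambda>x. g x \<in> S)"
    using measurable_sets[OF g, of S] S by (simp add: pred_def vimage_def Int_def conj_commute)
  moreover have "Measurable.pred (completion N) (\<lambda>x. P x \<or> R x \<and> \<not> Q x)"
    if "Measurable.pred (completion N) P" "Measurable.pred (completion N) Q" "Measurable.pred (completion N) R" for P Q R
    using that by (intro pred_intros_logic) auto
  ultimately have "Measurable.pred (completion N) (\<lambda>x. f x \<in> S \<and> f x \<noteq> g x \<or> g x \<in> S \<and> \<not> (g x \<in> S \<and> f x \<noteq> g x))"
    by blast
  also have "(\<lambda>x. f x \<in> S \<and> f x \<noteq> g x \<or> g x \<in> S \<and> \<not> (g x \<in> S \<and> f x \<noteq> g x)) = (\<lambda>x. f x \<in> S)" by auto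
  finally show "f -` S \<inter> space (completion N) \<in> sets (completion N)"
    by (simp add: pred_def vimage_def Int_def conj_commute)
qed

lemma matrix_weight_dual:
  assumes W: "matrix_weight n d W" and V: "matrix_weight n d (\<lambda>x. mat_powr (W x) s)"
  shows "AE x in leb n. mat_powr (W x) (- s) = minv (mat_powr (W x) s)"
    "matrix_weight n d (\<lambda>x. mat_powr (W x) (- s))"
proof -
  show AE: "AE x in leb n. mat_powr (W x) (- s) = minv (mat_powr (W x) s)"
    using matrix_weightD(5)[OF W] AE_space
    by eventually_elim (rule mat_powr_minus(2)[OF matrix_weightD(1)[OF W]])
  show "matrix_weight n d (\<lambda>x. mat_powr (W x) (- s))"
    unfolding matrix_weight_def
  proof (intro conjI ballI allI impI)
    show "mat_powr (W x) (- s) \<in> psd_mat d" if "x \<in> space (leb n)" for x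
      by (rule mat_powr_psd[OF matrix_weightD(1)[OF W that]])
    fix i j assume ij: "i < d" "j < d"
    have "(\<lambda>x. minv (mat_powr (W x) s) $$ (i, j)) \<in> borel_measurable (leb n)"
      by (rule borel_measurable_minv[OF matrix_weightD(2,4)[OF V] ij])
    moreover have "AE x in leb n. mat_powr (W x) (- s) $$ (i, j) = minv (mat_powr (W x) s) $$ (i, j)"
      using AE by eventually_elim simp
    ultimately show "(\<lambda>x. mat_powr (W x) (- s) $$ (i, j)) \<in> borel_measurable (leb n)"
      unfolding leb_def by (rule borel_measurable_completion_AE_eq)
  next
    show "AE x in leb n. invertible_mat (mat_powr (W x) (- s))"
      using matrix_weightD(5)[OF W] AE_space
      by eventually_elim (rule mat_powr_minus(1)[OF matrix_weightD(1)[OF W]])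
  qed
qed

lemma matrix_weight_scale:
  assumes V: "matrix_weight n d V" and w: "w \<in> borel_measurable (leb n)" "\<And>x. 0 < w x"
    and V0: "\<And>x. x \<in> space (leb n) \<Longrightarrow> V0 x = w x \<cdot>\<^sub>m V x"
  shows "matrix_weight n d V0"
  unfolding matrix_weight_def
proof (intro conjI ballI allI impI)
  fix x assume x: "x \<in> space (leb n)"
  note Vx = matrix_weightD(1-3)[OF V x]
  show "V0 x \<in> psd_mat d"
    unfolding V0[OF x] psd_mat_def
  proof (intro CollectI conjI ballI)
    show "transpose_mat (w x \<cdot>\<^sub>m V x) = w x \<cdot>\<^sub>m V x"
    proof -
      have "transpose_mat (w x \<cdot>\<^sub>m V x) = w x \<cdot>\<^sub>m transpose_mat (V x)" by (rule eq_matI) auto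
      then show ?thesis using Vx(3) by simp
    qed
    fix v :: "real vec" assume v: "v \<in> carrier_vec d"
    have "v \<bullet> ((w x \<cdot>\<^sub>m V x) *\<^sub>v v) = w x * (v \<bullet> (V x *\<^sub>v v))"
      using Vx(2) v by (simp add: smult_mat_mult_mat_vec[OF Vx(2) v])
    then show "0 \<le> v \<bullet> ((w x \<cdot>\<^sub>m V x) *\<^sub>v v)"
      using psd_matD(3)[OF Vx(1) v] w(2)[of x] by simp
  qed (use Vx in simp)
next
  fix i j assume ij: "i < d" "j < d"
  have "(\<lambda>x. w x * V x $$ (i, j)) \<in> borel_measurable (leb n)"
    using w(1) matrix_weightD(4)[OF V ij] by (intro borel_measurable_times)
  moreover have "V0 x $$ (i, j) = w x * V x $$ (i, j)" if "x \<in> space (leb n)" for x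
    using V0[OF that] matrix_weightD(2)[OF V that] ij by simp
  ultimately show "(\<lambda>x. V0 x $$ (i, j)) \<in> borel_measurable (leb n)"
    by (simp cong: measurable_cong)
next
  show "AE x in leb n. invertible_mat (V0 x)"
    using matrix_weightD(5)[OF V] AE_space
  proof eventually_elim
    case (elim x)
    then show ?case
      using matrix_weightD(2)[OF V elim(2)] w(2)[of x] by (simp add: V0 invertible_mat_iff_det[of _ d])
  qed
qed

lemma Lp_norm_cong:
  assumes "\<And>x. x \<in> space M \<Longrightarrow> h x = g x" and g: "g \<in> borel_measurable M"
  shows "Lp_norm M t h = Lp_norm M t g"
proof -
  have "h \<in> borel_measurable M" using g assms(1) by (simp cong: measurable_cong)
  then have "esssup M h = esssup M g"
    using assms by (intro esssup_AE_cong) auto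
  moreover have "(\<integral>\<^sup>+x. epowr (h x) (real_of_ereal t) \<partial>M) = (\<integral>\<^sup>+x. epowr (g x) (real_of_ereal t) \<partial>M)"
    using assms by (intro nn_integral_cong) simp
  ultimately show ?thesis by (simp add: Lp_norm_def)
qed

lemma weighted_vnorm_measurable:
  assumes "matrix_weight n d W" "vec_measurable n d f"
  shows "(\<lambda>x. vnorm (W x *\<^sub>v f x)) \<in> borel_measurable (leb n)"
  using assms(2)
  by (intro borel_measurable_vnorm[of _ _ d] borel_measurable_mult_mat_vec[OF matrix_weightD(2,4)[OF assms(1)]]
      mult_mat_vec_carrier[OF matrix_weightD(2)[OF assms(1)]]) (auto simp: vec_measurable_def)

text \<open>
  The norm is not zero because the weight is invertible almost everywhere.
\<close>

lemma weighted_norm_positive: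
  assumes W: "matrix_weight n d W" and f: "vec_measurable n d f" "\<not> (AE x in leb n. f x = 0\<^sub>v d)"
    and t: "0 < t" and fin: "weighted_norm n (ereal t) W f < top"
  obtains X where "0 < X" "weighted_norm n (ereal t) W f = ennreal X"
    "(\<integral>\<^sup>+x. ennreal (vnorm (W x *\<^sub>v f x) powr t) \<partial>leb n) = ennreal (X powr t)"
proof -
  define I where "I = (\<integral>\<^sup>+x. ennreal (vnorm (W x *\<^sub>v f x) powr t) \<partial>leb n)"
  note meas [measurable] = weighted_vnorm_measurable[OF W f(1)]
  have norm: "weighted_norm n (ereal t) W f = epowr I (1 / t)"
    by (simp add: weighted_norm_def Lp_norm_def I_def epowr_ennreal)
  have "I \<noteq> top" using fin by (auto simp: norm)
  moreover have "I \<noteq> 0"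
  proof
    assume "I = 0"
    then have "AE x in leb n. vnorm (W x *\<^sub>v f x) powr t = 0"
      unfolding I_def by (intro AE_ennreal_eq_0D) auto
    then have "AE x in leb n. f x = 0\<^sub>v d"
      using matrix_weightD(5)[OF W] AE_space
    proof eventually_elim
      case (elim x)
      note Wx = matrix_weightD(2)[OF W elim(3)]
      have fx: "f x \<in> carrier_vec d" using f(1) elim(3) by (simp add: vec_measurable_def)
      have "W x *\<^sub>v f x = 0\<^sub>v d"
        using elim(1) vnorm_eq_0[OF mult_mat_vec_carrier[OF Wx fx]] by simp
      then have "minv (W x) *\<^sub>v (W x *\<^sub>v f x) = 0\<^sub>v d" using minv_carrier[OF Wx] by auto
      moreover have "minv (W x) *\<^sub>v (W x *\<^sub>v f x) = f x"
        using minv_left[OF Wx elim(2)] minv_carrier[OF Wx] Wx fx by (simp flip: assoc_mult_mat_vec[of _ d d _ d])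
      ultimately show ?case by simp
    qed
    with f(2) show False by simp
  qed
  ultimately obtain z where z: "I = ennreal z" "0 < z" by (cases I) auto
  show ?thesis
  proof (rule that[of "z powr (1 / t)"])
    show "weighted_norm n (ereal t) W f = ennreal (z powr (1 / t))"
      using z by (simp add: norm epowr_ennreal)
    show "(\<integral>\<^sup>+x. ennreal (vnorm (W x *\<^sub>v f x) powr t) \<partial>leb n) = ennreal ((z powr (1 / t)) powr t)"
      using z t by (simp add: powr_powr flip: I_def)
  qed (use z in simp)
qed

lemma powr_sum3_le:
  fixes x y z t :: real
  assumes "0 \<le> x" "0 \<le> y" "0 \<le> z" "0 \<le> t"
  shows "(x + y + z) powr t \<le> 3 powr t * (x powr t + y powr t + z powr t)"
proof -
  define m where "m = max x (max y z)"
  have "(x + y + z) powr t \<le> (3 * m) powr t"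
    using assms by (intro powr_mono2) (auto simp: m_def)
  also have "\<dots> = 3 powr t * m powr t" by (simp add: powr_mult)
  also have "m powr t \<le> x powr t + y powr t + z powr t"
    by (auto simp: m_def max_def)
  finally show ?thesis by (simp add: mult_left_mono)
qed

lemma nn_integral_powr_sum3_le:
  fixes x y z :: "'a \<Rightarrow> real"
  assumes [measurable]: "x \<in> borel_measurable M" "y \<in> borel_measurable M" "z \<in> borel_measurable M"
    and nonneg: "\<And>\<xi>. 0 \<le> x \<xi>" "\<And>\<xi>. 0 \<le> y \<xi>" "\<And>\<xi>. 0 \<le> z \<xi>" and t: "0 \<le> t"
    and le: "(\<integral>\<^sup>+\<xi>. ennreal (x \<xi> powr t) \<partial>M) \<le> 1" "(\<integral>\<^sup>+\<xi>. ennreal (y \<xi> powr t) \<partial>M) \<le> 1" "(\<integral>\<^sup>+\<xi>. ennreal (z \<xi> powr t) \<partial>M) \<le> 1"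
  shows "(\<integral>\<^sup>+\<xi>. ennreal ((x \<xi> + y \<xi> + z \<xi>) powr t) \<partial>M) \<le> ennreal (3 * 3 powr t)"
proof -
  have "(\<integral>\<^sup>+\<xi>. ennreal ((x \<xi> + y \<xi> + z \<xi>) powr t) \<partial>M)
    \<le> (\<integral>\<^sup>+\<xi>. ennreal (3 powr t) * (ennreal (x \<xi> powr t) + ennreal (y \<xi> powr t) + ennreal (z \<xi> powr t)) \<partial>M)"
    using powr_sum3_le[OF nonneg t]
    by (intro nn_integral_mono) (simp add: ennreal_leI flip: ennreal_mult ennreal_plus)
  also have "\<dots> = ennreal (3 powr t) * ((\<integral>\<^sup>+\<xi>. ennreal (x \<xi> powr t) \<partial>M) + (\<integral>\<^sup>+\<xi>. ennreal (y \<xi> powr t) \<partial>M) + (\<integral>\<^sup>+\<xi>. ennreal (z \<xi> powr t) \<partial>M))"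
    by (subst nn_integral_cmult, measurable, subst nn_integral_add, measurable, subst nn_integral_add) auto
  also have "\<dots> \<le> ennreal (3 powr t) * (1 + 1 + 1)"
    by (intro mult_left_mono add_mono le) auto
  also have "\<dots> = ennreal (3 * 3 powr t)" by (simp add: ennreal_mult mult.commute)
  finally show ?thesis .
qed

lemma sigma_finite_obtain_density:
  assumes "sigma_finite_measure M"
  obtains \<phi> :: "'a \<Rightarrow> real" where "\<phi> \<in> borel_measurable M" "\<And>x. 0 < \<phi> x" "(\<integral>\<^sup>+x. ennreal (\<phi> x) \<partial>M) \<le> 1"
proof -
  interpret sigma_finite_measure M by fact
  obtain f :: "'a \<Rightarrow> real" where f [measurable]: "f \<in> borel_measurable M" and f0: "\<And>x. 0 < f x" and int: "integrable M f"
    using obtain_positive_integrable_function by metis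
  define c where "c = (\<integral>x. f x \<partial>M)"
  have c0: "0 \<le> c" unfolding c_def using f0 by (intro Bochner_Integration.integral_nonneg) (simp add: less_imp_le)
  have If: "(\<integral>\<^sup>+x. ennreal (f x) \<partial>M) = ennreal c"
    unfolding c_def using int f0 by (intro nn_integral_eq_integral) (auto simp: less_imp_le)
  show ?thesis
  proof (rule that[of "\<lambda>x. f x / (1 + c)"])
    show "0 < f x / (1 + c)" for x using f0[of x] c0 by simp
    have "(\<integral>\<^sup>+x. ennreal (f x / (1 + c)) \<partial>M) = (\<integral>\<^sup>+x. ennreal (1 / (1 + c)) * ennreal (f x) \<partial>M)"
      using f0 c0 by (intro nn_integral_cong) (simp add: less_imp_le flip: ennreal_mult)
    also have "\<dots> = ennreal (1 / (1 + c)) * ennreal c" by (simp add: nn_integral_cmult If)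
    also have "\<dots> = ennreal (c / (1 + c))" using c0 by (simp flip: ennreal_mult)
    also have "\<dots> \<le> 1" using c0 by simp
    finally show "(\<integral>\<^sup>+x. ennreal (f x / (1 + c)) \<partial>M) \<le> 1" .
  qed measurable
qed

text \<open>
  The exponents \<open>q0\<close>, \<open>r0\<close> and \<open>p0\<close> as functions of \<open>s\<close> and \<open>i0 = 1 / r0\<close>.
\<close>

definition initial_q :: "real \<Rightarrow> real \<Rightarrow> ereal" where
  "initial_q s i0 = (if i0 = 0 then \<infinity> else ereal (s / i0))"

definition initial_r :: "real \<Rightarrow> ereal" where
  "initial_r i0 = (if i0 = 0 then \<infinity> else ereal (1 / i0))"

definition initial_p :: "real \<Rightarrow> real \<Rightarrow> ereal" where
  "initial_p s i0 = (if i0 = 0 \<and> s = 1 then \<infinity> else ereal (1 / (1 - (1 - i0) / s)))"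

text \<open>
  A common bound for the integrals of \<open>a^r'\<close> and \<open>b^r\<close>: each of \<open>a\<close> and \<open>b\<close> majorizes a sum of three functions of
  norm at most one, and the majorization costs a factor two.
\<close>

definition extrapolation_const :: "real \<Rightarrow> real" where
  "extrapolation_const r = 3 * 6 powr (r / (r - 1)) + 3 * 6 powr r"

lemma extrapolation_const_pos: "0 < extrapolation_const r"
  by (simp add: extrapolation_const_def add_pos_pos)

text \<open>
  From \<open>p0 \<ge> 1\<close> and the gap between the exponents follows \<open>q0 \<ge> s\<close>, so that \<open>i0 = s / q0\<close> is at most one.
\<close>

lemma exponent_relations:
  fixes p0 q0 r0 :: ereal and s :: real
  assumes s: "1 \<le> s" and p0: "1 \<le> p0" and pq: "p0 \<le> q0"
    and gap: "1 / p0 - 1 / q0 = 1 / conj_exp (ereal s)" and r0: "r0 = q0 / ereal s"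
  obtains i0 where "0 \<le> i0" "i0 \<le> 1" "q0 = initial_q s i0" "r0 = initial_r i0" "p0 = initial_p s i0"
    "real_of_ereal (1 / r0) = i0" "real_of_ereal (1 / conj_exp r0) = 1 - i0"
    "1 / p0 - 1 / q0 = ereal (1 - 1 / s)"
proof -
  have conj: "1 / conj_exp (ereal s) = ereal (1 - 1 / s)"
  proof (cases "s = 1")
    case False
    then have "1 < s" using s by simp
    then show ?thesis by (simp add: conj_exp_ereal one_ereal_def divide_ereal_def field_simps)
  qed (simp flip: one_ereal_def add: zero_ereal_def)
  show ?thesis
  proof (cases q0)
    case PInf
    have r0i: "r0 = \<infinity>" using s by (simp add: r0 PInf divide_ereal_def)
    have p0t: "p0 = initial_p s 0"
    proof (cases p0)
      case (real P)
      then have "1 \<le> P" using p0 by (simp add: one_ereal_def)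
      then have "1 / P = 1 - 1 / s" using gap unfolding conj PInf real by (simp add: one_ereal_def divide_ereal_def divide_inverse)
      moreover have "0 < 1 / P" using \<open>1 \<le> P\<close> by simp
      ultimately have "s \<noteq> 1" "1 / (1 / P) = 1 / (1 - 1 / s)" by auto
      then have "s \<noteq> 1" "P = 1 / (1 - 1 / s)" by simp_all
      then show ?thesis by (simp add: initial_p_def real)
    next
      case PInf': PInf
      have "ereal 0 = ereal (1 - 1 / s)" using gap unfolding conj PInf PInf' by (simp add: zero_ereal_def)
      then have "s = 1" using s by simp
      then show ?thesis by (simp add: initial_p_def PInf')
    qed (use p0 in auto)
    show ?thesis
      by (rule that[of 0]) (use gap conj PInf r0i p0t in \<open>auto simp: initial_q_def initial_r_def one_ereal_def\<close>)
  next
    case (real Q)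
    obtain P where P: "p0 = ereal P" using p0 pq real by (cases p0) auto
    have P1: "1 \<le> P" "P \<le> Q" using p0 pq by (simp_all add: P real one_ereal_def)
    have gap': "1 / P - 1 / Q = 1 - 1 / s"
      using gap P1 unfolding conj P real by (simp add: one_ereal_def divide_ereal_def divide_inverse)
    define i0 where "i0 = s / Q"
    have i00: "0 < i0" using s P1 by (simp add: i0_def)
    have "1 / P \<le> 1" using P1 by simp
    with gap' have "1 / Q \<le> 1 / s" by linarith
    then have "s \<le> Q" using s P1 by (simp add: field_simps)
    then have i01: "i0 \<le> 1" using s P1 by (simp add: i0_def)
    have sQ: "s / i0 = Q" "1 / i0 = Q / s" using s P1 by (auto simp: i0_def)
    have r0': "r0 = ereal (1 / i0)" using s unfolding sQ(2) by (simp add: r0 real)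
    have "i0 / s = 1 / Q" using s by (simp add: i0_def)
    then have "1 - (1 - i0) / s = 1 / P" using gap' by (simp add: diff_divide_distrib)
    then have p0t: "p0 = initial_p s i0" using i00 P1 by (simp add: initial_p_def P)
    have c: "real_of_ereal (1 / conj_exp r0) = 1 - i0"
    proof (cases "i0 = 1")
      case True
      then show ?thesis by (simp add: r0' flip: one_ereal_def)
    next
      case False
      then have "1 < 1 / i0" using i00 i01 by simp
      then have "conj_exp r0 = ereal ((1 / i0) / (1 / i0 - 1))" unfolding r0' by (rule conj_exp_ereal)
      also have "(1 / i0) / (1 / i0 - 1) = 1 / (1 - i0)" using i00 i01 False by (simp add: field_simps)
      finally show ?thesis using i01 False by (simp add: one_ereal_def divide_ereal_def)
    qed
    show ?thesis
    proof (rule that[of i0])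
      show "real_of_ereal (1 / r0) = i0" using i00 by (simp add: r0' one_ereal_def divide_ereal_def)
    qed (use i00 i01 sQ r0' p0t c gap conj real in \<open>auto simp: initial_q_def initial_r_def\<close>)
  qed (use p0 pq in auto)
qed

text \<open>
  Everything except the hypothesis of extrapolation itself: for a given pair there is a weight \<open>W0\<close> that
  belongs to the initial class with the right constant, and for which the norms in the initial
  inequality are comparable, each in the needed direction, to those in the target inequality.
\<close>

lemma extrapolation_weight:
  fixes n d :: nat and \<B> :: "(nat \<Rightarrow> real) set set" and K :: "nat \<Rightarrow> real \<Rightarrow> real \<Rightarrow> real"
    and r s p i0 :: real and W :: "(nat \<Rightarrow> real) \<Rightarrow> real mat" and f g :: "(nat \<Rightarrow> real) \<Rightarrow> real vec"
  defines "V \<equiv> \<lambda>x. mat_powr (W x) s" and "Vi \<equiv> \<lambda>x. mat_powr (W x) (- s)" and "r' \<equiv> r / (r - 1)"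
  assumes mb: "matrix_muckenhoupt_basis n \<B> K" and d: "1 \<le> d" and s: "1 \<le> s" and r: "1 < r" and p: "1 < p"
    and p_def: "1 / p = 1 / (r * s) + 1 - 1 / s" and i0: "0 \<le> i0" "i0 \<le> 1"
    and W: "matrix_weight n d W" and V: "V \<in> A_class n d \<B> (ereal r)"
    and f: "vec_measurable n d f" "\<not> (AE x in leb n. f x = 0\<^sub>v d)"
    and g: "vec_measurable n d g" "\<not> (AE x in leb n. g x = 0\<^sub>v d)"
    and fin_f: "weighted_norm n (ereal (r * s)) W f < top" and fin_g: "weighted_norm n (ereal p) W g < top"
  obtains W0 where "matrix_weight n d W0" "(\<lambda>x. mat_powr (W0 x) s) \<in> A_class n d \<B> (initial_r i0)"
    "A_const n \<B> (initial_r i0) (\<lambda>x. mat_powr (W0 x) s) \<le>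
      ennreal ((4 * real d ^ 3 + 1) * K d r' (enn2real (A_const n \<B> (ereal r') Vi)) powr i0 *
        K d r (enn2real (A_const n \<B> (ereal r) V)) powr (1 - i0))"
    "weighted_norm n (initial_q s i0) W0 f < top"
    "weighted_norm n (ereal (r * s)) W f \<le> ennreal (extrapolation_const r) * weighted_norm n (initial_q s i0) W0 f"
    "weighted_norm n (initial_p s i0) W0 g \<le> ennreal (extrapolation_const r) * weighted_norm n (ereal p) W g"
proof -
  let ?M = "leb n"
  have d0: "0 < d" using d by simp
  have r': "1 < r'" using r by (simp add: r'_def field_simps)
  have rr': "(r - 1) * r' = r" using r by (simp add: r'_def)
  have V_weight: "matrix_weight n d V" and V_fin: "A_const n \<B> (ereal r) V < top"
    using V by (auto simp: A_class_def)
  have Vi1: "AE x in ?M. Vi x = minv (V x)" and Vi2: "matrix_weight n d Vi"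
    using matrix_weight_dual[OF W V_weight[unfolded V_def]] by (simp_all add: V_def Vi_def)
  have sets: "B \<in> sets ?M" "emeasure ?M B < top" if "B \<in> \<B>" for B
    using mb basis_sets[of n \<B> B] that by (auto simp: matrix_muckenhoupt_basis_def)
  have "A_const n \<B> (ereal r') Vi < top"
    unfolding r'_def using A_const_dual_finite[OF d0 r _ V_weight V_fin Vi1] sets by blast
  then have Vi_class: "Vi \<in> A_class n d \<B> (ereal r')" using Vi2 by (simp add: A_class_def)
  interpret mV: muckenhoupt_weight n d \<B> K r V
    using mb d r V by unfold_locales
  interpret mVi: muckenhoupt_weight n d \<B> K r' Vi
    using mb d r' Vi_class by unfold_locales
  define F G where "F = (\<lambda>x. vnorm (W x *\<^sub>v f x))" and "G = (\<lambda>x. vnorm (W x *\<^sub>v g x))"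
  have [measurable]: "F \<in> borel_measurable ?M" "G \<in> borel_measurable ?M"
    unfolding F_def G_def by (rule weighted_vnorm_measurable[OF W f(1)], rule weighted_vnorm_measurable[OF W g(1)])
  have F0: "0 \<le> F x" and G0: "0 \<le> G x" for x by (auto simp: F_def G_def)
  have "0 < r * s" "0 < p" using r s p by auto
  obtain X where X: "0 < X" "weighted_norm n (ereal (r * s)) W f = ennreal X"
    "(\<integral>\<^sup>+x. ennreal (F x powr (r * s)) \<partial>?M) = ennreal (X powr (r * s))"
    unfolding F_def by (rule weighted_norm_positive[OF W f \<open>0 < r * s\<close> fin_f])
  obtain Y where Y: "0 < Y" "weighted_norm n (ereal p) W g = ennreal Y"
    "(\<integral>\<^sup>+x. ennreal (G x powr p) \<partial>?M) = ennreal (Y powr p)"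
    unfolding G_def by (rule weighted_norm_positive[OF W g \<open>0 < p\<close> fin_g])
  obtain \<phi> where [measurable]: "\<phi> \<in> borel_measurable ?M" and \<phi>0: "\<And>x. 0 < \<phi> x"
    and \<phi>1: "(\<integral>\<^sup>+x. ennreal (\<phi> x) \<partial>?M) \<le> 1"
    using sigma_finite_obtain_density[OF sigma_finite_leb[of n]] by blast
  have normalized: "(\<integral>\<^sup>+x. ennreal ((H x / Z) powr t) \<partial>?M) \<le> 1"
    if [measurable]: "H \<in> borel_measurable ?M" and Z: "0 < Z" and int: "(\<integral>\<^sup>+x. ennreal (H x powr t) \<partial>?M) = ennreal (Z powr t)"
      for H :: "(nat \<Rightarrow> real) \<Rightarrow> real" and Z t
  proof -
    have "(\<integral>\<^sup>+x. ennreal ((H x / Z) powr t) \<partial>?M) = (\<integral>\<^sup>+x. ennreal (1 / Z powr t) * ennreal (H x powr t) \<partial>?M)"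
      by (intro nn_integral_cong) (simp add: powr_divide flip: ennreal_mult)
    also have "\<dots> = ennreal (1 / Z powr t) * ennreal (Z powr t)" by (simp add: nn_integral_cmult int)
    also have "\<dots> = 1" using Z by (simp flip: ennreal_mult)
    finally show ?thesis by simp
  qed
  have FX: "(\<integral>\<^sup>+x. ennreal ((F x / X) powr (r * s)) \<partial>?M) \<le> 1" by (rule normalized[OF _ X(1,3)]) measurable
  have GY: "(\<integral>\<^sup>+x. ennreal ((G x / Y) powr p) \<partial>?M) \<le> 1" by (rule normalized[OF _ Y(1,3)]) measurable
  (* The function phi is added to make h1 and h2 strictly positive, as the weight built from
     their majorants has to be invertible; the zero in h1 makes both sums of three terms. *)
  define h1 where "h1 = (\<lambda>x. (F x / X) powr (r * s - s) + 0 + \<phi> x powr (1 / r'))"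
  define h2 where "h2 = (\<lambda>x. (F x / X) powr s + (G x / Y) powr (p / r) + \<phi> x powr (1 / r))"
  have h_meas [measurable]: "h1 \<in> borel_measurable ?M" "h2 \<in> borel_measurable ?M"
    unfolding h1_def h2_def by measurable
  have h1_pos: "0 < h1 x" and h2_pos: "0 < h2 x" for x
    using \<phi>0[of x] by (auto simp: h1_def h2_def intro!: add_nonneg_pos)
  have h1_int: "(\<integral>\<^sup>+x. ennreal (h1 x powr r') \<partial>?M) \<le> ennreal (3 * 3 powr r')"
    unfolding h1_def
  proof (rule nn_integral_powr_sum3_le)
    have "(r * s - s) * r' = s * ((r - 1) * r')" by (simp add: algebra_simps)
    then have "(r * s - s) * r' = r * s" unfolding rr' by simp
    then show "(\<integral>\<^sup>+x. ennreal (((F x / X) powr (r * s - s)) powr r') \<partial>?M) \<le> 1"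
      using FX unfolding powr_powr by simp
    show "(\<integral>\<^sup>+x. ennreal ((\<phi> x powr (1 / r')) powr r') \<partial>?M) \<le> 1"
      using \<phi>1 \<phi>0 r' by (simp add: powr_powr less_imp_le)
  qed (use r' in auto)
  have h2_int: "(\<integral>\<^sup>+x. ennreal (h2 x powr r) \<partial>?M) \<le> ennreal (3 * 3 powr r)"
    unfolding h2_def
  proof (rule nn_integral_powr_sum3_le)
    show "(\<integral>\<^sup>+x. ennreal (((F x / X) powr s) powr r) \<partial>?M) \<le> 1"
      using FX unfolding powr_powr by (simp add: mult.commute)
    show "(\<integral>\<^sup>+x. ennreal (((G x / Y) powr (p / r)) powr r) \<partial>?M) \<le> 1"
      using GY r unfolding powr_powr by simp
    show "(\<integral>\<^sup>+x. ennreal ((\<phi> x powr (1 / r)) powr r) \<partial>?M) \<le> 1"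
      using \<phi>1 \<phi>0 r by (simp add: powr_powr less_imp_le)
  qed (use r in auto)
  have h1_fin: "(\<integral>\<^sup>+x. ennreal (h1 x powr r') \<partial>?M) < top" and h2_fin: "(\<integral>\<^sup>+x. ennreal (h2 x powr r) \<partial>?M) < top"
    using h1_int h2_int by (auto intro: le_less_trans)
  obtain a where a_meas [measurable]: "a \<in> borel_measurable ?M" and a0: "\<And>x. 0 < a x" and ha: "AE x in ?M. h1 x \<le> a x"
    and a_int: "(\<integral>\<^sup>+x. ennreal (a x powr r') \<partial>?M) \<le> ennreal (2 powr r') * (\<integral>\<^sup>+x. ennreal (h1 x powr r') \<partial>?M)"
    and a_A1: "AE x in ?M. \<forall>B\<in>\<B>. x \<in> B \<longrightarrow> avg ?M B (\<lambda>y. ennreal (weight_kernel Vi x y) * ennreal (a y)) \<le> ennreal (2 * (real d ^ 2 * mVi.\<kappa>)) * ennreal (a x)"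
    by (rule mVi.majorant[OF h_meas(1) h1_pos h1_fin], rule that)
  obtain b where b_meas [measurable]: "b \<in> borel_measurable ?M" and b0: "\<And>x. 0 < b x" and hb: "AE x in ?M. h2 x \<le> b x"
    and b_int: "(\<integral>\<^sup>+x. ennreal (b x powr r) \<partial>?M) \<le> ennreal (2 powr r) * (\<integral>\<^sup>+x. ennreal (h2 x powr r) \<partial>?M)"
    and b_A1: "AE x in ?M. \<forall>B\<in>\<B>. x \<in> B \<longrightarrow> avg ?M B (\<lambda>y. ennreal (weight_kernel V x y) * ennreal (b y)) \<le> ennreal (2 * (real d ^ 2 * mV.\<kappa>)) * ennreal (b x)"
    by (rule mV.majorant[OF h_meas(2) h2_pos h2_fin], rule that)
  define D where "D = extrapolation_const r"
  have six: "2 powr t * (3 * 3 powr t) = 3 * 6 powr t" for t :: real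
    using powr_mult[of 2 3 t] by simp
  have "1 \<le> (6::real) powr r" using powr_mono[of 0 r 6] r by simp
  then have D1: "1 \<le> D" unfolding D_def extrapolation_const_def using powr_ge_zero[of 6 "r / (r - 1)"] by linarith
  have "(\<integral>\<^sup>+x. ennreal (a x powr r') \<partial>?M) \<le> ennreal (2 powr r') * ennreal (3 * 3 powr r')"
    using a_int h1_int by (meson mult_left_mono order_trans zero_le)
  also have "\<dots> = ennreal (3 * 6 powr r')" by (simp add: six flip: ennreal_mult)
  also have "\<dots> \<le> ennreal D" by (intro ennreal_leI) (simp add: D_def extrapolation_const_def r'_def)
  finally have a_int': "(\<integral>\<^sup>+x. ennreal (a x powr (r / (r - 1))) \<partial>?M) \<le> ennreal D" by (simp add: r'_def)
  have "(\<integral>\<^sup>+x. ennreal (b x powr r) \<partial>?M) \<le> ennreal (2 powr r) * ennreal (3 * 3 powr r)"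
    using b_int h2_int by (meson mult_left_mono order_trans zero_le)
  also have "\<dots> = ennreal (3 * 6 powr r)" by (simp add: six flip: ennreal_mult)
  also have "\<dots> \<le> ennreal D" by (intro ennreal_leI) (simp add: D_def extrapolation_const_def)
  finally have b_int': "(\<integral>\<^sup>+x. ennreal (b x powr r) \<partial>?M) \<le> ennreal D" .
  interpret em: extrapolation_majorants ?M F G a b X Y D r s p i0
  proof
    show "AE x in ?M. F x \<le> X * b x powr (1 / s)"
      using hb
    proof eventually_elim
      case (elim x)
      have "(F x / X) powr s \<le> b x" using elim unfolding h2_def by (smt (verit) powr_ge_zero)
      then have "((F x / X) powr s) powr (1 / s) \<le> b x powr (1 / s)" using s by (intro powr_mono2) auto
      moreover have "((F x / X) powr s) powr (1 / s) = F x / X" using s X(1) F0[of x] by (simp add: powr_powr)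
      ultimately show ?case using X(1) by (simp add: field_simps)
    qed
    show "AE x in ?M. F x powr (r * s - s) \<le> X powr (r * s - s) * a x"
      using ha
    proof eventually_elim
      case (elim x)
      have "(F x / X) powr (r * s - s) \<le> a x" using elim unfolding h1_def by (smt (verit) powr_ge_zero)
      then show ?case using X(1) by (simp add: powr_divide field_simps)
    qed
    show "AE x in ?M. G x \<le> Y * b x powr (r / p)"
      using hb
    proof eventually_elim
      case (elim x)
      have "(G x / Y) powr (p / r) \<le> b x" using elim unfolding h2_def by (smt (verit) powr_ge_zero)
      then have "((G x / Y) powr (p / r)) powr (r / p) \<le> b x powr (r / p)" using r p by (intro powr_mono2) auto
      moreover have "((G x / Y) powr (p / r)) powr (r / p) = G x / Y" using r p Y(1) G0[of x] by (simp add: powr_powr)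
      ultimately show ?case using Y(1) by (simp add: field_simps)
    qed
  qed (use F0 G0 a0 b0 r s p p_def i0 X(1,3) Y(1) D1 a_int' b_int' in auto)
  define W0 where "W0 = (\<lambda>x. em.\<omega> x \<cdot>\<^sub>m W x)"
  have W0_weight: "matrix_weight n d W0"
    by (rule matrix_weight_scale[OF W em.omega_measurable em.omega_pos]) (simp add: W0_def)
  define V0 where "V0 = (\<lambda>x. mat_powr (W0 x) s)"
  define w where "w = (\<lambda>x. a x powr i0 * b x powr (- (1 - i0)))"
  have [measurable]: "w \<in> borel_measurable ?M" unfolding w_def by measurable
  have w0: "0 < w x" for x using a0[of x] b0[of x] by (simp add: w_def)
  have V0: "V0 x = w x \<cdot>\<^sub>m V x" if "x \<in> space ?M" for x
  proof -
    have "V0 x = (em.\<omega> x powr s) \<cdot>\<^sub>m mat_powr (W x) s"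
      unfolding V0_def W0_def using em.omega_pos[of x] by (intro mat_powr_smult[OF matrix_weightD(1)[OF W that]]) simp
    also have "em.\<omega> x powr s = w x"
    proof -
      have "em.\<omega> x = w x powr (1 / s)" by (simp only: em.\<omega>_def w_def)
      then show ?thesis using s w0[of x] by (simp add: powr_powr)
    qed
    finally show ?thesis by (simp add: V_def)
  qed
  have V0_weight: "matrix_weight n d V0"
    by (rule matrix_weight_scale[OF V_weight _ w0 V0]) measurable
  have A_le: "A_const n \<B> (initial_r i0) V0 \<le> ennreal ((4 * real d ^ 3 + 1) * mVi.\<kappa> powr i0 * mV.\<kappa> powr (1 - i0))"
  proof (cases "\<exists>B\<in>\<B>. emeasure ?M B \<noteq> 0")
    case False
    then have "A_const n \<B> (initial_r i0) V0 = 0" using sets by (intro A_const_null) auto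
    then show ?thesis by simp
  next
    case True
    then obtain B where B: "B \<in> \<B>" "emeasure ?M B \<noteq> 0" by blast
    have \<kappa>: "0 < mV.\<kappa>" "0 < mVi.\<kappa>"
      using mV.kappa_pos[OF B, of "\<lambda>x. ennreal (h2 x)"] mVi.kappa_pos[OF B, of "\<lambda>x. ennreal (h1 x)"]
        h1_pos h2_pos h1_fin h2_fin by (auto simp: epowr_ennreal less_imp_le)
    interpret fw: factored_weight n d \<B> V Vi V0 a b "2 * (real d ^ 2 * mVi.\<kappa>)" "2 * (real d ^ 2 * mV.\<kappa>)" i0
      using d0 sets V_weight V0_weight Vi1 a0 b0 \<kappa> a_A1 b_A1 i0 V0
      by unfold_locales (auto simp: w_def)
    have "A_const n \<B> (initial_r i0) V0 \<le> ennreal fw.R"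
    proof -
      consider "i0 = 0" | "i0 = 1" | "0 < i0" "i0 < 1" using i0 by linarith
      then show ?thesis
      proof cases
        case 1 then show ?thesis using fw.A_const_infinity by (simp add: initial_r_def)
      next
        case 2 then show ?thesis using fw.A_const_one by (simp add: initial_r_def flip: one_ereal_def)
      next
        case 3 then show ?thesis using fw.A_const_interior[of "1 / i0"] by (simp add: initial_r_def)
      qed
    qed
    also have "fw.R = 4 * real d ^ 3 * mVi.\<kappa> powr i0 * mV.\<kappa> powr (1 - i0)"
    proof -
      have split: "(c * x) powr i0 * (c * y) powr (1 - i0) = c * (x powr i0 * y powr (1 - i0))" if "0 < c" for c x y :: real
      proof -
        have "(c * x) powr i0 * (c * y) powr (1 - i0) = (c powr i0 * c powr (1 - i0)) * (x powr i0 * y powr (1 - i0))"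
          by (simp add: powr_mult mult_ac)
        also have "c powr i0 * c powr (1 - i0) = c" using that by (simp flip: powr_add)
        finally show ?thesis .
      qed
      have "fw.R = 2 * real d * ((2 * real d ^ 2 * mVi.\<kappa>) powr i0 * (2 * real d ^ 2 * mV.\<kappa>) powr (1 - i0))"
        unfolding fw.R_def by (simp add: mult.assoc)
      also have "\<dots> = 2 * real d * (2 * real d ^ 2 * (mVi.\<kappa> powr i0 * mV.\<kappa> powr (1 - i0)))"
        using d0 by (subst split) auto
      finally show ?thesis by (simp add: power2_eq_square power3_eq_cube)
    qed
    also have "ennreal \<dots> \<le> ennreal ((4 * real d ^ 3 + 1) * mVi.\<kappa> powr i0 * mV.\<kappa> powr (1 - i0))"
      by (intro ennreal_leI mult_right_mono) auto
    finally show ?thesis .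
  qed
  have norm_eq: "weighted_norm n t W0 h = Lp_norm ?M t (\<lambda>x. ennreal (em.\<omega> x * vnorm (W x *\<^sub>v h x)))"
    if h: "vec_measurable n d h" for t h
    unfolding weighted_norm_def
  proof (rule Lp_norm_cong)
    fix x assume x: "x \<in> space ?M"
    have "h x \<in> carrier_vec d" using h x by (simp add: vec_measurable_def)
    then show "ennreal (vnorm (W0 x *\<^sub>v h x)) = ennreal (em.\<omega> x * vnorm (W x *\<^sub>v h x))"
      using em.omega_pos[of x] by (simp add: W0_def smult_mat_mult_mat_vec[OF matrix_weightD(2)[OF W x]] vnorm_smult)
  next
    note [measurable] = weighted_vnorm_measurable[OF W h]
    show "(\<lambda>x. ennreal (em.\<omega> x * vnorm (W x *\<^sub>v h x))) \<in> borel_measurable ?M" by measurable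
  qed
  have f_eq: "weighted_norm n t W0 f = Lp_norm ?M t (\<lambda>x. ennreal (em.\<omega> x * F x))" for t
    unfolding F_def by (rule norm_eq[OF f(1)])
  have g_eq: "weighted_norm n t W0 g = Lp_norm ?M t (\<lambda>x. ennreal (em.\<omega> x * G x))" for t
    unfolding G_def by (rule norm_eq[OF g(1)])
  show ?thesis
  proof (rule that[of W0])
    show "matrix_weight n d W0" by (rule W0_weight)
    show "A_const n \<B> (initial_r i0) (\<lambda>x. mat_powr (W0 x) s) \<le>
      ennreal ((4 * real d ^ 3 + 1) * K d r' (enn2real (A_const n \<B> (ereal r') Vi)) powr i0 *
        K d r (enn2real (A_const n \<B> (ereal r) V)) powr (1 - i0))"
      using A_le by (simp add: V0_def mV.\<kappa>_def mVi.\<kappa>_def)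
    show "(\<lambda>x. mat_powr (W0 x) s) \<in> A_class n d \<B> (initial_r i0)"
      using V0_weight le_less_trans[OF A_le] by (simp add: A_class_def V0_def)
    show "weighted_norm n (initial_q s i0) W0 f < top"
      unfolding f_eq initial_q_def using em.lower_endpoint(1) em.lower_interior(1) i0 by simp
    show "weighted_norm n (ereal (r * s)) W f \<le> ennreal (extrapolation_const r) * weighted_norm n (initial_q s i0) W0 f"
      unfolding f_eq initial_q_def X(2) D_def[symmetric] using em.lower_endpoint(2) em.lower_interior(2) i0 by simp
    show "weighted_norm n (initial_p s i0) W0 g \<le> ennreal (extrapolation_const r) * weighted_norm n (ereal p) W g"
      unfolding g_eq initial_p_def Y(2) D_def[symmetric]
    proof (cases "i0 = 0 \<and> s = 1")
      case False
      have "(1 - i0) / s < 1"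
      proof (cases "i0 = 0")
        case True then show ?thesis using False s by simp
      next
        case False then show ?thesis using i0 s by (simp add: divide_less_eq)
      qed
      then show "Lp_norm ?M (if i0 = 0 \<and> s = 1 then \<infinity> else ereal (1 / (1 - (1 - i0) / s))) (\<lambda>x. ennreal (em.\<omega> x * G x)) \<le> ennreal D * ennreal Y"
        unfolding if_not_P[OF False] by (intro em.upper_interior) auto
    qed (use em.upper_endpoint in auto)
  qed
qed

theorem theorem4p1:
  shows "\<exists>(C1 :: nat \<Rightarrow> ereal \<Rightarrow> ereal \<Rightarrow> real \<Rightarrow> real \<Rightarrow> real) (C2 :: nat \<Rightarrow> ereal \<Rightarrow> ereal \<Rightarrow> real).
    (\<forall>d p0 q0 p q. 0 < C1 d p0 q0 p q) \<and> (\<forall>d p0 q0. 0 < C2 d p0 q0) \<and>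
    (\<forall>(n::nat) (d::nat) \<B> K \<F> (s::real) (p0::ereal) (q0::ereal) (r0::ereal) (N :: real \<Rightarrow> real).
      1 \<le> n \<and> 1 \<le> d \<and>
      matrix_muckenhoupt_basis n \<B> K \<and>
      extrapolation_pairs n d \<F> \<and>
      1 \<le> s \<and>
      1 \<le> p0 \<and> p0 \<le> q0 \<and>
      1 / p0 - 1 / q0 = 1 / conj_exp (ereal s) \<and>
      r0 = q0 / ereal s \<and>
      mono_on {0..} N \<and> (\<forall>t\<ge>0. 0 < N t) \<and>
      (\<forall>W0. matrix_weight n d W0 \<and> (\<lambda>x. mat_powr (W0 x) s) \<in> A_class n d \<B> r0 \<longrightarrow>
         pairs_ineq n \<F> W0 p0 q0 (N (enn2real (A_const n \<B> r0 (\<lambda>x. mat_powr (W0 x) s)))))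
      \<longrightarrow>
      (\<forall>(p::real) (q::real) (r::real) (r'::real) W.
         1 < p \<and> p \<le> q \<and>
         ereal (1 / p - 1 / q) = 1 / p0 - 1 / q0 \<and>
         r = q / s \<and>
         ereal r' = conj_exp (ereal r) \<and>
         matrix_weight n d W \<and> (\<lambda>x. mat_powr (W x) s) \<in> A_class n d \<B> (ereal r)
         \<longrightarrow>
         pairs_ineq n \<F> W (ereal p) (ereal q)
           (C1 d p0 q0 p q *
            N (C2 d p0 q0 *
               K d r' (enn2real (A_const n \<B> (ereal r') (\<lambda>x. mat_powr (W x) (- s))))
                 powr real_of_ereal (1 / r0) *
               K d r (enn2real (A_const n \<B> (ereal r) (\<lambda>x. mat_powr (W x) s)))
                 powr real_of_ereal (1 / conj_exp r0)))))"
proof (rule exI[of _ "\<lambda>d p0 q0 p q. (extrapolation_const (1 + q - q / p))\<^sup>2"],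
    rule exI[of _ "\<lambda>d p0 q0. 4 * real d ^ 3 + 1"], intro conjI allI impI; (elim conjE)?)
  show "0 < (extrapolation_const (1 + q - q / p))\<^sup>2" for p q :: real
    using extrapolation_const_pos[of "1 + q - q / p"] by simp
  show "0 < 4 * real d ^ 3 + 1" for d :: nat by (simp add: add_nonneg_pos)
next
  fix n d :: nat and \<B> :: "(nat \<Rightarrow> real) set set" and K :: "nat \<Rightarrow> real \<Rightarrow> real \<Rightarrow> real"
    and \<F> :: "(((nat \<Rightarrow> real) \<Rightarrow> real vec) \<times> ((nat \<Rightarrow> real) \<Rightarrow> real vec)) set"
    and s :: real and p0 q0 r0 :: ereal and N :: "real \<Rightarrow> real"
    and p q r r' :: real and W :: "(nat \<Rightarrow> real) \<Rightarrow> real mat"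
  assume d: "1 \<le> d" and mb: "matrix_muckenhoupt_basis n \<B> K" and pairs: "extrapolation_pairs n d \<F>"
    and s: "1 \<le> s" and p0: "1 \<le> p0" "p0 \<le> q0" and gap: "1 / p0 - 1 / q0 = 1 / conj_exp (ereal s)"
    and r0: "r0 = q0 / ereal s" and N_mono: "mono_on {0..} N" and N_pos: "\<forall>t\<ge>0. 0 < N t"
    and hyp: "\<forall>W0. matrix_weight n d W0 \<and> (\<lambda>x. mat_powr (W0 x) s) \<in> A_class n d \<B> r0 \<longrightarrow>
         pairs_ineq n \<F> W0 p0 q0 (N (enn2real (A_const n \<B> r0 (\<lambda>x. mat_powr (W0 x) s))))"
    and p: "1 < p" "p \<le> q" and pq: "ereal (1 / p - 1 / q) = 1 / p0 - 1 / q0" and r_def: "r = q / s"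
    and r'_def: "ereal r' = conj_exp (ereal r)"
    and W: "matrix_weight n d W" and V: "(\<lambda>x. mat_powr (W x) s) \<in> A_class n d \<B> (ereal r)"
  (* The initial exponents enter only through i0 = 1 / r0; the constant C1 is a function of p and q
     alone because r = 1 + q - q / p. *)
  obtain i0 where i0: "0 \<le> i0" "i0 \<le> 1" "q0 = initial_q s i0" "r0 = initial_r i0" "p0 = initial_p s i0"
    and i0_r0: "real_of_ereal (1 / r0) = i0" "real_of_ereal (1 / conj_exp r0) = 1 - i0"
    and gap': "1 / p0 - 1 / q0 = ereal (1 - 1 / s)"
    by (rule exponent_relations[OF s p0 gap r0])
  have pq': "1 / p - 1 / q = 1 - 1 / s" using pq gap' by simp
  have q: "q = r * s" using s by (simp add: r_def)
  have p_def: "1 / p = 1 / (r * s) + 1 - 1 / s" using pq' by (simp add: q)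
  have r: "1 < r"
  proof -
    have "1 / p < 1" using p by simp
    with pq' have "1 / q < 1 / s" by linarith
    then show ?thesis using p s by (simp add: r_def field_simps)
  qed
  have r_eq: "1 + q - q / p = r"
  proof -
    have "q / p = q * (1 / p)" by simp
    also have "1 / p = 1 / q + 1 - 1 / s" using pq' by simp
    also have "q * (1 / q + 1 - 1 / s) = 1 + q - r" using p by (simp add: r_def algebra_simps)
    finally show ?thesis by simp
  qed
  have r': "r' = r / (r - 1)" using r'_def conj_exp_ereal[OF r] by simp
  (* The argument of N in the conclusion. *)
  define \<rho> where "\<rho> = (4 * real d ^ 3 + 1) * K d r' (enn2real (A_const n \<B> (ereal r') (\<lambda>x. mat_powr (W x) (- s)))) powr i0 *
        K d r (enn2real (A_const n \<B> (ereal r) (\<lambda>x. mat_powr (W x) s))) powr (1 - i0)"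
  have \<rho>0: "0 \<le> \<rho>" by (simp add: \<rho>_def)
  have N\<rho>: "0 < N \<rho>" using N_pos \<rho>0 by simp
  have D0: "0 < extrapolation_const r" by (rule extrapolation_const_pos)
  have "pairs_ineq n \<F> W (ereal p) (ereal q) ((extrapolation_const r)\<^sup>2 * N \<rho>)"
    unfolding pairs_ineq_def
  proof (intro ballI, clarify)
    fix f g assume fg: "(f, g) \<in> \<F>" and fin: "weighted_norm n (ereal q) W f < \<infinity>"
    have f: "vec_measurable n d f" "\<not> (AE x in leb n. f x = 0\<^sub>v d)"
      and g: "vec_measurable n d g" "\<not> (AE x in leb n. g x = 0\<^sub>v d)"
      using pairs fg unfolding extrapolation_pairs_def by auto
    show "weighted_norm n (ereal q) W f \<le> ennreal ((extrapolation_const r)\<^sup>2 * N \<rho>) * weighted_norm n (ereal p) W g"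
    proof (cases "weighted_norm n (ereal p) W g = top")
      case True
      then show ?thesis using D0 N\<rho> by (simp add: ennreal_mult_top)
    next
      case False
      then have fin_g: "weighted_norm n (ereal p) W g < top" by (simp add: less_top)
      have fin_f: "weighted_norm n (ereal (r * s)) W f < top" using fin by (simp add: q)
      obtain W0 where W0: "matrix_weight n d W0" "(\<lambda>x. mat_powr (W0 x) s) \<in> A_class n d \<B> r0"
        and A_le: "A_const n \<B> r0 (\<lambda>x. mat_powr (W0 x) s) \<le> ennreal \<rho>"
        and lower: "weighted_norm n q0 W0 f < top"
          "weighted_norm n (ereal q) W f \<le> ennreal (extrapolation_const r) * weighted_norm n q0 W0 f"
        and upper: "weighted_norm n p0 W0 g \<le> ennreal (extrapolation_const r) * weighted_norm n (ereal p) W g"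
        unfolding i0(3-5) \<rho>_def r' q
        by (rule extrapolation_weight[OF mb d s r p(1) p_def i0(1,2) W V f g fin_f fin_g])
      have "enn2real (A_const n \<B> r0 (\<lambda>x. mat_powr (W0 x) s)) \<le> \<rho>"
        using enn2real_mono[OF A_le] \<rho>0 by simp
      then have "N (enn2real (A_const n \<B> r0 (\<lambda>x. mat_powr (W0 x) s))) \<le> N \<rho>"
        using \<rho>0 by (intro mono_onD[OF N_mono]) auto
      moreover have "weighted_norm n q0 W0 f \<le> ennreal (N (enn2real (A_const n \<B> r0 (\<lambda>x. mat_powr (W0 x) s)))) * weighted_norm n p0 W0 g"
        using hyp W0 fg lower(1) unfolding pairs_ineq_def by fastforce
      ultimately have "weighted_norm n q0 W0 f \<le> ennreal (N \<rho>) * weighted_norm n p0 W0 g"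
        by (meson ennreal_leI mult_right_mono order_trans zero_le)
      also have "\<dots> \<le> ennreal (N \<rho>) * (ennreal (extrapolation_const r) * weighted_norm n (ereal p) W g)"
        by (intro mult_left_mono upper) auto
      finally have "ennreal (extrapolation_const r) * weighted_norm n q0 W0 f
        \<le> ennreal (extrapolation_const r) * (ennreal (N \<rho>) * (ennreal (extrapolation_const r) * weighted_norm n (ereal p) W g))"
        by (intro mult_left_mono) auto
      also have "\<dots> = ennreal ((extrapolation_const r)\<^sup>2 * N \<rho>) * weighted_norm n (ereal p) W g"
        using D0 N\<rho> by (simp add: power2_eq_square ennreal_mult mult_ac)
      finally show ?thesis using lower(2) by (rule order_trans[rotated])
    qed
  qed
  then show "pairs_ineq n \<F> W (ereal p) (ereal q)
           ((extrapolation_const (1 + q - q / p))\<^sup>2 *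
            N ((4 * real d ^ 3 + 1) *
               K d r' (enn2real (A_const n \<B> (ereal r') (\<lambda>x. mat_powr (W x) (- s))))
                 powr real_of_ereal (1 / r0) *
               K d r (enn2real (A_const n \<B> (ereal r) (\<lambda>x. mat_powr (W x) s)))
                 powr real_of_ereal (1 / conj_exp r0)))"
    by (simp only: r_eq i0_r0 \<rho>_def)
qed

end
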